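(* Let $G$ be a bridgeless connected graph with $d(G)=4$ and maximum edge girth $g^*(G)\in\{6,7,8\}$. Then there is an orientation $\overrightarrow{G}$ of $G$ with $d(\overrightarrow{G})\le 13$. Consequently the oriented diameter satisfies $\overrightarrow{diam}(G)\le 13$.
   Context: Graphs are finite, connected, without loops (parallel edges allowed). $d(G)$ is the diameter of $G$. $G$ is bridgeless if no edge deletion disconnects it. For an edge $e$, the edge girth $l_G(e)$ is the length of a shortest cycle containing $e$, and $g^*(G)=\max\{l_G(e):e\in E(G)\}$. For an orientation $\overrightarrow{G}$ of $G$, $\partial(u,v)$ is the length of a shortest directed $u$–$v$ path and $d(\overrightarrow{G})=\max_{u,v}\partial(u,v)$. The oriented diameter $\overrightarrow{diam}(G)$ is the minimum of $d(\overrightarrow{G})$ over all strongly connected orientations $\overrightarrow{G}$ of $G$. *)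

theory Defs
  imports "Graph_Theory.Digraph_Component" "HOL-Library.Extended_Nat"
begin

text \<open>
  Undirected multigraphs. Edges are objects of their own, so that parallel edges can be
  distinguished; the symmetric digraphs of \<open>Graph_Theory\<close> neither identify the two directions
  of an edge nor exclude \<open>a, b, a\<close> as a cycle. Directed notions are those of \<open>Graph_Theory\<close>.
\<close>

record ('v, 'e) mgraph =
  mverts :: "'v set"
  medges :: "'e set"
  ends :: "'e \<Rightarrow> 'v set"

locale multigraph =
  fixes G :: "('v, 'e) mgraph"
  assumes finite_mverts: "finite (mverts G)"
    and finite_medges: "finite (medges G)"
    and ends_two: "e \<in> medges G \<Longrightarrow> \<exists>u\<in>mverts G. \<exists>v\<in>mverts G. u \<noteq> v \<and> ends G e = {u, v}"

text \<open>A walk is given by its vertex sequence together with its edge sequence.\<close>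

definition mwalk :: "('v, 'e) mgraph \<Rightarrow> 'v list \<Rightarrow> 'e list \<Rightarrow> bool" where
  "mwalk G vs es \<longleftrightarrow>
     length vs = Suc (length es) \<and> set vs \<subseteq> mverts G \<and> set es \<subseteq> medges G \<and>
     (\<forall>i<length es. ends G (es ! i) = {vs ! i, vs ! Suc i})"

definition mpath :: "('v, 'e) mgraph \<Rightarrow> 'v \<Rightarrow> 'v list \<Rightarrow> 'e list \<Rightarrow> 'v \<Rightarrow> bool" where
  "mpath G u vs es v \<longleftrightarrow> mwalk G vs es \<and> hd vs = u \<and> last vs = v \<and> distinct vs"

text \<open>
  Two parallel edges form a cycle of length 2; \<open>distinct es\<close> only serves to rule out going
  back and forth along a single edge.
\<close>

definition mcycle :: "('v, 'e) mgraph \<Rightarrow> 'v list \<Rightarrow> 'e list \<Rightarrow> bool" where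
  "mcycle G vs es \<longleftrightarrow>
     mwalk G vs es \<and> es \<noteq> [] \<and> hd vs = last vs \<and> distinct (tl vs) \<and> distinct es"

definition mconnected :: "('v, 'e) mgraph \<Rightarrow> bool" where
  "mconnected G \<longleftrightarrow>
     mverts G \<noteq> {} \<and> (\<forall>u\<in>mverts G. \<forall>v\<in>mverts G. \<exists>vs es. mpath G u vs es v)"

definition del_edge :: "('v, 'e) mgraph \<Rightarrow> 'e \<Rightarrow> ('v, 'e) mgraph" where
  "del_edge G e = G\<lparr>medges := medges G - {e}\<rparr>"

definition bridgeless :: "('v, 'e) mgraph \<Rightarrow> bool" where
  "bridgeless G \<longleftrightarrow> (\<forall>e\<in>medges G. mconnected (del_edge G e))"

text \<open>
  Lengths are extended naturals: a minimum over no paths, cycles or orientations is \<open>\<infinity>\<close>.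
  Over a nonempty set \<open>INF\<close> is an attained minimum, over a finite nonempty set \<open>SUP\<close> is a maximum.
\<close>

definition mdist :: "('v, 'e) mgraph \<Rightarrow> 'v \<Rightarrow> 'v \<Rightarrow> enat" where
  "mdist G u v = (INF (vs, es)\<in>{(vs, es). mpath G u vs es v}. enat (length es))"

definition mdiameter :: "('v, 'e) mgraph \<Rightarrow> enat" where
  "mdiameter G = (SUP u\<in>mverts G. SUP v\<in>mverts G. mdist G u v)"

definition edge_girth :: "('v, 'e) mgraph \<Rightarrow> 'e \<Rightarrow> enat" where
  "edge_girth G e = (INF (vs, es)\<in>{(vs, es). mcycle G vs es \<and> e \<in> set es}. enat (length es))"

definition max_edge_girth :: "('v, 'e) mgraph \<Rightarrow> enat" where
  "max_edge_girth G = (SUP e\<in>medges G. edge_girth G e)"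

definition orientation :: "('v, 'e) mgraph \<Rightarrow> ('v, 'e) pre_digraph \<Rightarrow> bool" where
  "orientation G D \<longleftrightarrow>
     verts D = mverts G \<and> arcs D = medges G \<and>
     (\<forall>e\<in>medges G. {tail D e, head D e} = ends G e)"

definition ddist :: "('v, 'e) pre_digraph \<Rightarrow> 'v \<Rightarrow> 'v \<Rightarrow> enat" where
  "ddist D u v = (INF p\<in>{p. pre_digraph.apath D u p v}. enat (length p))"

definition ddiameter :: "('v, 'e) pre_digraph \<Rightarrow> enat" where
  "ddiameter D = (SUP u\<in>verts D. SUP v\<in>verts D. ddist D u v)"

definition oriented_diameter :: "('v, 'e) mgraph \<Rightarrow> enat" where
  "oriented_diameter G = (INF D\<in>{D. orientation G D \<and> strongly_connected D}. ddiameter D)"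

end

theory Submission
  imports Defs
begin

text \<open>
  Some edge \<open>uv\<close> has edge girth at least 6. Sort the vertices by their distances to \<open>u\<close> and \<open>v\<close>:
  \<open>A\<^sub>i\<close> has distances \<open>i\<close> and \<open>i + 1\<close>, \<open>B\<^sub>i\<close> is its mirror image, \<open>C\<^sub>i\<close> has both distances \<open>i\<close>. As there is no short
  cycle through \<open>uv\<close>, only \<open>A\<^sub>0, \<dots>, A\<^sub>3\<close>, \<open>B\<^sub>0, \<dots>, B\<^sub>3\<close>, \<open>C\<^sub>3\<close>, \<open>C\<^sub>4\<close> occur, and the only edges between \<open>A\<close>
  and \<open>B\<close> apart from \<open>uv\<close> join \<open>A\<^sub>2\<close> to \<open>B\<^sub>2\<close> or \<open>A\<^sub>3\<close> to \<open>B\<^sub>3\<close>. Orient \<open>uv\<close> from \<open>u\<close> to \<open>v\<close>, the \<open>B\<close>-side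
  away from \<open>v\<close>, the \<open>A\<close>-side towards \<open>u\<close>, and all edges in between from \<open>B\<close> over \<open>C\<close> to \<open>A\<close>. It then
  suffices to bound the length of \<open>x \<rightarrow> u\<close> plus that of \<open>v \<rightarrow> y\<close> by 12. The vertices of \<open>A\<close> that this
  flow misses are served by ears; since the diameter is 4, each of them is next to a vertex that is entered
  early. For \<open>x\<close> in \<open>B\<close> and \<open>y\<close> in \<open>A\<close> an undirected path of length at most 4 crosses from \<open>B\<close>
  to \<open>A\<close>: either it survives in the orientation, or it shows that one of \<open>x \<rightarrow> u\<close>, \<open>v \<rightarrow> y\<close> is short.
\<close>

text \<open>Entering and leaving compete: turning one downward edge of \<open>A\<close> upward lets
  \<open>v\<close> reach its upper end early, but removes a way down to \<open>u\<close>. The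
  compromise is exits within 1, 3, 5 and entries within 8, 7, 6 steps on \<open>A\<^sub>1\<close>
  (vertices with a child), \<open>A\<^sub>2\<close>, \<open>A\<^sub>3\<close>. Some of these pairs
  exceed the budget of 12, for instance 8 + 8 from \<open>B\<^sub>1\<close> to
  \<open>A\<^sub>1\<close>. They are repaired by a trade: by \<open>diam4\<close>, a late entry on
  one side forces early crossings for the other end (\<open>A2_bad\<close>, \<open>A1_B3\<close>).
  An ear is a pair of attached vertices on one level: the flow comes up the foot edge of one, moves
  sideways, and goes down the foot edge of the other. If a vertex has another way down, it needs no
  partner. Circularity is avoided because exit bounds use arcs of one side only. The exit bounds of
  the mirrored side come first, and they supply the start of the entry bounds
  (\<open>half_in\<close>). The properties in \<open>oriented\<close> are invariant under reversing
  all arcs and exchanging \<open>u\<close> and \<open>v\<close>, so every bound on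
  \<open>v \<rightarrow> y\<close> is also one on \<open>x \<rightarrow> u\<close>.\<close>

definition reach :: "('a \<Rightarrow> 'a \<Rightarrow> bool) \<Rightarrow> nat \<Rightarrow> 'a \<Rightarrow> 'a \<Rightarrow> bool" where
  "reach R n x y \<longleftrightarrow> (\<exists>k\<le>n. (R ^^ k) x y)"

lemma reach_refl [simp]: "reach R n x x"
  unfolding reach_def by (rule exI[of _ 0]) auto

lemma reach_mono: "reach R m x y \<Longrightarrow> m \<le> n \<Longrightarrow> reach R n x y"
  unfolding reach_def using le_trans by blast

lemma reach_trans: "reach R m x y \<Longrightarrow> reach R n y z \<Longrightarrow> reach R (m + n) x z"
  unfolding reach_def by (metis add_mono relcomppI relpowp_add)

lemma reach_one: "R x y \<Longrightarrow> reach R (Suc 0) x y"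
  unfolding reach_def by (metis le_refl relpowp_1 One_nat_def)

lemma reach_Suc: "reach R n x y \<Longrightarrow> R y z \<Longrightarrow> reach R (Suc n) x z"
  using reach_trans[OF _ reach_one] by fastforce

lemma reach_Suc2: "R x y \<Longrightarrow> reach R n y z \<Longrightarrow> reach R (Suc n) x z"
  using reach_trans[OF reach_one] by fastforce

lemma reach_converse: "reach (\<lambda>s t. R t s) n x y \<longleftrightarrow> reach R n y x"
proof -
  have "((\<lambda>s t. R t s) ^^ k) x y \<longleftrightarrow> (R ^^ k) y x" for k
  proof (induction k arbitrary: y)
    case (Suc k)
    then show ?case by (metis relpowp_Suc_D2 relpowp_Suc_E relpowp_Suc_I relpowp_Suc_I2)
  qed auto
  then show ?thesis unfolding reach_def by simp
qed

section \<open>Levels around a long edge\<close>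

text \<open>What the proof keeps of the multigraph. Short cycles through \<open>uv\<close> are
  excluded one length at a time: 2 by \<open>uv_edge\<close>, 3 and 5 by \<open>centre\<close>, 4 by
  \<open>no_chord\<close>. Bridgelessness survives as \<open>two_edges\<close>, \<open>ex_A2\<close>
  and \<open>ex_B2\<close>, the diameter as \<open>du4\<close>, \<open>dv4\<close> and
  \<open>diam4\<close>. Walks in \<open>diam4\<close> may pause, so that four steps cover all
  shorter lengths.\<close>

locale levels =
  fixes V :: "'v set" and E :: "'e set" and ed :: "'e \<Rightarrow> 'v set"
    and u v :: 'v and du dv :: "'v \<Rightarrow> nat"
    and adj :: "'v \<Rightarrow> 'v \<Rightarrow> bool"
  assumes adj_def: "adj s t \<longleftrightarrow> (\<exists>e\<in>E. ed e = {s, t})"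
    and finV: "finite V"
    and ed2: "e \<in> E \<Longrightarrow> \<exists>s\<in>V. \<exists>t\<in>V. s \<noteq> t \<and> ed e = {s, t}"
    and uV: "u \<in> V" and vV: "v \<in> V" and du_v: "du v = Suc 0" and dv_u: "dv u = Suc 0"
    and du0: "x \<in> V \<Longrightarrow> du x = 0 \<longleftrightarrow> x = u" and dv0: "x \<in> V \<Longrightarrow> dv x = 0 \<longleftrightarrow> x = v"
    and du4: "x \<in> V \<Longrightarrow> du x \<le> 4" and dv4: "x \<in> V \<Longrightarrow> dv x \<le> 4"
    and du_adj: "adj x y \<Longrightarrow> du y \<le> Suc (du x)" and dv_adj: "adj x y \<Longrightarrow> dv y \<le> Suc (dv x)"
    and du_dv: "x \<in> V \<Longrightarrow> du x \<le> Suc (dv x)" and dv_du: "x \<in> V \<Longrightarrow> dv x \<le> Suc (du x)"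
    and du_prev: "x \<in> V \<Longrightarrow> du x = Suc n \<Longrightarrow> \<exists>y. adj x y \<and> du y = n"
    and dv_prev: "x \<in> V \<Longrightarrow> dv x = Suc n \<Longrightarrow> \<exists>y. adj x y \<and> dv y = n"
    and centre: "x \<in> V \<Longrightarrow> du x = dv x \<Longrightarrow> 3 \<le> du x"
    and no_chord: "adj x y \<Longrightarrow> \<not> (du x = 1 \<and> dv x = 2 \<and> du y = 2 \<and> dv y = 1)"
    and uv_edge: "e \<in> E \<Longrightarrow> e' \<in> E \<Longrightarrow> ed e = {u, v} \<Longrightarrow> ed e' = {u, v} \<Longrightarrow> e = e'"
    and adj_uv: "adj u v"
    and diam4: "x \<in> V \<Longrightarrow> y \<in> V \<Longrightarrow>
      \<exists>a b c. (x = a \<or> adj x a) \<and> (a = b \<or> adj a b) \<and> (b = c \<or> adj b c) \<and> (c = y \<or> adj c y)"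
    and two_edges: "x \<in> V \<Longrightarrow> \<exists>g\<in>E. g \<noteq> e \<and> x \<in> ed g"
    and ex_A2: "\<exists>x\<in>V. du x = 2 \<and> dv x = 3" and ex_B2: "\<exists>x\<in>V. du x = 3 \<and> dv x = 2"
begin

lemma adj_sym: "adj x y \<Longrightarrow> adj y x"
  unfolding adj_def by (metis insert_commute)

lemma adjI: "e \<in> E \<Longrightarrow> ed e = {x, y} \<Longrightarrow> adj x y"
  unfolding adj_def by auto

lemma adjV: "adj x y \<Longrightarrow> x \<in> V \<and> y \<in> V \<and> x \<noteq> y"
  unfolding adj_def using ed2 by (metis doubleton_eq_iff)

text \<open>
  Exchanging \<open>u\<close> and \<open>v\<close> gives a mirror copy: if \<open>side i\<close> is \<open>A\<^sub>i\<close>, then \<open>sw.side i\<close> is \<open>B\<^sub>i\<close>. A fact reaches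
  its mirror copy only when its context is closed, which is why contexts are reopened below.
\<close>

sublocale sw: levels V E ed v u dv du adj
proof
  show "3 \<le> dv x" if "x \<in> V" "dv x = du x" for x
    using centre[of x] that by simp
  show "\<not> (dv x = 1 \<and> du x = 2 \<and> dv y = 2 \<and> du y = 1)" if "adj x y" for x y
    using no_chord[of y x] adj_sym[OF that] by auto
  show "e = e'" if "e \<in> E" "e' \<in> E" "ed e = {v, u}" "ed e' = {v, u}" for e e'
    using uv_edge[of e e'] that by (simp add: insert_commute)
  show "adj v u" using adj_uv adj_sym by simp
  show "\<exists>x\<in>V. dv x = 2 \<and> du x = 3" "\<exists>x\<in>V. dv x = 3 \<and> du x = 2"
    using ex_A2 ex_B2 by auto
qed (fact adj_def finV ed2 vV uV dv_u du_v dv0 du0 dv4 du4 dv_adj du_adj dv_du du_dv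
    dv_prev du_prev diam4 two_edges)+

end

context levels
begin

definition side :: "nat \<Rightarrow> 'v \<Rightarrow> bool" where
  "side i x \<longleftrightarrow> x \<in> V \<and> du x = i \<and> dv x = Suc i"

definition middle :: "nat \<Rightarrow> 'v \<Rightarrow> bool" where
  "middle i x \<longleftrightarrow> x \<in> V \<and> du x = i \<and> dv x = i"

definition has_child :: "'v \<Rightarrow> bool" where
  "has_child x \<longleftrightarrow> side 1 x \<and> (\<exists>w. adj x w \<and> side 2 w)"

end

context levels
begin

lemma sw_middle: "sw.middle = middle"
  unfolding middle_def sw.middle_def by auto

lemma side_V: "side i x \<Longrightarrow> x \<in> V"
  by (simp add: side_def)

lemma side_0: "side 0 x \<longleftrightarrow> x = u"
  using du0 uV dv_u unfolding side_def by auto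

lemma side_inj: "side i x \<Longrightarrow> side j x \<Longrightarrow> i = j"
  by (simp add: side_def)

end

section \<open>Possible neighbours of each level\<close>

context levels
begin

lemma adj_levels:
  assumes "adj x y"
  shows "du y \<le> Suc (du x)" "du x \<le> Suc (du y)" "dv y \<le> Suc (dv x)" "dv x \<le> Suc (dv y)"
    "x \<in> V" "y \<in> V" "du y \<le> Suc (dv y)" "dv y \<le> Suc (du y)" "du y = dv y \<longrightarrow> 3 \<le> du y"
    "du y \<le> 4" "dv y \<le> 4"
  using du_adj[OF assms] dv_adj[OF assms] du_adj[OF adj_sym[OF assms]] dv_adj[OF adj_sym[OF assms]]
    adjV[OF assms] du_dv[of y] dv_du[of y] centre[of y] du4[of y] dv4[of y] by auto

lemma du_u: "du u = 0" and dv_v: "dv v = 0"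
  using du0 dv0 uV vV by auto

lemma level_pairs:
  fixes a b :: nat
  assumes "a \<le> 4" "b \<le> 4" "a \<le> Suc b" "b \<le> Suc a" "a = b \<longrightarrow> 3 \<le> a"
  shows "a = 0 \<or> b = 0 \<or> (a = 1 \<and> b = 2) \<or> (a = 2 \<and> b = 3) \<or> (a = 3 \<and> b = 4) \<or> (a = 3 \<and> b = 3)
    \<or> (a = 4 \<and> b = 4) \<or> (a = 2 \<and> b = 1) \<or> (a = 3 \<and> b = 2) \<or> (a = 4 \<and> b = 3)"
proof -
  have "a = 0 \<or> a = 1 \<or> a = 2 \<or> a = 3 \<or> a = 4"
    "b = 0 \<or> b = 1 \<or> b = 2 \<or> b = 3 \<or> b = 4" using assms by presburger+
  then show ?thesis using assms by (elim disjE) simp_all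
qed

lemma V_cases:
  assumes x: "x \<in> V"
  obtains "x = u" | "side 1 x" | "side 2 x" | "side 3 x" | "middle 3 x" | "middle 4 x"
    | "x = v" | "sw.side 1 x" | "sw.side 2 x" | "sw.side 3 x"
proof -
  have "du x = dv x \<longrightarrow> 3 \<le> du x" using centre x by auto
  from level_pairs[OF du4[OF x] dv4[OF x] du_dv[OF x] dv_du[OF x] this]
  have "x = u \<or> side 1 x \<or> side 2 x \<or> side 3 x \<or> middle 3 x \<or> middle 4 x
    \<or> x = v \<or> sw.side 1 x \<or> sw.side 2 x \<or> sw.side 3 x"
    unfolding side_def sw.side_def middle_def using x du0[OF x] dv0[OF x]
    by (elim disjE) simp_all
  then show thesis using that by (elim disjE)
qed

lemma A1_nb:
  assumes "side 1 x" "adj x y"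
  shows "y = u \<or> side 1 y \<or> side 2 y"
  using V_cases[OF adj_levels(6)[OF assms(2)]]
  by cases (use assms(1) adj_levels(1-4)[OF assms(2)] no_chord[OF assms(2)] du_u dv_v du_v dv_u in \<open>simp_all add: side_def sw.side_def middle_def\<close>)

lemma A2_nb:
  assumes "side 2 x" "adj x y"
  shows "side 1 y \<or> side 2 y \<or> side 3 y \<or> sw.side 2 y \<or> middle 3 y"
  using V_cases[OF adj_levels(6)[OF assms(2)]]
  by cases (use assms(1) adj_levels(1-4)[OF assms(2)] no_chord[OF assms(2)] du_u dv_v du_v dv_u in \<open>simp_all add: side_def sw.side_def middle_def\<close>)

lemma A3_nb:
  assumes "side 3 x" "adj x y"
  shows "side 2 y \<or> side 3 y \<or> sw.side 3 y \<or> middle 3 y \<or> middle 4 y"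
  using V_cases[OF adj_levels(6)[OF assms(2)]]
  by cases (use assms(1) adj_levels(1-4)[OF assms(2)] no_chord[OF assms(2)] du_u dv_v du_v dv_u in \<open>simp_all add: side_def sw.side_def middle_def\<close>)

lemma C3_nb:
  assumes "middle 3 x" "adj x y"
  shows "side 2 y \<or> side 3 y \<or> sw.side 2 y \<or> sw.side 3 y \<or> middle 3 y \<or> middle 4 y"
  using V_cases[OF adj_levels(6)[OF assms(2)]]
  by cases (use assms(1) adj_levels(1-4)[OF assms(2)] no_chord[OF assms(2)] du_u dv_v du_v dv_u in \<open>simp_all add: side_def sw.side_def middle_def\<close>)

lemma C4_nb:
  assumes "middle 4 x" "adj x y"
  shows "side 3 y \<or> sw.side 3 y \<or> middle 3 y \<or> middle 4 y"
  using V_cases[OF adj_levels(6)[OF assms(2)]]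
  by cases (use assms(1) adj_levels(1-4)[OF assms(2)] no_chord[OF assms(2)] du_u dv_v du_v dv_u in \<open>simp_all add: side_def sw.side_def middle_def\<close>)

lemma u_nb: "adj u y \<Longrightarrow> y = v \<or> side 1 y"
  using V_cases[OF adj_levels(6)[of u y]] adj_levels(1-4)[of u y] adjV[of u y] du_u du_v dv_u
  by cases (simp_all add: side_def sw.side_def middle_def)

lemma down: "side (Suc i) x \<Longrightarrow> \<exists>w. adj x w \<and> side i w"
proof -
  assume x: "side (Suc i) x"
  then obtain w where w: "adj x w" "du w = i"
    using du_prev[of x i] unfolding side_def by auto
  then have "side i w"
    using adj_levels[of x w] x unfolding side_def by auto
  then show ?thesis using w by auto
qed

lemma down3: "side 3 x \<Longrightarrow> \<exists>w. adj x w \<and> side 2 w"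
  using down[of 2 x] by simp

lemma down2: "side 2 x \<Longrightarrow> \<exists>w. adj x w \<and> has_child w"
  using down[of 1 x] adj_sym unfolding has_child_def by (auto simp: numeral_2_eq_2)

lemma down1: "side 1 x \<Longrightarrow> adj x u"
  using down[of 0 x] side_0 by auto

end

context levels
begin

text \<open>
  In \<open>entered n x\<close>, the number \<open>n\<close> bounds the length of a walk from \<open>v\<close> up the \<open>B\<close>-side, across, and then
  downwards or sideways in \<open>A\<close>. Vertices of \<open>A\<^sub>1\<close> without a neighbour in \<open>A\<^sub>2\<close> are left out: they hang on \<open>u\<close>.
\<close>

inductive entered :: "nat \<Rightarrow> 'v \<Rightarrow> bool" where
  cross_B2: "side 2 x \<Longrightarrow> adj x y \<Longrightarrow> sw.side 2 y \<Longrightarrow> 3 \<le> n \<Longrightarrow> entered n x"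
| cross_C3: "side 2 x \<Longrightarrow> adj x y \<Longrightarrow> middle 3 y \<Longrightarrow> 4 \<le> n \<Longrightarrow> entered n x"
| cross_B3: "side 3 x \<Longrightarrow> adj x y \<Longrightarrow> sw.side 3 y \<or> middle 3 y \<Longrightarrow> 4 \<le> n \<Longrightarrow> entered n x"
| cross_C4: "side 3 x \<Longrightarrow> adj x y \<Longrightarrow> middle 4 y \<Longrightarrow> 5 \<le> n \<Longrightarrow> entered n x"
| descend: "entered k w \<Longrightarrow> side (Suc i) w \<Longrightarrow> side i x \<Longrightarrow> 1 \<le> i \<Longrightarrow> adj x w \<Longrightarrow> k < n \<Longrightarrow> entered n x"
| sideways: "entered k w \<Longrightarrow> side i w \<Longrightarrow> side i x \<Longrightarrow> 1 \<le> i \<Longrightarrow> adj x w \<Longrightarrow> (i = 1 \<longrightarrow> has_child x) \<Longrightarrow> k < n \<Longrightarrow> entered n x"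

end

context levels
begin

lemma entered_mono: "entered m x \<Longrightarrow> m \<le> n \<Longrightarrow> entered n x"
proof (erule entered.cases, goal_cases)
  case (5 k w i)
  then show ?case using descend[of k w i x n] by simp
next
  case (6 k w i)
  then show ?case using sideways[of k w i x n] by simp
qed (auto intro: cross_B2 cross_C3 cross_B3 cross_C4)

lemma entered_side: "entered k x \<Longrightarrow> side 1 x \<or> side 2 x \<or> side 3 x"
proof (induction rule: entered.induct)
  case (descend k w i x n)
  then show ?case by (auto simp: side_def)
next
  case (sideways k w i x n)
  then show ?case by (auto simp: side_def)
qed auto

lemma entered_has_child: "entered k x \<Longrightarrow> side 1 x \<Longrightarrow> has_child x"
  by (erule entered.cases) (auto simp: has_child_def numeral_2_eq_2 dest: side_inj)

lemma descend_A3: "entered k w \<Longrightarrow> side 3 w \<Longrightarrow> side 2 x \<Longrightarrow> adj x w \<Longrightarrow> k < n \<Longrightarrow> entered n x"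
  using descend[of k w 2 x n] by auto
lemma descend_A2: "entered k w \<Longrightarrow> side 2 w \<Longrightarrow> side 1 x \<Longrightarrow> adj x w \<Longrightarrow> k < n \<Longrightarrow> entered n x"
  using descend[of k w 1 x n] by (auto simp: numeral_2_eq_2)
lemma sideways_A3: "entered k w \<Longrightarrow> side 3 w \<Longrightarrow> side 3 x \<Longrightarrow> adj x w \<Longrightarrow> k < n \<Longrightarrow> entered n x"
  using sideways[of k w 3 x n] by auto
lemma sideways_A2: "entered k w \<Longrightarrow> side 2 w \<Longrightarrow> side 2 x \<Longrightarrow> adj x w \<Longrightarrow> k < n \<Longrightarrow> entered n x"
  using sideways[of k w 2 x n] by auto
lemma sideways_A1: "entered k w \<Longrightarrow> side 1 w \<Longrightarrow> has_child x \<Longrightarrow> adj x w \<Longrightarrow> k < n \<Longrightarrow> entered n x"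
  using sideways[of k w 1 x n] by (auto simp: has_child_def)

end

section \<open>What diameter 4 forces around vertices that are entered late\<close>

context levels
begin
lemma levels_disjoint:
  "side i x \<Longrightarrow> sw.side j x \<Longrightarrow> False" "side i x \<Longrightarrow> middle j x \<Longrightarrow> False" "sw.side i x \<Longrightarrow> middle j x \<Longrightarrow> False"
  "side (Suc 0) u \<Longrightarrow> False" "side 2 u \<Longrightarrow> False" "side 3 u \<Longrightarrow> False" "sw.side i u \<Longrightarrow> False" "middle i u \<Longrightarrow> False"
  "sw.side (Suc 0) v \<Longrightarrow> False" "sw.side 2 v \<Longrightarrow> False" "sw.side 3 v \<Longrightarrow> False" "side i v \<Longrightarrow> False" "middle i v \<Longrightarrow> False"
  "u = v \<Longrightarrow> False" "v = u \<Longrightarrow> False"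
  "side (Suc 0) x \<Longrightarrow> side 2 x \<Longrightarrow> False" "side (Suc 0) x \<Longrightarrow> side 3 x \<Longrightarrow> False" "side 2 x \<Longrightarrow> side 3 x \<Longrightarrow> False"
  "sw.side (Suc 0) x \<Longrightarrow> sw.side 2 x \<Longrightarrow> False" "sw.side (Suc 0) x \<Longrightarrow> sw.side 3 x \<Longrightarrow> False" "sw.side 2 x \<Longrightarrow> sw.side 3 x \<Longrightarrow> False"
  "sw.side i x \<Longrightarrow> u = x \<Longrightarrow> False" "middle i x \<Longrightarrow> u = x \<Longrightarrow> False" "side i x \<Longrightarrow> v = x \<Longrightarrow> False" "middle i x \<Longrightarrow> v = x \<Longrightarrow> False"
  "side (Suc i) x \<Longrightarrow> u = x \<Longrightarrow> False" "sw.side (Suc i) x \<Longrightarrow> v = x \<Longrightarrow> False" "side 2 x \<Longrightarrow> u = x \<Longrightarrow> False" "side 3 x \<Longrightarrow> u = x \<Longrightarrow> False"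
  "sw.side 2 x \<Longrightarrow> v = x \<Longrightarrow> False" "sw.side 3 x \<Longrightarrow> v = x \<Longrightarrow> False"
  "middle 3 x \<Longrightarrow> middle 4 x \<Longrightarrow> False" "adj x x \<Longrightarrow> False"
  using du_u dv_v du_v dv_u adjV by (auto simp: side_def sw.side_def middle_def)

text \<open>Contrapositive of the introduction rules of \<open>entered\<close>: a crossing edge or
  an early neighbour would make \<open>x\<close> early. Such exclusions are what makes the walks of
  length 4 nearly forced.\<close>

lemma A2_nb_unentered:
  assumes "\<not> entered n x" "side 2 x" "adj x a" "k < n" "4 \<le> n"
  shows "side 1 a \<or> side 2 a \<and> \<not> entered k a \<or> side 3 a \<and> \<not> entered k a"
  using A2_nb[OF assms(2,3)] cross_B2[of x a n] cross_C3[of x a n] sideways_A2[of k a x n] descend_A3[of k a x n] assms by auto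

lemma A3_nb_unentered:
  assumes "\<not> entered n x" "side 3 x" "adj x a" "k < n" "5 \<le> n"
  shows "side 2 a \<or> side 3 a \<and> \<not> entered k a"
  using A3_nb[OF assms(2,3)] cross_B3[of x a n] cross_C4[of x a n] sideways_A3[of k a x n] assms by auto

lemma A3_nb_uncrossed: "\<not> entered 4 x \<Longrightarrow> side 3 x \<Longrightarrow> adj x a \<Longrightarrow> side 2 a \<or> side 3 a \<or> middle 4 a"
  using A3_nb[of x a] cross_B3[of x a 4] by auto

lemma ex_B1: "\<exists>y. sw.has_child y"
  using ex_B2 sw.down2 unfolding sw.side_def by fastforce

text \<open>Consider a walk of length 4 to a vertex of \<open>B\<^sub>1\<close>. Its third vertex is
  \<open>v\<close> or in \<open>B\<^sub>1\<close> or \<open>B\<^sub>2\<close>, while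
  \<open>x\<close> is too late for the walk to have left the \<open>A\<close>-side by its second
  vertex, except into \<open>C\<^sub>4\<close>. Only an edge between \<open>A\<^sub>2\<close> and
  \<open>B\<^sub>2\<close> can join the two, so the second vertex is entered in 3.\<close>

lemma A3_cases:
  assumes x: "side 3 x" "\<not> entered 5 x"
  shows "(\<exists>b. adj x b \<and> side 2 b \<and> entered 4 b) \<or> (\<exists>a b. adj x a \<and> side 3 a \<and> adj a b \<and> side 2 b \<and> entered 3 b)"
proof (rule ccontr)
  assume no: "\<not> ?thesis"
  obtain y where y: "sw.side 1 y" using ex_B1 sw.has_child_def by blast
  obtain a b c where p: "x = a \<or> adj x a" "a = b \<or> adj a b" "b = c \<or> adj b c" "c = y \<or> adj c y"
    using diam4[OF side_V[OF x(1)] sw.side_V[OF y]] by blast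
  have c: "c = v \<or> sw.side 1 c \<or> sw.side 2 c"
    using p(4) y sw.A1_nb[OF y adj_sym] by blast
  have a: "adj x a \<and> side 2 a \<and> \<not> entered 4 a \<or> side 3 a \<and> \<not> entered 4 a \<and> (x = a \<or> adj x a)"
    using p(1) A3_nb_unentered[OF x(2,1), of a 4] no entered_mono[of 4 x 5] x by auto
  then have b: "side 1 b \<or> side 2 b \<and> (adj x b \<or> adj x a \<and> adj a b \<and> (side 2 a \<and> \<not> entered 4 a \<or> side 3 a)) \<or> side 3 b \<or> middle 4 b"
    using p(2) A3_nb_uncrossed[of a b] A2_nb_unentered[of 4 a b 3] by auto
  have "side 2 b \<and> entered 3 b"
    using b
  proof (elim disjE)
    assume "side 1 b"
    then show ?thesis using p(3) c A1_nb[of b c] by (auto dest: levels_disjoint)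
  next
    assume "side 3 b"
    then show ?thesis using p(3) c A3_nb[of b c] by (auto dest: levels_disjoint)
  next
    assume "middle 4 b"
    then show ?thesis using p(3) c C4_nb[of b c] by (auto dest: levels_disjoint)
  next
    assume "side 2 b \<and> (adj x b \<or> adj x a \<and> adj a b \<and> (side 2 a \<and> \<not> entered 4 a \<or> side 3 a))"
    then show ?thesis using p(3) c A2_nb[of b c] cross_B2[of b c 3] by (auto dest: levels_disjoint)
  qed
  then show False using b no entered_mono[of 3 b 4] sideways_A2[of 3 b a 4] by (auto dest: levels_disjoint)
qed

definition low_parent :: "'v \<Rightarrow> bool" where
  "low_parent x \<longleftrightarrow> (\<exists>p. adj x p \<and> side 1 p \<and> entered 5 p)"

definition above :: "nat \<Rightarrow> 'v \<Rightarrow> bool" where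
  "above n a \<longleftrightarrow> side 3 a \<and> (\<exists>b. adj a b \<and> side 2 b \<and> entered n b)"

text \<open>A crossing in one of the first two steps would enter \<open>x\<close> within 6, so the
  walk is still on the \<open>A\<close>-side. The route to \<open>b\<close> is recorded because it
  later decides which vertices can serve as feet.\<close>

lemma A2_walk2:
  assumes x: "side 2 x" "\<not> entered 6 x" and p: "x = a \<or> adj x a" "a = b \<or> adj a b"
  shows "b = u \<or> side 1 b \<and> (adj x b \<or> adj x a \<and> adj a b \<and> (side 1 a \<or> side 2 a))
    \<or> side 2 b \<and> (\<not> entered 4 b \<or> adj x a \<and> adj a b \<and> (side 1 a \<or> side 3 a))
    \<or> side 3 b \<and> \<not> entered 4 b \<and> (adj x b \<or> adj x a \<and> adj a b \<and> (side 2 a \<or> side 3 a))"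
proof -
  have nx: "y = x \<or> adj x y \<Longrightarrow> y = x \<and> side 2 y \<and> \<not> entered 4 y \<or> adj x y \<and> (side 1 y \<or> side 2 y \<and> \<not> entered 4 y \<and> \<not> entered 5 y \<or> side 3 y \<and> \<not> entered 4 y \<and> \<not> entered 5 y)" for y
    using A2_nb_unentered[OF x(2,1), of y 5] entered_mono[of 4 y 5] entered_mono[of 4 x 6] x by auto
  show ?thesis
  proof (cases "a = x \<or> a = b")
    case True
    then show ?thesis using p nx[of b] by auto
  next
    case False
    then have a: "adj x a" "adj a b" using p by auto
    from nx[of a] a False consider "side 1 a" | "side 2 a" "\<not> entered 5 a" | "side 3 a" "\<not> entered 5 a" by auto
    then show ?thesis
    proof cases
      case 1 then show ?thesis using a A1_nb[of a b] by auto
    next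
      case 2 then show ?thesis using a A2_nb_unentered[of 5 a b 4] by auto
    next
      case 3 then show ?thesis using a A3_nb_unentered[of 5 a b 4] by auto
    qed
  qed
qed

lemma has_childI: "side 1 a \<Longrightarrow> adj a b \<Longrightarrow> side 2 b \<Longrightarrow> has_child a"
  unfolding has_child_def by auto

text \<open>The trade between the two sides. A walk of length 4 from \<open>x\<close> cannot cross
  in its first two steps, so it crosses next to \<open>y\<close> or at \<open>y\<close> itself, and
  the same edge serves the mirrored \<open>entered\<close> of \<open>y\<close>. A crossing at
  \<open>B\<^sub>3\<close> is impossible, as it would enter \<open>b\<close> within 4. The
  \<open>A\<close>-end of the crossing then yields the feet needed near \<open>x\<close>.\<close>

lemma A2_bad:
  assumes x: "side 2 x" "\<not> entered 6 x" and y: "sw.side 2 y"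
  shows "sw.entered 4 y \<and> (low_parent x \<or> (\<exists>a. adj x a \<and> above 4 a) \<or>
     sw.entered 3 y \<and> (\<exists>a. adj x a \<and> (side 2 a \<and> (low_parent a \<or> (\<exists>a'. adj a a' \<and> above 3 a')) \<or> side 3 a \<and> (\<exists>a'. adj a a' \<and> above 3 a'))))"
proof -
  obtain a b c where p: "x = a \<or> adj x a" "a = b \<or> adj a b" "b = c \<or> adj b c" "c = y \<or> adj c y"
    using diam4[OF side_V[OF x(1)] sw.side_V[OF y]] by blast
  note b = A2_walk2[OF x p(1,2)]
  \<comment> \<open>Since \<open>b\<close> is entered within 4, it cannot be a neighbour of the late
    \<open>x\<close>; the vertex \<open>a\<close> in between is a parent entered within 5 or a
    vertex of \<open>A\<^sub>3\<close> above \<open>b\<close>.\<close>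
  have K: ?thesis if "sw.entered 4 y" "side 2 b" "entered 4 b"
  proof -
    have "adj x a" "adj a b" "side 1 a \<or> side 3 a" using b that by (auto dest: levels_disjoint)
    then show ?thesis using that descend_A2[of 4 b a 5] unfolding low_parent_def above_def by auto
  qed
  have "c = y \<or> adj y c" using p(4) adj_sym by blast
  with y sw.A2_nb[OF y, of c] consider "sw.side 2 c" | "c \<noteq> y" "sw.side 1 c" | "sw.side 3 c" | "adj y c" "side 2 c" | "adj y c" "middle 3 c"
    unfolding sw_middle by blast
  then show ?thesis
  proof cases
    case 1
    then have bc: "side 2 b \<and> adj b c"
      using b p(3) A1_nb[of b c] A3_nb[of b c] u_nb[of c] by (auto dest: levels_disjoint)
    then have "sw.entered 3 c" "entered 3 b" using 1 cross_B2[of b c 3] sw.cross_B2[of c b 3] adj_sym by auto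
    moreover have "sw.entered 4 y"
      using \<open>sw.entered 3 c\<close> p(4) sw.entered_mono[of 3 c 4] sw.sideways_A2[of 3 c y 4] 1 y adj_sym by auto
    ultimately show ?thesis using K bc entered_mono[of 3 b 4] by auto
  next
    case 2
    then have False using b p(3) A1_nb[of b c] A3_nb[of b c] u_nb[of c] A2_nb[of b c] by (auto dest: levels_disjoint)
    then show ?thesis ..
  next
    case 3
    then have "side 3 b" "adj b c" using b p(3) A1_nb[of b c] A2_nb[of b c] u_nb[of c] by (auto dest: levels_disjoint)
    then have "entered 4 b" using 3 cross_B3[of b c 4] by auto
    then show ?thesis using b \<open>side 3 b\<close> by (auto dest: levels_disjoint)
  next
    case 4
    then have c3: "entered 3 c" "sw.entered 3 y" using cross_B2[of c y 3] sw.cross_B2[of y c 3] y adj_sym by auto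
    then have y4: "sw.entered 4 y" using sw.entered_mono[of 3 y 4] by auto
    from b consider "b = u" | "side 1 b" | "side 2 b" | "side 3 b" by blast
    then show ?thesis
    proof cases
      case 1
      then show ?thesis using p(3) 4 u_nb[of c] by (auto dest: levels_disjoint)
    next
      case 2
      then have bc: "adj b c" using p(3) 4 by (auto dest: levels_disjoint)
      then have "entered 4 b" using descend_A2[of 3 c b 4] c3 4 2 by auto
      then have b5: "entered 5 b" using entered_mono[of 4 b 5] by auto
      have "adj x b \<or> adj x a \<and> adj a b \<and> (side 1 a \<or> side 2 a)" using b 2 by (auto dest: levels_disjoint)
      moreover have "entered 5 a" if "adj x a" "adj a b" "side 1 a"
        using sideways_A1[of 4 b a 5] that \<open>entered 4 b\<close> 2 has_childI[OF that(3) _ x(1)] adj_sym by auto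
      ultimately show ?thesis using b5 y4 c3 2 unfolding low_parent_def by blast
    next
      case 3
      then have "entered 4 b" using p(3) c3 entered_mono[of 3 c 4] sideways_A2[of 3 c b 4] 4 by auto
      then show ?thesis using K y4 3 by auto
    next
      case 5: 4
      then have bc: "adj b c" using p(3) 4 by (auto dest: levels_disjoint)
      then have "above 3 b" "above 4 b" using 5 4 c3 entered_mono[of 3 c 4] unfolding above_def by auto
      moreover have "adj x b \<or> adj x a \<and> adj a b \<and> (side 2 a \<or> side 3 a)" using b 5 by (auto dest: levels_disjoint)
      ultimately show ?thesis using y4 c3 by blast
    qed
  next
    case 5
    then have y4: "sw.entered 4 y" using sw.cross_C3[of y c 4] y unfolding sw_middle by auto
    have bc: "adj b c \<and> (side 2 b \<or> side 3 b)" using p(3) 5 b u_nb[of c] A1_nb[of b c] by (auto dest: levels_disjoint)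
    then have "entered 4 b" using cross_C3[of b c 4] cross_B3[of b c 4] 5 by auto
    then show ?thesis using K y4 bc b by (auto dest: levels_disjoint)
  qed
qed

end

context levels
begin

text \<open>With both ends this late, crossings from \<open>A\<^sub>2\<close> to
  \<open>B\<^sub>2\<close> or through \<open>C\<^sub>3\<close> are excluded, as they would enter
  \<open>x\<close> or \<open>y\<close> in time. What remains passes through \<open>B\<^sub>3\<close>
  and comes from \<open>A\<^sub>3\<close> or \<open>C\<^sub>4\<close>. For these walks, adding entry
  times is too expensive, and the walk itself has to be followed.\<close>

lemma A2_B2_far:
  assumes x: "side 2 x" "\<not> entered 5 x" and y: "sw.side 2 y" "\<not> sw.entered 4 y"
  obtains a b c where "adj x a" "adj a b" "adj b c" "adj c y" "sw.side 3 c"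
    "side 2 a \<and> side 3 b \<or> side 3 a \<and> \<not> entered 4 a \<and> (side 3 b \<or> middle 4 b)"
proof -
  obtain a b c where p: "x = a \<or> adj x a" "a = b \<or> adj a b" "b = c \<or> adj b c" "c = y \<or> adj c y"
    using diam4[OF side_V[OF x(1)] sw.side_V[OF y(1)]] by blast
  have a: "side 1 a \<or> side 2 a \<and> \<not> entered 4 a \<or> side 3 a \<and> \<not> entered 4 a"
    using p(1) A2_nb_unentered[OF x(2,1), of a 4] entered_mono[of 4 x 5] x by auto
  have b: "b = u \<or> side 1 b \<or> side 2 b \<or> side 3 b \<and> (side 2 a \<and> adj a b \<or> side 3 a) \<or> middle 4 b \<and> adj a b \<and> side 3 a"
  proof -
    have 1: "side 1 a \<Longrightarrow> adj a b \<Longrightarrow> b = u \<or> side 1 b \<or> side 2 b" using A1_nb by auto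
    have 2: "side 2 a \<Longrightarrow> \<not> entered 4 a \<Longrightarrow> adj a b \<Longrightarrow> side 1 b \<or> side 2 b \<or> side 3 b" using A2_nb_unentered[of 4 a b 3] by auto
    have 3: "side 3 a \<Longrightarrow> \<not> entered 4 a \<Longrightarrow> adj a b \<Longrightarrow> side 2 b \<or> side 3 b \<or> middle 4 b" using A3_nb_uncrossed[of a b] by auto
    show ?thesis using p(2) a 1 2 3 by auto
  qed
  have "sw.side 1 c \<or> sw.side 2 c \<and> \<not> sw.entered 3 c \<or> sw.side 3 c \<and> adj c y"
    using p(4) sw.A2_nb_unentered[OF y(2,1), of c 3] sw.entered_mono[of 3 y 4] y adj_sym[of c y] by auto
  then show thesis
  proof (elim disjE conjE)
    assume "sw.side 1 c"
    then have False using b p(3) u_nb[of c] A1_nb[of b c] A2_nb[of b c] A3_nb[of b c] C4_nb[of b c] by (auto dest: levels_disjoint)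
    then show thesis ..
  next
    assume c: "sw.side 2 c" "\<not> sw.entered 3 c"
    then have "side 2 b" "adj c b" using b p(3) u_nb[of c] A1_nb[of b c] A3_nb[of b c] C4_nb[of b c] adj_sym[of b c] by (auto dest: levels_disjoint)
    then show thesis using c sw.cross_B2[of c b 3] by auto
  next
    assume c: "sw.side 3 c" "adj c y"
    then have bc: "adj b c" and b': "side 3 b \<and> (side 2 a \<and> adj a b \<or> side 3 a) \<or> middle 4 b \<and> adj a b \<and> side 3 a"
      using b p(3) u_nb[of c] A1_nb[of b c] A2_nb[of b c] by (auto dest: levels_disjoint)
    have r: "side 3 b \<Longrightarrow> entered 4 b" using cross_B3[of b c 4] bc c by auto
    have ax: "a = x \<Longrightarrow> False"
      using b' r x descend_A3[of 4 b x 5] by (auto dest: levels_disjoint)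
    have ab: "a = b \<Longrightarrow> False" using b' r a by (auto dest: levels_disjoint)
    have "adj x a" "adj a b" using ax ab p by auto
    then show thesis using that[of a b c] c bc a b' by (auto dest: levels_disjoint)
  qed
qed

text \<open>Entering a late \<open>x\<close> may cost 7, so \<open>y\<close> has to leave within 5,
  and \<open>above 3\<close> on the mirrored side guarantees this. The walk has to arrive at
  \<open>y\<close> through \<open>B\<^sub>2\<close>: a crossing between \<open>A\<^sub>3\<close> and
  \<open>B\<^sub>3\<close> would enter its end \<open>c\<close> within 4.\<close>

lemma A2_bad_B3:
  assumes x: "side 2 x" "\<not> entered 6 x" and y: "sw.side 3 y" "\<not> sw.entered 5 y"
  shows "sw.above 3 y"
proof -
  obtain a b c where p: "x = a \<or> adj x a" "a = b \<or> adj a b" "b = c \<or> adj b c" "c = y \<or> adj c y"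
    using diam4[OF side_V[OF x(1)] sw.side_V[OF y(1)]] by blast
  note b = A2_walk2[OF x p(1,2)]
  have "adj y c \<and> sw.side 2 c \<or> sw.side 3 c \<and> \<not> sw.entered 4 c"
    using p(4) sw.A3_nb_unentered[OF y(2,1) adj_sym, of c 4] sw.entered_mono[of 4 y 5] y adj_sym[of c y] by auto
  then show ?thesis
  proof (elim disjE conjE)
    assume c: "adj y c" "sw.side 2 c"
    then have "side 2 b \<and> adj b c"
      using b p(3) A1_nb[of b c] A3_nb[of b c] u_nb[of c] by (auto dest: levels_disjoint)
    then show ?thesis using c y sw.cross_B2[of c b 3] adj_sym[of b c] unfolding sw.above_def by auto
  next
    assume c: "sw.side 3 c" "\<not> sw.entered 4 c"
    then have "side 3 b \<and> adj b c"
      using b p(3) A1_nb[of b c] A2_nb[of b c] u_nb[of c] by (auto dest: levels_disjoint)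
    then show ?thesis using c sw.cross_B3[of c b 4] adj_sym[of b c] by auto
  qed
qed

lemma A1_walk2:
  assumes x: "has_child x" and p: "x = a \<or> adj x a" "a = b \<or> adj a b"
  shows "b = u \<or> b = v \<or> side 1 b \<or> side 2 b \<and> (adj x b \<or> adj x a \<and> adj a b \<and> (side 1 a \<or> side 2 a)) \<or>
    adj x a \<and> side 2 a \<and> adj a b \<and> (side 3 b \<or> sw.side 2 b \<or> middle 3 b)"
proof -
  have x1: "side 1 x" using x has_child_def by auto
  show ?thesis
  proof (cases "a = x \<or> a = b")
    case True
    then show ?thesis using p A1_nb[OF x1] x1 by auto
  next
    case False
    then have a: "adj x a" "adj a b" using p by auto
    then show ?thesis using A1_nb[OF x1 a(1)] u_nb[of b] A1_nb[OF _ a(2)] A2_nb[OF _ a(2)] by auto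
  qed
qed

lemma A1_up:
  assumes x: "has_child x" and a: "adj x a" "adj a b" "side 1 a \<or> side 2 a" "side 2 b" "entered k b" "k + 2 \<le> n"
  shows "entered n x"
  using a descend_A2[of k b a "Suc k"] sideways_A1[of "Suc k" a x n] sideways_A2[of k b a "Suc k"] descend_A2[of "Suc k" a x n] x
  unfolding has_child_def by auto

lemma A1_up3:
  assumes x: "has_child x" and a: "adj x a" "adj a b" "side 2 a" "side 3 b" "entered k b" "k + 2 \<le> n"
  shows "entered n x"
  using a descend_A3[of k b a "Suc k"] descend_A2[of "Suc k" a x n] x unfolding has_child_def by auto

text \<open>The walk of length 4 to \<open>y\<close> has to cross, and its part before the crossing,
  read backwards, is a descent to \<open>x\<close>; the worst case is 5 + 2. Main use: if a vertex
  with a child is not entered within 7, then \<open>B\<^sub>3\<close> is empty and so, by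
  \<open>A3_late_nb\<close>, nothing is \<open>A3_late\<close>.\<close>

lemma A1_B3:
  assumes x: "has_child x" and y: "sw.side 3 y"
  shows "entered 7 x \<and> (sw.entered 5 y \<or> entered 6 x)"
proof -
  have x1: "side 1 x" using x has_child_def by auto
  obtain a b c where p: "x = a \<or> adj x a" "a = b \<or> adj a b" "b = c \<or> adj b c" "c = y \<or> adj c y"
    using diam4[OF side_V[OF x1] sw.side_V[OF y]] by blast
  note b = A1_walk2[OF x p(1,2)]
  have 76: "entered 6 x \<Longrightarrow> ?thesis" using entered_mono[of 6 x 7] by auto
  have R2: "entered (k + 2) x" if "side 2 b" "entered k b" for k
    using b that A1_up[OF x _ _ _ that, of a "k + 2"] descend_A2[of k b x "k + 2"] x1 by (auto dest: levels_disjoint)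
  have R3: "entered (k + 2) x" if "side 3 b" "entered k b" for k
    using b that A1_up3[OF x _ _ _ that, of a "k + 2"] by (auto dest: levels_disjoint)
  have RB: ?thesis if "sw.side 2 b \<or> middle 3 b"
  proof -
    have "adj x a" "side 2 a" "entered 4 a" using b that cross_B2[of a b 4] cross_C3[of a b 4] by (auto dest: levels_disjoint)
    then show ?thesis using 76 descend_A2[of 4 a x 6] x1 by auto
  qed
  have "c = y \<or> adj y c" using p(4) adj_sym by blast
  with sw.A3_nb[OF y, of c] y consider "adj y c" "sw.side 2 c" | "sw.side 3 c" | "adj y c" "side 3 c" | "adj y c" "middle 3 c" | "adj y c" "middle 4 c"
    unfolding sw_middle by blast
  then show ?thesis
  proof cases
    case 1
    have "side 2 b \<and> adj b c \<or> (sw.side 2 b \<or> middle 3 b)"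
      using b p(3) 1 u_nb[of c] A1_nb[of b c] sw.u_nb[of c] A3_nb[of b c] by (auto dest: levels_disjoint)
    then show ?thesis using RB R2[of 3] cross_B2[of b c 3] 1 76 entered_mono[of 5 x 6] by auto
  next
    case 2
    have "side 3 b \<and> adj b c \<or> (sw.side 2 b \<or> middle 3 b)"
      using b p(3) 2 u_nb[of c] A1_nb[of b c] sw.u_nb[of c] A2_nb[of b c] by (auto dest: levels_disjoint)
    then show ?thesis using RB R3[of 4] cross_B3[of b c 4] 2 76 by auto
  next
    case 3
    then have c4: "entered 4 c" and y4: "sw.entered 5 y" using cross_B3[of c y 4] sw.cross_B3[of y c 5] y adj_sym by auto
    have "side 2 b \<and> adj b c \<or> side 3 b \<and> (b = c \<or> adj b c) \<or> (sw.side 2 b \<or> middle 3 b)"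
      using b p(3) 3 u_nb[of c] A1_nb[of b c] sw.u_nb[of c] by (auto dest: levels_disjoint)
    then show ?thesis
    proof (elim disjE)
      assume "side 2 b \<and> adj b c"
      then show ?thesis using R2[of 5] descend_A3[of 4 c b 5] c4 3 y4 by auto
    next
      assume "side 3 b \<and> (b = c \<or> adj b c)"
      then show ?thesis using R3[of 5] sideways_A3[of 4 c b 5] entered_mono[of 4 c 5] c4 3 y4 by auto
    qed (use RB in auto)
  next
    case 4
    have "side 2 b \<and> adj b c \<or> side 3 b \<and> adj b c \<or> (sw.side 2 b \<or> middle 3 b)"
      using b p(3) 4 u_nb[of c] A1_nb[of b c] sw.u_nb[of c] by (auto dest: levels_disjoint)
    then show ?thesis using RB R2[of 4] R3[of 4] cross_C3[of b c 4] cross_B3[of b c 4] 4 76 by auto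
  next
    case 5
    then have y5: "sw.entered 5 y" using sw.cross_C4[of y c 5] y unfolding sw_middle by auto
    have "side 3 b \<and> adj b c \<or> (sw.side 2 b \<or> middle 3 b)"
      using b p(3) 5 u_nb[of c] A1_nb[of b c] sw.u_nb[of c] A2_nb[of b c] by (auto dest: levels_disjoint)
    then show ?thesis using RB R3[of 5] cross_C4[of b c 5] 5 y5 by auto
  qed
qed

text \<open>Every other route would enter \<open>x\<close> within 7. Only a walk that leaves
  \<open>A\<^sub>3\<close> for \<open>C\<^sub>4\<close> in its last step is too slow:
  \<open>c\<close> is entered in 5, and three more steps lead down to \<open>x\<close>.\<close>

lemma A1_C4:
  assumes x: "has_child x" "\<not> entered 7 x" and y: "middle 4 y"
  obtains a b c where "adj x a" "adj a b" "adj b c" "adj c y" "side 3 c"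
    "side 2 b \<and> (side 1 a \<or> side 2 a) \<or> side 3 b \<and> side 2 a"
proof -
  have x1: "side 1 x" using x has_child_def by auto
  have yV: "y \<in> V" using y middle_def by auto
  obtain a b c where p: "x = a \<or> adj x a" "a = b \<or> adj a b" "b = c \<or> adj b c" "c = y \<or> adj c y"
    using diam4[OF side_V[OF x1] yV] by blast
  note b = A1_walk2[OF x(1) p(1,2)]
  have m: "entered k x \<Longrightarrow> k \<le> 7 \<Longrightarrow> False" for k using entered_mono[of k x 7] x(2) by auto
  have R2: "False" if "side 2 b" "entered 5 b"
    using b that A1_up[OF x(1) _ _ _ that, of a 7] descend_A2[of 5 b x 7] x1 x(2) by (auto dest: levels_disjoint)
  have R3: "False" if "side 3 b" "entered 5 b"
    using b that A1_up3[OF x(1) _ _ _ that, of a 7] x by (auto dest: levels_disjoint)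
  have RB: False if "sw.side 2 b \<or> middle 3 b"
  proof -
    have "adj x a" "side 2 a" "entered 4 a" using b that cross_B2[of a b 4] cross_C3[of a b 4] by (auto dest: levels_disjoint)
    then show ?thesis using m[of 6] descend_A2[of 4 a x 6] x1 by auto
  qed
  have bA: "b = u \<or> b = v \<or> side 1 b \<or> side 2 b \<or> side 3 b" using b RB by auto
  have "c = y \<or> adj y c" using p(4) adj_sym by blast
  with C4_nb[OF y, of c] y consider "adj y c" "side 3 c" | "sw.side 3 c" | "middle 3 c" | "middle 4 c" by blast
  then show thesis
  proof cases
    case 1
    then have "entered 5 c" using cross_C4[of c y 5] y adj_sym by auto
    then have "b \<noteq> c" using R3 1 by auto
    then have bc: "adj b c" using p by auto
    then have b2: "side 2 b \<or> side 3 b"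
      using bA u_nb[of c] sw.u_nb[of c] A1_nb[of b c] 1 by (auto dest: levels_disjoint)
    have "side 2 b \<Longrightarrow> adj x b \<Longrightarrow> False"
      using descend_A3[of 5 c b 6] descend_A2[of 6 b x 7] \<open>entered 5 c\<close> 1 bc x1 x(2) by auto
    then have "adj x a \<and> adj a b \<and> (side 2 b \<and> (side 1 a \<or> side 2 a) \<or> side 3 b \<and> side 2 a)"
      using b2 b by (auto dest: levels_disjoint)
    then show thesis using that[of a b c] bc 1 adj_sym by blast
  next
    case 2
    then have "side 3 b \<and> adj b c"
      using bA p(3) u_nb[of c] sw.u_nb[of c] A1_nb[of b c] A2_nb[of b c] by (auto dest: levels_disjoint)
    then show thesis using R3 cross_B3[of b c 5] 2 by auto
  next
    case 3
    then have "(side 2 b \<or> side 3 b) \<and> adj b c"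
      using bA p(3) u_nb[of c] sw.u_nb[of c] A1_nb[of b c] by (auto dest: levels_disjoint)
    then show thesis using R2 R3 cross_B3[of b c 5] cross_C3[of b c 5] 3 by auto
  next
    case 4
    then have "side 3 b \<and> adj b c"
      using bA p(3) u_nb[of c] sw.u_nb[of c] A1_nb[of b c] A2_nb[of b c] by (auto dest: levels_disjoint)
    then show thesis using R3 cross_C4[of b c 5] 4 by auto
  qed
qed

end

context levels
begin

section \<open>Vertices served by ears\<close>

text \<open>
  A vertex of \<open>A\<^sub>3\<close> (of \<open>A\<^sub>2\<close>) is late if it is not entered within 5 (within 6) steps. The class \<open>A3_first\<close>
  also takes some vertices that are entered in exactly 5 steps, so that their late neighbours are reached
  sooner. Its side condition on \<open>C\<^sub>4\<close> keeps such a vertex within 3 steps of \<open>u\<close> whenever the mirror image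
  relies on leaving \<open>C\<^sub>4\<close> through it.
\<close>

definition no_B3 :: bool where
  "no_B3 \<longleftrightarrow> \<not> (\<exists>y. sw.side 3 y)"

definition A3_first :: "'v \<Rightarrow> bool" where
  "A3_first x \<longleftrightarrow> above 3 x \<and> \<not> entered 4 x \<and>
    (entered 5 x \<longrightarrow> (no_B3 \<or> \<not> (\<exists>c. adj x c \<and> middle 4 c)) \<and> (\<exists>w. adj x w \<and> side 3 w \<and> \<not> entered 5 w))"

text \<open>Unattached on purpose. Such a vertex is an exit for its \<open>A3_first\<close>
  neighbour, which therefore lies outside \<open>P\<close> and is reached through its foot in 4;
  this gives entry in 5 while all downward edges remain usable. It also keeps
  \<open>A3_first\<close> and \<open>A3_second\<close> vertices from being adjacent, so the partner
  on an ear has the same class.\<close>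

definition A3_hung :: "'v \<Rightarrow> bool" where
  "A3_hung x \<longleftrightarrow> side 3 x \<and> \<not> entered 5 x \<and> \<not> A3_first x \<and> (\<exists>a. adj x a \<and> A3_first a)"

definition A3_second :: "'v \<Rightarrow> bool" where
  "A3_second x \<longleftrightarrow> above 4 x \<and> \<not> entered 5 x \<and> \<not> A3_first x \<and> \<not> A3_hung x"

definition A3_late :: "'v \<Rightarrow> bool" where
  "A3_late x \<longleftrightarrow> side 3 x \<and> \<not> entered 5 x \<and> \<not> A3_first x \<and> \<not> A3_second x \<and> \<not> A3_hung x"

definition A2_late :: "'v \<Rightarrow> bool" where
  "A2_late x \<longleftrightarrow> side 2 x \<and> \<not> entered 6 x"

definition supplied :: "'v \<Rightarrow> bool" where
  "supplied x \<longleftrightarrow> (\<exists>a. adj x a \<and> (A3_first a \<or> A3_second a \<or> A3_hung a))"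

text \<open>The last condition guarantees a second way out. Edges to \<open>A\<^sub>3\<close> point
  down to \<open>x\<close> and are no exits; without neighbours in \<open>A\<^sub>3\<close> the edge
  from \<open>two_edges\<close> goes to \<open>A\<^sub>1\<close> or \<open>A\<^sub>2\<close>,
  otherwise a neighbour in \<open>A\<^sub>2\<close> is required.\<close>

definition A2_rooted :: "'v \<Rightarrow> bool" where
  "A2_rooted x \<longleftrightarrow> A2_late x \<and> \<not> supplied x \<and> low_parent x \<and> ((\<exists>a. adj x a \<and> side 3 a) \<longrightarrow> (\<exists>a. adj x a \<and> side 2 a))"

definition A2_below :: "'v \<Rightarrow> bool" where
  "A2_below x \<longleftrightarrow> A2_late x \<and> \<not> A2_rooted x \<and> (\<exists>a. adj x a \<and> side 3 a)"

definition A2_beside :: "'v \<Rightarrow> bool" where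
  "A2_beside x \<longleftrightarrow> A2_late x \<and> \<not> A2_rooted x \<and> \<not> (\<exists>a. adj x a \<and> side 3 a)"

definition attached :: "'v \<Rightarrow> bool" where
  "attached x \<longleftrightarrow> side 1 x \<and> \<not> has_child x \<or> A3_first x \<or> A3_second x \<or> A2_rooted x"

text \<open>The bounds 5, 3 and 4 let a vertex that is entered through its foot be reached in 6
  (\<open>A2_rooted\<close>), 4 (\<open>A3_first\<close>) and 5 (\<open>A3_second\<close>) steps.
  They also ensure that a foot is never attached itself.\<close>

definition is_foot :: "'v \<Rightarrow> 'v \<Rightarrow> bool" where
  "is_foot x p \<longleftrightarrow> (if side 1 x then p = u else if side 2 x then side 1 p \<and> entered 5 p
     else side 2 p \<and> entered (if A3_first x then 3 else 4) p)"

lemma class_side: "A3_first x \<Longrightarrow> side 3 x" "A3_second x \<Longrightarrow> side 3 x" "A3_hung x \<Longrightarrow> side 3 x" "A3_late x \<Longrightarrow> side 3 x" "A2_rooted x \<Longrightarrow> side 2 x" "A2_late x \<Longrightarrow> side 2 x"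
  "A2_below x \<Longrightarrow> A2_late x" "A2_beside x \<Longrightarrow> A2_late x" "A2_rooted x \<Longrightarrow> A2_late x"
  unfolding A3_first_def A3_second_def A3_hung_def A3_late_def A2_rooted_def A2_late_def A2_below_def A2_beside_def above_def by auto

lemma attached_A1: "side 1 x \<Longrightarrow> attached x \<longleftrightarrow> \<not> has_child x"
  unfolding attached_def using class_side(1,2,5)[of x] by (auto dest: levels_disjoint)

lemma attached_A2: "side 2 x \<Longrightarrow> attached x \<longleftrightarrow> A2_rooted x"
  unfolding attached_def using class_side(1,2,5)[of x] by (auto dest: levels_disjoint)

lemma attached_A3: "side 3 x \<Longrightarrow> attached x \<longleftrightarrow> A3_first x \<or> A3_second x"
  unfolding attached_def using class_side(1,2,5)[of x] by (auto dest: levels_disjoint)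

lemma attached_side: "attached x \<Longrightarrow> side 1 x \<or> side 2 x \<or> side 3 x"
  unfolding attached_def using class_side(1,2,5)[of x] by auto

lemma not_attached: "side 2 x \<Longrightarrow> entered 6 x \<Longrightarrow> \<not> attached x" "has_child x \<Longrightarrow> \<not> attached x" "side 3 x \<Longrightarrow> entered 4 x \<Longrightarrow> \<not> attached x" "\<not> attached u"
    "A3_hung x \<Longrightarrow> \<not> attached x" "A3_late x \<Longrightarrow> \<not> attached x" "A2_below x \<Longrightarrow> \<not> attached x" "A2_beside x \<Longrightarrow> \<not> attached x"
proof -
  show "\<not> attached x" if "side 2 x" "entered 6 x"
    using attached_A2[OF that(1)] that(2) unfolding A2_rooted_def A2_late_def by blast
  show "\<not> attached x" if "A2_below x"
    using attached_A2[OF class_side(6)[OF class_side(7)[OF that]]] that unfolding A2_below_def by blast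
  show "\<not> attached x" if "A2_beside x"
    using attached_A2[OF class_side(6)[OF class_side(8)[OF that]]] that unfolding A2_beside_def by blast
  show "\<not> attached x" if "has_child x" using attached_A1[of x] that unfolding has_child_def by blast
  show "\<not> attached x" if "side 3 x" "entered 4 x"
    using attached_A3[OF that(1)] that(2) entered_mono[OF that(2), of 5] unfolding A3_first_def A3_second_def by simp
  show "\<not> attached x" if "A3_hung x"
    using attached_A3[OF class_side(3)[OF that]] that unfolding A3_hung_def A3_second_def by blast
  show "\<not> attached x" if "A3_late x"
    using attached_A3[OF class_side(4)[OF that]] that unfolding A3_late_def by blast
  show "\<not> attached u" using attached_side[of u] by (auto dest: levels_disjoint)
qed

lemma A2_late_nb: "A2_late x \<Longrightarrow> adj x a \<Longrightarrow> side 3 a \<Longrightarrow> \<not> entered 5 a"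
  using descend_A3[of 5 a x 6] unfolding A2_late_def by auto

text \<open>This is the purpose of \<open>supplied\<close> in \<open>A2_rooted\<close>: vertices of
  \<open>A\<^sub>2\<close> below these vertices stay unattached and reach \<open>u\<close> in 2
  steps, which makes descending from \<open>A\<^sub>3\<close> cheap.\<close>

lemma not_attached_below: "side 2 w \<Longrightarrow> adj x w \<Longrightarrow> A3_first x \<or> A3_second x \<or> A3_hung x \<or> side 3 x \<and> entered 5 x \<Longrightarrow> \<not> attached w"
  using attached_A2[of w] A2_late_nb[of w x] adj_sym[of x w] unfolding A2_rooted_def supplied_def by blast

lemma below_has_child: "side 2 x \<Longrightarrow> adj x w \<Longrightarrow> side 1 w \<Longrightarrow> has_child w"
  using adj_sym unfolding has_child_def by blast

text \<open>As \<open>x\<close> is not \<open>A3_second\<close>, only the second case of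
  \<open>A3_cases\<close> is left, with a neighbour \<open>a\<close> that is \<open>above 3\<close>.
  It is not \<open>A3_first\<close>, otherwise \<open>x\<close> would be hung, and not entered in 4,
  otherwise \<open>x\<close> would be entered in 5. So the side condition of \<open>A3_first\<close>
  fails at \<open>a\<close>: it is entered in 5, and \<open>no_B3\<close> is false.\<close>

lemma A3_late_nb:
  assumes "A3_late x"
  shows "(\<exists>y. sw.side 3 y) \<and> (\<exists>a. adj x a \<and> side 3 a \<and> entered 5 a \<and> \<not> attached a)"
proof -
  have x: "side 3 x" "\<not> entered 5 x" "\<not> A3_first x" "\<not> A3_hung x" "\<not> A3_second x" using assms unfolding A3_late_def by auto
  then have "\<not> above 4 x" using A3_second_def by auto
  then obtain a where a: "adj x a" "side 3 a" "above 3 a"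
    using A3_cases[OF x(1,2)] x unfolding above_def by blast
  have "\<not> A3_first a" using x a A3_hung_def by auto
  moreover have "\<not> entered 4 a" using sideways_A3[of 4 a x 5] x a by auto
  ultimately have "entered 5 a" "\<not> no_B3" using a x adj_sym[OF a(1)] unfolding A3_first_def by auto
  moreover from this have "\<not> attached a" using attached_A3[OF a(2)] \<open>\<not> A3_first a\<close> A3_second_def by auto
  ultimately show ?thesis using a no_B3_def by auto
qed

lemma foot_ex: "attached x \<Longrightarrow> \<exists>p. adj x p \<and> is_foot x p"
proof -
  assume "attached x"
  then consider "side 1 x" | "A3_first x" | "A3_second x" | "A2_rooted x" unfolding attached_def by auto
  then show ?thesis
  proof cases
    case 1 then show ?thesis using down1 unfolding is_foot_def by auto
  next
    case 2 then have "side 3 x" "\<exists>b. adj x b \<and> side 2 b \<and> entered 3 b" using class_side unfolding A3_first_def above_def by auto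
    then show ?thesis using 2 unfolding is_foot_def by (auto dest: levels_disjoint)
  next
    case 3 then have "side 3 x" "\<exists>b. adj x b \<and> side 2 b \<and> entered 4 b" "\<not> A3_first x" using class_side unfolding A3_second_def above_def by auto
    then show ?thesis unfolding is_foot_def by (auto dest: levels_disjoint)
  next
    case 4 then have "side 2 x" "low_parent x" using class_side unfolding A2_rooted_def by auto
    then show ?thesis unfolding is_foot_def low_parent_def by (auto dest: levels_disjoint)
  qed
qed

lemma foot_level: "attached x \<Longrightarrow> is_foot x p \<Longrightarrow> du x = Suc (du p) \<and> du p < dv p \<and> p \<in> V \<and> \<not> attached p"
proof -
  assume x: "attached x" and p: "is_foot x p"
  from attached_side[OF x] consider "side 1 x" | "side 2 x" | "side 3 x" by auto
  then show ?thesis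
  proof cases
    case 1 then have "p = u" using p unfolding is_foot_def by auto
    then show ?thesis using 1 du_u dv_u uV not_attached unfolding side_def by auto
  next
    case 2
    then have "\<not> side 1 x" by (auto dest: levels_disjoint)
    then have "side 1 p" "entered 5 p" using p 2 unfolding is_foot_def by simp_all
    then show ?thesis using 2 entered_has_child not_attached(2) unfolding side_def by auto
  next
    case 3
    then have "\<not> side 1 x" "\<not> side 2 x" by (auto dest: levels_disjoint)
    then have "side 2 p" "entered (if A3_first x then 3 else 4) p" using p unfolding is_foot_def by simp_all
    then have "side 2 p" "entered 6 p" using entered_mono[of "if A3_first x then 3 else 4" p 6] by (simp_all split: if_splits)
    then show ?thesis using 3 not_attached(1) unfolding side_def by auto
  qed
qed

lemma ends_other: "g \<in> E \<Longrightarrow> x \<in> ed g \<Longrightarrow> \<exists>w. ed g = {x, w} \<and> adj x w"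
  using ed2[of g] unfolding adj_def by (metis empty_iff insert_commute insert_iff)

lemma side_less: "side i x \<Longrightarrow> du x < dv x"
  unfolding side_def by simp

text \<open>The second edge comes from \<open>two_edges\<close> and may be parallel to the foot
  edge, so \<open>via0\<close> argues with edges instead of neighbours. For an
  \<open>A3_first\<close> vertex entered in 5 that edge might cross to the middle, and the neighbour
  demanded in \<open>A3_first_def\<close> takes its place. Lower neighbours are never attached here,
  so an attached end lies on the level of \<open>x\<close>.\<close>

lemma attached_other_edge:
  assumes x: "attached x" and e: "ed e = {x, p}" "is_foot x p"
  shows "\<exists>g\<in>E. g \<noteq> e \<and> (\<exists>w. ed g = {x, w} \<and> du w < dv w \<and> du w \<le> du x \<and> (attached w \<longrightarrow> du w = du x))"
proof -
  have xV: "x \<in> V" using attached_side[OF x] side_V by auto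
  obtain g0 where g0: "g0 \<in> E" "g0 \<noteq> e" "x \<in> ed g0" using two_edges[OF xV] by blast
  obtain w0 where w0: "ed g0 = {x, w0}" "adj x w0" using ends_other[OF g0(1,3)] by auto
  have pl: "du x = Suc (du p)" using foot_level[OF x e(2)] by auto
  have viaw: ?thesis if w: "adj x w" "side i w" "side i x" for w i
  proof -
    obtain g where g: "g \<in> E" "ed g = {x, w}" using w(1) unfolding adj_def by blast
    have "g \<noteq> e" using g e pl w adjV[OF w(1)] by (auto simp: doubleton_eq_iff side_def)
    then show ?thesis using g w side_less[OF w(2)]
      by (intro bexI[of _ g] conjI exI[of _ w]) (auto simp: side_def)
  qed
  have via0: ?thesis if "side i w0" "side i x \<or> Suc i = du x \<and> \<not> attached w0" for i
    using that g0 w0 side_less[OF that(1)]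
    by (intro bexI[of _ g0] conjI exI[of _ w0]) (auto simp: side_def)
  from x consider "side 1 x" "\<not> has_child x" | "A3_first x" "entered 5 x" | "(A3_first x \<or> A3_second x) \<and> \<not> entered 5 x" | "A2_rooted x" "\<not> (\<exists>a. adj x a \<and> side 3 a)" | "A2_rooted x" "\<exists>a. adj x a \<and> side 2 a"
    unfolding attached_def A3_second_def A2_rooted_def by blast
  then show ?thesis
  proof cases
    case 1
    then have "w0 = u \<or> side 1 w0" using A1_nb[OF 1(1) w0(2)] w0 unfolding has_child_def by auto
    then show ?thesis using via0[of 0] via0[of 1] 1 side_0 not_attached(4) unfolding side_def by auto
  next
    case 2
    then show ?thesis using viaw[of _ 3] class_side unfolding A3_first_def by blast
  next
    case 3
    then have x3: "side 3 x" "\<not> entered 5 x" using class_side by auto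
    then have "side 2 w0 \<or> side 3 w0" using A3_nb_unentered[of 5 x w0 4] w0 by auto
    then show ?thesis using via0[of 2] via0[of 3] x3 not_attached_below[of w0 x] w0 3 unfolding side_def by auto
  next
    case 4
    then have x2: "side 2 x" "\<not> entered 6 x" using class_side unfolding A2_late_def by auto
    then have "side 1 w0 \<or> side 2 w0" using A2_nb_unentered[of 6 x w0 5] w0 4 by auto
    then show ?thesis using via0[of 1] via0[of 2] x2 below_has_child[OF x2(1) w0(2)] not_attached(2)[of w0] unfolding side_def by auto
  next
    case 5
    then show ?thesis using viaw[of _ 2] class_side by blast
  qed
qed

end

text \<open>
  Each attached vertex owns one edge \<open>f x\<close> to a foot. Vertices in \<open>P\<close> leave through the foot and are entered
  from an attached neighbour outside \<open>P\<close>; all others are entered through the foot and leave elsewhere.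
\<close>

locale attachment = levels +
  fixes f :: "'a \<Rightarrow> 'b" and P :: "'a set"
  assumes f: "attached x \<Longrightarrow> f x \<in> E \<and> (\<exists>p. ed (f x) = {x, p} \<and> is_foot x p)"
    and P_X: "x \<in> P \<Longrightarrow> attached x"
    and P_no_exit: "x \<in> P \<Longrightarrow> g \<in> E \<Longrightarrow> g \<noteq> f x \<Longrightarrow> ed g = {x, w} \<Longrightarrow> du w < dv w \<Longrightarrow> du w \<le> du x \<Longrightarrow> attached w"
    and P_nb: "x \<in> P \<Longrightarrow> \<exists>w. attached w \<and> w \<notin> P \<and> adj x w \<and> du w = du x"
    and Q_exit: "attached x \<Longrightarrow> x \<notin> P \<Longrightarrow> (\<exists>g\<in>E. g \<noteq> f x \<and> (\<exists>w. ed g = {x, w} \<and> du w < dv w \<and> du w \<le> du x \<and> \<not> attached w))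
      \<or> (\<exists>w\<in>P. adj x w \<and> du w = du x)"

section \<open>Choosing which end of each ear leaves through its foot\<close>

lemma maximal_independent:
  fixes S :: "'v set"
  assumes "finite S"
  shows "\<exists>P\<subseteq>S. (\<forall>x\<in>P. \<forall>y\<in>P. \<not> R x y) \<and> (\<forall>x\<in>S - P. \<not> R x x \<longrightarrow> (\<exists>y\<in>P. R x y \<or> R y x))"
proof -
  let ?F = "{P. P \<subseteq> S \<and> (\<forall>x\<in>P. \<forall>y\<in>P. \<not> R x y)}"
  have "finite ?F" "{} \<in> ?F" using assms by auto
  then have "\<exists>P\<in>?F. \<forall>P'\<in>?F. P \<subseteq> P' \<longrightarrow> P = P'"
    by (intro finite_has_maximal) auto
  then obtain P where P: "P \<in> ?F" "\<forall>P'\<in>?F. P \<subseteq> P' \<longrightarrow> P = P'" by blast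
  have "\<exists>y\<in>P. R x y \<or> R y x" if "x \<in> S" "x \<notin> P" "\<not> R x x" for x
  proof (rule ccontr)
    assume "\<not> ?thesis"
    then have "insert x P \<in> ?F" using P(1) that by auto
    then show False using P(2) that by blast
  qed
  then show ?thesis using P(1) by blast
qed

context levels
begin

text \<open>\<open>P\<close> is a maximal independent set, for adjacency within a level, among the
  attached vertices without an exit to an unattached vertex. By independence, the second edge of a
  vertex of \<open>P\<close> ends in an attached vertex outside \<open>P\<close>, its entry. By
  maximality, a vertex outside \<open>P\<close> without such an exit has a neighbour in
  \<open>P\<close> to leave through.\<close>

lemma attachment_ex: "\<exists>f P. attachment V E ed u v du dv adj f P"
proof -
  have "\<forall>x. \<exists>e. attached x \<longrightarrow> e \<in> E \<and> (\<exists>p. ed e = {x, p} \<and> is_foot x p)"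
    using foot_ex unfolding adj_def by blast
  then obtain f where f: "attached x \<Longrightarrow> f x \<in> E \<and> (\<exists>p. ed (f x) = {x, p} \<and> is_foot x p)" for x
    by metis
  define ex where "ex x \<longleftrightarrow> (\<exists>g\<in>E. g \<noteq> f x \<and> (\<exists>w. ed g = {x, w} \<and> du w < dv w \<and> du w \<le> du x \<and> \<not> attached w))" for x
  define S where "S = {x. attached x \<and> \<not> ex x}"
  define R where "R x y \<longleftrightarrow> adj x y \<and> du x = du y" for x y
  have "S \<subseteq> V" using attached_side side_V unfolding S_def by blast
  then have "finite S" using finV finite_subset by blast
  from maximal_independent[OF this, of R] obtain P where P: "P \<subseteq> S" "\<And>x y. x \<in> P \<Longrightarrow> y \<in> P \<Longrightarrow> \<not> R x y"
    "\<And>x. x \<in> S \<Longrightarrow> x \<notin> P \<Longrightarrow> \<not> R x x \<Longrightarrow> \<exists>y\<in>P. R x y \<or> R y x"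
    by blast
  have PS: "attached x" "\<not> ex x" if "x \<in> P" for x using P(1) that unfolding S_def by auto
  have "attachment V E ed u v du dv adj f P"
  proof
    show "attached x \<Longrightarrow> f x \<in> E \<and> (\<exists>p. ed (f x) = {x, p} \<and> is_foot x p)" for x by (fact f)
    show "x \<in> P \<Longrightarrow> attached x" for x by (rule PS)
    show "attached w" if "x \<in> P" "g \<in> E" "g \<noteq> f x" "ed g = {x, w}" "du w < dv w" "du w \<le> du x" for x g w
      using that PS(2)[of x] unfolding ex_def by blast
    show "\<exists>w. attached w \<and> w \<notin> P \<and> adj x w \<and> du w = du x" if x: "x \<in> P" for x
    proof -
      obtain p where p: "ed (f x) = {x, p}" "is_foot x p" using f[OF PS(1)[OF x]] by blast
      obtain g w where "g \<in> E" "g \<noteq> f x" "ed g = {x, w}" "du w < dv w" "du w \<le> du x" "attached w \<longrightarrow> du w = du x"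
        using attached_other_edge[OF PS(1)[OF x] p] by blast
      moreover from this have "attached w" using PS(2)[OF x] unfolding ex_def by blast
      ultimately show ?thesis using P(2)[OF x, of w] adjI[of g x w] unfolding R_def by auto
    qed
    show "(\<exists>g\<in>E. g \<noteq> f x \<and> (\<exists>w. ed g = {x, w} \<and> du w < dv w \<and> du w \<le> du x \<and> \<not> attached w))
      \<or> (\<exists>w\<in>P. adj x w \<and> du w = du x)" if "attached x" "x \<notin> P" for x
    proof (cases "ex x")
      case False
      then show ?thesis using P(3)[of x] that adjV[of x x] adj_sym unfolding R_def S_def by force
    qed (auto simp: ex_def)
  qed
  then show ?thesis by blast
qed

end

section \<open>The prescribed orientation inside the \<open>A\<close>-side\<close>

context attachment
begin

text \<open>
  Edges within a level go from lower to higher priority. The value 8 for \<open>A2_below\<close> is at least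
  \<open>2 + entry_time\<close> on the vertices of \<open>A\<^sub>2\<close> that are not late and smaller than it on \<open>A2_beside\<close>; 50 stands for infinity.
\<close>

definition entry_time :: "'a \<Rightarrow> nat" where
  "entry_time x = (if \<exists>k. entered k x then LEAST k. entered k x else 50)"

definition priority :: "'a \<Rightarrow> nat" where
  "priority x = (if attached x then (if x \<in> P then 1 else 0) else if A2_below x then 8 else 2 + entry_time x)"

text \<open>Everything flows down, except along the foot edges of attached vertices outside
  \<open>P\<close>. An edge within a level between vertices of equal priority gets no direction
  here; it is directed arbitrarily in \<open>good_orientation\<close>.\<close>

definition half_arc :: "'b \<Rightarrow> 'a \<Rightarrow> 'a \<Rightarrow> bool" where
  "half_arc e s t \<longleftrightarrow> e \<in> E \<and> ed e = {s, t} \<and> du s < dv s \<and> du t < dv t \<and>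
     (du s = Suc (du t) \<and> e \<notin> f ` {x. attached x \<and> x \<notin> P} \<or>
      du t = Suc (du s) \<and> e \<in> f ` {x. attached x \<and> x \<notin> P} \<or>
      du s = du t \<and> priority s < priority t)"

lemma entry_time_le: "entered k x \<Longrightarrow> entry_time x \<le> k"
  unfolding entry_time_def by (auto intro: Least_le)

lemma entered_entry_time: "entered k x \<Longrightarrow> entered (entry_time x) x"
  unfolding entry_time_def by (auto intro: LeastI)

lemma entry_time_gt: "\<not> entered k x \<Longrightarrow> k < 50 \<Longrightarrow> k < entry_time x"
proof (cases "\<exists>j. entered j x")
  case True
  assume "\<not> entered k x"
  then show ?thesis using entered_entry_time entered_mono[of "entry_time x" x k] True by (meson not_less)
qed (simp add: entry_time_def)

lemma priority_P: "x \<in> P \<Longrightarrow> priority x = 1" and priority_Q: "attached x \<Longrightarrow> x \<notin> P \<Longrightarrow> priority x = 0" and priority_not_attached: "\<not> attached x \<Longrightarrow> 2 \<le> priority x"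
  and priority_A2_below: "A2_below x \<Longrightarrow> priority x = 8"
  and priority_entry_time: "\<not> attached x \<Longrightarrow> \<not> A2_below x \<Longrightarrow> priority x = 2 + entry_time x"
  using P_X[of x] not_attached(7)[of x] unfolding priority_def by simp_all

lemma side_of: "w \<in> V \<Longrightarrow> du w < dv w \<Longrightarrow> side (du w) w"
  using dv_du[of w] unfolding side_def by auto

lemma half_arc_side:
  assumes "half_arc e s t"
  shows "\<exists>i j. side i s \<and> side j t"
proof -
  have a: "e \<in> E" "ed e = {s, t}" "du s < dv s" "du t < dv t" using assms unfolding half_arc_def by blast+
  then have V: "s \<in> V" "t \<in> V" using adjV[OF adjI[OF a(1,2)]] by blast+
  show ?thesis using side_of[OF V(1) a(3)] side_of[OF V(2) a(4)] by blast
qed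

lemma half_arc_antisym:
  assumes "half_arc e s t"
  shows "\<not> half_arc e t s"
proof
  assume "half_arc e t s"
  then have "du t = Suc (du s) \<and> e \<notin> f ` {x. attached x \<and> x \<notin> P} \<or>
      du s = Suc (du t) \<and> e \<in> f ` {x. attached x \<and> x \<notin> P} \<or> du t = du s \<and> priority t < priority s"
    unfolding half_arc_def by blast
  moreover have "du s = Suc (du t) \<and> e \<notin> f ` {x. attached x \<and> x \<notin> P} \<or>
      du t = Suc (du s) \<and> e \<in> f ` {x. attached x \<and> x \<notin> P} \<or> du s = du t \<and> priority s < priority t"
    using assms unfolding half_arc_def by blast
  ultimately show False by (elim disjE conjE) simp_all
qed

lemma foot_owner:
  assumes e: "ed e = {x, w}" and d: "du x = Suc (du w)" and y: "e = f y" "attached y"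
  shows "y = x"
proof -
  obtain p where p: "ed (f y) = {y, p}" "is_foot y p" using f[OF y(2)] by blast
  have yp: "du y = Suc (du p)" using foot_level[OF y(2) p(2)] by blast
  have "{y, p} = {x, w}" using e y(1) p(1) by simp
  then have "y = x \<or> y = w \<and> p = x" by (auto simp: doubleton_eq_iff)
  then show ?thesis using d yp by auto
qed

lemma foot_edge:
  assumes x: "attached x" and w: "ed (f x) = {x, w}"
  shows "is_foot x w"
proof -
  obtain p where p: "ed (f x) = {x, p}" "is_foot x p" using f[OF x] by blast
  then have "p = w" using w by (auto simp: doubleton_eq_iff)
  then show ?thesis using p(2) by simp
qed

lemma P_exit:
  assumes "attached a" "adj a x" "du x \<le> du a" "du x < dv x" "\<not> attached x" "\<not> is_foot a x"
  shows "a \<notin> P"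
proof
  assume "a \<in> P"
  obtain g where "g \<in> E" "ed g = {a, x}" using assms(2) unfolding adj_def by blast
  moreover from this have "g \<noteq> f a" using foot_edge[OF assms(1), of x] assms(6) by auto
  ultimately show False using P_no_exit[OF \<open>a \<in> P\<close>, of g x] assms(3-5) by blast
qed

end

section \<open>Directed distances on one side\<close>

text \<open>Only an inclusion is required, so \<open>arc\<close> can be the relation of the whole
  orientation, and for the mirrored side its converse.\<close>

locale oriented_half = attachment +
  fixes arc :: "'a \<Rightarrow> 'a \<Rightarrow> bool"
  assumes half_arc_arc: "half_arc e s t \<Longrightarrow> arc s t"
begin

lemma arc_down_attached:
  assumes "attached x" "g \<in> E" "g \<noteq> f x" "ed g = {x, w}" "side i w" "side (Suc i) x"
  shows "arc x w"
proof (rule half_arc_arc)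
  have "g \<noteq> f y" if "attached y" for y
    using foot_owner[OF assms(4) _ _ that] assms(3,5,6) by (auto simp: side_def)
  then show "half_arc g x w" using assms unfolding half_arc_def side_def by auto
qed

lemma arc_down:
  assumes "\<not> attached x" "adj x w" "side i w" "side (Suc i) x"
  shows "arc x w"
proof -
  obtain g where g: "g \<in> E" "ed g = {x, w}" using assms(2) unfolding adj_def by blast
  have "g \<noteq> f y" if "attached y" for y
    using foot_owner[OF g(2) _ _ that] assms that by (auto simp: side_def)
  then have "half_arc g x w" using assms g unfolding half_arc_def side_def by auto
  then show ?thesis by (rule half_arc_arc)
qed

lemma arc_down_nofoot:
  assumes "\<not> is_foot x w" "adj x w" "side i w" "side (Suc i) x"
  shows "arc x w"
proof (cases "attached x")
  case True
  obtain g where g: "g \<in> E" "ed g = {x, w}" using assms(2) unfolding adj_def by blast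
  have "g \<noteq> f x" using foot_edge[OF True, of w] assms(1) g by auto
  then show ?thesis using arc_down_attached True g assms by blast
qed (use arc_down assms in blast)

lemma arc_P: "x \<in> P \<Longrightarrow> \<exists>p. is_foot x p \<and> arc x p"
proof -
  assume x: "x \<in> P"
  note Xx = P_X[OF x]
  obtain p where p: "ed (f x) = {x, p}" "is_foot x p" "f x \<in> E" using f[OF Xx] by auto
  note l = foot_level[OF Xx p(2)]
  have "f x \<noteq> f y" if "attached y" "y \<notin> P" for y
    using foot_owner[OF p(1) _ _ that(1)] l that x by auto
  moreover have "du x < dv x" using attached_side[OF Xx] side_less by auto
  ultimately have "half_arc (f x) x p" using p l unfolding half_arc_def by auto
  then show ?thesis using p half_arc_arc by blast
qed

lemma arc_Q: "attached x \<Longrightarrow> x \<notin> P \<Longrightarrow> \<exists>p. is_foot x p \<and> arc p x"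
proof -
  assume Xx: "attached x" and x: "x \<notin> P"
  obtain p where p: "ed (f x) = {x, p}" "is_foot x p" "f x \<in> E" using f[OF Xx] by auto
  note l = foot_level[OF Xx p(2)]
  have "du x < dv x" using attached_side[OF Xx] side_less by auto
  then have "half_arc (f x) p x" using p l Xx x unfolding half_arc_def by (auto simp: insert_commute)
  then show ?thesis using p half_arc_arc by blast
qed

lemma arc_sideways: "adj x w \<Longrightarrow> side i x \<Longrightarrow> side i w \<Longrightarrow> priority x < priority w \<Longrightarrow> arc x w"
proof -
  assume a: "adj x w" "side i x" "side i w" "priority x < priority w"
  then obtain g where g: "g \<in> E" "ed g = {x, w}" unfolding adj_def by blast
  then have "half_arc g x w" using a unfolding half_arc_def side_def by auto
  then show ?thesis by (rule half_arc_arc)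
qed

lemma Q_cases:
  assumes x: "attached x" "x \<notin> P" "side k x" "k = Suc i"
  obtains w where "adj x w" "arc x w" "side i w" | w where "adj x w" "arc x w" "side k w" "\<not> attached w"
    | w where "adj x w" "arc x w" "side k w" "w \<in> P"
  using Q_exit[OF x(1,2)]
proof (elim disjE bexE conjE exE)
  fix w assume w: "w \<in> P" "adj x w" "du w = du x"
  then have "side k w" using attached_side[OF P_X[OF w(1)]] x(3) by (auto simp: side_def)
  then show thesis using that(3)[OF w(2)] arc_sideways[OF w(2) x(3)] priority_Q[OF x(1,2)] priority_P[OF w(1)] w by simp
next
  fix g w assume g: "g \<in> E" "g \<noteq> f x" "ed g = {x, w}" "du w < dv w" "du w \<le> du x" "\<not> attached w"
  have xw: "adj x w" using adjI g by blast
  have w: "side (du w) w" using side_of[OF _ g(4)] adjV[OF xw] by auto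
  show thesis
  proof (cases "du w = du x")
    case True
    then have w': "side k w" using w x(3) by (simp add: side_def)
    then show thesis using that(2)[OF xw] arc_sideways[OF xw x(3) w'] priority_Q[OF x(1,2)] priority_not_attached[OF g(6)] g(6) by simp
  next
    case False
    then have "du w = i" using g(5) adj_levels(2)[OF xw] x(3,4) by (simp add: side_def)
    then have "side i w" using w by simp
    then show thesis using that(1)[OF xw] arc_down_attached[OF x(1) g(1,2,3) _ x(3)[unfolded x(4)]] by blast
  qed
qed

abbreviation dout :: "nat \<Rightarrow> 'a \<Rightarrow> bool" where
  "dout n x \<equiv> reach arc n x u"

abbreviation din :: "nat \<Rightarrow> 'a \<Rightarrow> bool" where
  "din n x \<equiv> reach arc n v x"

lemma dout_A1: "has_child x \<Longrightarrow> dout 1 x"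
  using reach_one[of arc x u] arc_down[of x u 0] down1[of x] not_attached(2)[of x] side_0[of u] unfolding has_child_def by auto

lemma dout_step: "arc x y \<Longrightarrow> dout m y \<Longrightarrow> m < n \<Longrightarrow> dout n x"
  using reach_Suc2[of arc x y m u] reach_mono[of arc "Suc m" x u n] by auto

lemma din_step: "din m x \<Longrightarrow> arc x y \<Longrightarrow> m < n \<Longrightarrow> din n y"
  using reach_Suc[of arc m v x y] reach_mono[of arc "Suc m" v y n] by auto

lemma three_Suc: "3 = Suc 2"
  by simp

lemma dout_A2_free: "side 2 x \<Longrightarrow> \<not> attached x \<Longrightarrow> dout 2 x"
proof -
  assume x: "side 2 x" "\<not> attached x"
  obtain w where w: "adj x w" "has_child w" using down2[OF x(1)] by blast
  have "side 1 w" using w(2) unfolding has_child_def by blast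
  then have "arc x w" using arc_down[OF x(2) w(1), of 1] x(1) by (simp only: Suc_1)
  then show ?thesis using dout_step[OF _ dout_A1[OF w(2)], of x 2] by simp
qed

lemma isfoot2: "side 2 x \<Longrightarrow> is_foot x p \<longleftrightarrow> side 1 p \<and> entered 5 p"
  unfolding is_foot_def by (auto dest: levels_disjoint)

lemma isfoot3: "side 3 x \<Longrightarrow> is_foot x p \<longleftrightarrow> side 2 p \<and> entered (if A3_first x then 3 else 4) p"
  unfolding is_foot_def by (auto dest: levels_disjoint)

lemma isfoot1: "side 1 x \<Longrightarrow> is_foot x p \<longleftrightarrow> p = u"
  unfolding is_foot_def by auto

lemma dout_A2_P: "side 2 x \<Longrightarrow> x \<in> P \<Longrightarrow> dout 2 x"
  using arc_P[of x] isfoot2[of x] entered_has_child[of 5] dout_A1 dout_step[of x _ 1 2] by fastforce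

lemma dout_A2: "side 2 x \<Longrightarrow> dout 3 x"
proof -
  assume x: "side 2 x"
  consider "\<not> attached x" | "x \<in> P" | "attached x" "x \<notin> P" by blast
  then show ?thesis
  proof cases
    case 1 then show ?thesis using dout_A2_free[OF x] reach_mono[of arc 2 x u 3] by simp
  next
    case 2 then show ?thesis using dout_A2_P[OF x] reach_mono[of arc 2 x u 3] by simp
  next
    case 3
    from Q_cases[OF 3 x Suc_1[symmetric]] show ?thesis
    proof cases
      case (1 w)
      then show ?thesis using dout_step[OF 1(2) dout_A1, of 3] below_has_child[OF x 1(1)] by simp
    next
      case (2 w)
      then show ?thesis using dout_step[OF 2(2) dout_A2_free, of 3] by simp
    next
      case (3 w)
      then show ?thesis using dout_step[OF 3(2) dout_A2_P, of 3] by simp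
    qed
  qed
qed

lemma dout_A3_free: "side 3 x \<Longrightarrow> \<not> attached x \<Longrightarrow> \<not> A3_late x \<Longrightarrow> dout 3 x"
proof -
  assume x: "side 3 x" "\<not> attached x" "\<not> A3_late x"
  then have "A3_hung x \<or> entered 5 x" using attached_A3[OF x(1)] A3_late_def by blast
  moreover obtain w where w: "adj x w" "side 2 w" using down3[OF x(1)] by blast
  ultimately have "\<not> attached w" using not_attached_below[OF w(2,1)] x(1) by blast
  then show ?thesis using dout_step[OF arc_down[OF x(2) w(1), of 2] dout_A2_free, of 3] w x by simp
qed

lemma dout_A3_late: "A3_late x \<Longrightarrow> dout 4 x"
proof -
  assume t: "A3_late x"
  obtain w where w: "adj x w" "side 2 w" using down3[OF class_side(4)[OF t]] by blast
  have "arc x w" using arc_down[OF not_attached(6)[OF t] w(1), of 2] w(2) class_side(4)[OF t] by simp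
  then show ?thesis using dout_step[OF _ dout_A2[OF w(2)], of x 4] by simp
qed

lemma dout_A3_P: "side 3 x \<Longrightarrow> x \<in> P \<Longrightarrow> dout 3 x"
proof -
  assume x: "side 3 x" "x \<in> P"
  obtain p where p: "is_foot x p" "arc x p" using arc_P[OF x(2)] by blast
  have "side 2 p" "entered 6 p" using p(1) isfoot3[OF x(1)] entered_mono[of "if A3_first x then 3 else 4" p 6] by (auto split: if_splits)
  then show ?thesis using dout_step[OF p(2) dout_A2_free, of 3] not_attached(1) by simp
qed

text \<open>The 5 arises only when an attached vertex outside \<open>P\<close> leaves sideways to an
  \<open>A3_late\<close> one, whose lower neighbour may be attached in turn and then needs 3
  steps.\<close>

lemma dout_A3: "side 3 x \<Longrightarrow> dout 5 x \<and> ((\<nexists>y. A3_late y) \<longrightarrow> dout 4 x)"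
proof -
  assume x: "side 3 x"
  have m: "dout 3 x \<Longrightarrow> ?thesis" using reach_mono[of arc 3 x u 5] reach_mono[of arc 3 x u 4] by auto
  have m4: "dout 4 x \<Longrightarrow> ?thesis" using reach_mono[of arc 4 x u 5] by auto
  consider "\<not> attached x" "\<not> A3_late x" | "x \<in> P" | "A3_late x" | "attached x" "x \<notin> P" by blast
  then show ?thesis
  proof cases
    case 1 then show ?thesis using m dout_A3_free[OF x] by blast
  next
    case 2 then show ?thesis using m dout_A3_P[OF x] by blast
  next
    case 3 then show ?thesis using m4 dout_A3_late by blast
  next
    case 4
    then have T: "A3_first x \<or> A3_second x" using attached_A3[OF x] by blast
    from Q_cases[OF 4 x three_Suc] show ?thesis
    proof cases
      case (1 w)
      then show ?thesis using dout_step[OF 1(2) dout_A2_free, of 3] not_attached_below[OF 1(3,1)] T m by auto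
    next
      case (2 w)
      then have w: "side 3 w" by simp
      show ?thesis
      proof (cases "A3_late w")
        case True then show ?thesis using dout_step[OF 2(2) dout_A3_late, of 5] by auto
      next
        case False then show ?thesis using dout_step[OF 2(2) dout_A3_free[OF w 2(4)], of 4] m4 by simp
      qed
    next
      case (3 w)
      then show ?thesis using dout_step[OF 3(2) dout_A3_P, of 4] m4 by simp
    qed
  qed
qed

text \<open>The mirror image enters its own side through these vertices and needs the 3. The side
  condition on \<open>C\<^sub>4\<close> in \<open>A3_first_def\<close> is made for the second
  alternative: it prevents such a vertex from being attached.\<close>

lemma dout_A3_crossing: "side 3 x \<Longrightarrow> entered 4 x \<or> entered 5 x \<and> \<not> no_B3 \<and> (\<exists>c. adj x c \<and> middle 4 c) \<Longrightarrow> \<not> attached x \<and> dout 3 x"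
proof -
  assume x: "side 3 x" "entered 4 x \<or> entered 5 x \<and> \<not> no_B3 \<and> (\<exists>c. adj x c \<and> middle 4 c)"
  then have "entered 5 x" using entered_mono[of 4 x 5] by auto
  moreover have "\<not> A3_first x" using x \<open>entered 5 x\<close> unfolding A3_first_def by blast
  ultimately have "\<not> attached x" "\<not> A3_late x" using attached_A3[OF x(1)] unfolding A3_second_def A3_late_def by auto
  then show ?thesis using dout_A3_free[OF x(1)] by blast
qed

text \<open>These are ears based at \<open>u\<close>: the foot is \<open>u\<close> for both ends,
  and no other level is involved.\<close>

lemma childless:
  assumes x: "side 1 x" "\<not> has_child x"
  shows "dout 2 x" "reach arc 2 u x"
proof -
  have Xx: "attached x" using attached_A1 x by blast
  have P1: "dout 1 w" if "w \<in> P" "side 1 w" for w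
    using arc_P[OF that(1)] isfoot1[OF that(2)] reach_one[of arc w u] by auto
  have Q1: "reach arc 1 u w" if "attached w" "w \<notin> P" "side 1 w" for w
    using arc_Q[OF that(1,2)] isfoot1[OF that(3)] reach_one[of arc u w] by auto
  show "dout 2 x"
  proof (cases "x \<in> P")
    case True
    then show ?thesis using P1 x reach_mono[of arc 1 x u 2] by auto
  next
    case False
    from Q_cases[OF Xx False x(1) One_nat_def] show ?thesis
    proof cases
      case (1 w)
      then have "w = u" using side_0 by auto
      then show ?thesis using 1 reach_one[of arc x u] reach_mono[of arc 1 x u 2] by auto
    next
      case (2 w)
      then have "has_child w" using attached_A1 by auto
      then show ?thesis using dout_step[OF 2(2) dout_A1, of 2] by auto
    next
      case (3 w)
      then show ?thesis using dout_step[OF 3(2) P1, of 2] by auto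
    qed
  qed
  show "reach arc 2 u x"
  proof (cases "x \<in> P")
    case True
    then obtain w where w: "attached w" "w \<notin> P" "adj x w" "du w = du x" using P_nb by blast
    then have w1: "side 1 w" using attached_side[OF w(1)] x by (auto simp: side_def)
    have "arc w x" using arc_sideways[OF adj_sym[OF w(3)] w1 x(1)] priority_Q[OF w(1,2)] priority_P[OF True] by simp
    then show ?thesis using reach_Suc[OF Q1[OF w(1,2) w1]] by (simp add: numeral_2_eq_2)
  next
    case False
    then show ?thesis using Q1[OF Xx] x reach_mono[of arc 1 u x 2] by auto
  qed
qed

end

section \<open>Distances from \<open>v\<close> into the \<open>A\<close>-side\<close>

context levels
begin

lemma entered_ge_3: "entered k x \<Longrightarrow> 3 \<le> k"
  by (induction rule: entered.induct) auto

end

text \<open>The four assumptions say that the crossing rules of \<open>entered\<close> are realised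
  by \<open>arc\<close>. They speak about the other side and the middle, and are discharged in
  \<open>half_in\<close>.\<close>

locale oriented_half_in = oriented_half +
  assumes base_B2: "side 2 x \<Longrightarrow> adj x y \<Longrightarrow> sw.side 2 y \<Longrightarrow> reach arc 3 v x"
    and base_C3: "side 2 x \<Longrightarrow> adj x y \<Longrightarrow> middle 3 y \<Longrightarrow> reach arc 4 v x"
    and base_B3: "side 3 x \<Longrightarrow> adj x y \<Longrightarrow> sw.side 3 y \<or> middle 3 y \<Longrightarrow> reach arc 4 v x"
    and base_C4: "side 3 x \<Longrightarrow> adj x y \<Longrightarrow> middle 4 y \<Longrightarrow> reach arc 5 v x"
begin

lemma din_3: "side 2 x \<Longrightarrow> entered 3 x \<Longrightarrow> din 3 x"
  by (erule entered.cases[of 3 x]) (auto dest: base_B2 entered_ge_3 levels_disjoint)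

lemma din_mono: "din m x \<Longrightarrow> m \<le> n \<Longrightarrow> din n x"
  by (rule reach_mono)

lemma din_A3_first_Q: "A3_first x \<Longrightarrow> x \<notin> P \<Longrightarrow> din 4 x"
proof -
  assume x: "A3_first x" "x \<notin> P"
  then obtain p where p: "is_foot x p" "arc p x" using arc_Q[of x] attached_def by blast
  then show ?thesis using isfoot3[OF class_side(1)[OF x(1)]] din_3[of p] din_step[of 3 p x 4] x by simp
qed

lemma P_partner: "x \<in> P \<Longrightarrow> side i x \<Longrightarrow> \<exists>w. attached w \<and> w \<notin> P \<and> adj x w \<and> side i w \<and> arc w x"
proof -
  assume x: "x \<in> P" "side i x"
  then obtain w where w: "attached w" "w \<notin> P" "adj x w" "du w = du x" using P_nb by blast
  then have "side i w" using attached_side[OF w(1)] x by (auto simp: side_def)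
  moreover have "arc w x" using arc_sideways[OF adj_sym[OF w(3)] calculation x(2)] priority_Q[OF w(1,2)] priority_P[OF x(1)] by simp
  ultimately show ?thesis using w by blast
qed

lemma din_A3_first: "A3_first x \<Longrightarrow> din 5 x"
proof (cases "x \<in> P")
  case True
  assume x: "A3_first x"
  obtain w where w: "attached w" "w \<notin> P" "adj x w" "side 3 w" "arc w x" using P_partner[OF True class_side(1)[OF x]] by blast
  have "\<not> A3_second w" using x w(3) class_side(2)[of w] adj_sym[OF w(3)] unfolding A3_second_def A3_hung_def by blast
  then have "A3_first w" using attached_A3[OF w(4)] w(1) by blast
  then show ?thesis using din_step[OF din_A3_first_Q w(5), of 5] w(2) by simp
next
  case False
  assume "A3_first x"
  then show ?thesis using din_A3_first_Q din_mono[of 4 x 5] False by simp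
qed

text \<open>When \<open>n\<close> is the exact entry time and \<open>x\<close> is not
  \<open>A3_first\<close>, the bounds 5, 6, 7 on the levels make \<open>x\<close> unattached with
  priority \<open>2 + n\<close>, so that the last edge of the derivation points to \<open>x\<close>.
  An \<open>A3_first\<close> vertex is not entered in 4, hence \<open>5 \<le> n\<close>, and it is
  reached in 5 by its ear.\<close>

lemma din_entered:
  "entered n x \<Longrightarrow> n \<le> 7 \<Longrightarrow> (side 3 x \<longrightarrow> n \<le> 5) \<Longrightarrow> (side 2 x \<longrightarrow> n \<le> 6) \<Longrightarrow> din n x"
proof (induction n arbitrary: x rule: less_induct)
  case (less n)
  note r = less.prems(1)
  show ?case
  proof (cases "entry_time x < n")
    case True
    have "side 3 x \<longrightarrow> entry_time x \<le> 5" "side 2 x \<longrightarrow> entry_time x \<le> 6" "entry_time x \<le> 7"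
      using True less.prems(2-4) by linarith+
    then have "din (entry_time x) x" using less.IH[OF True entered_entry_time[OF r]] by blast
    then show ?thesis using din_mono True by simp
  next
    case False
    then have io: "entry_time x = n" using entry_time_le[OF r] by simp
    show ?thesis
    proof (cases "A3_first x")
      case True
      then have "\<not> entered 4 x" "side 3 x" using class_side unfolding A3_first_def by auto
      then have "5 \<le> n" using entered_mono[OF r, of 4] by linarith
      then show ?thesis using din_A3_first[OF True] din_mono by blast
    next
      case nT: False
      have nX: "\<not> attached x" "\<not> A2_below x"
      proof -
        from entered_side[OF r] consider "side 1 x" | "side 2 x" | "side 3 x" by blast
        then have "\<not> attached x \<and> \<not> A2_below x"
        proof cases
          case 1
          then show ?thesis using not_attached(2)[OF entered_has_child[OF r 1]] class_side(6,7)[of x] by (auto dest: levels_disjoint)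
        next
          case 2
          then have "entered 6 x" using entered_mono[OF r, of 6] less.prems(4) by simp
          then show ?thesis using not_attached(1)[OF 2] unfolding A2_below_def A2_late_def by blast
        next
          case 3
          then have "entered 5 x" using entered_mono[OF r, of 5] less.prems(3) by simp
          then show ?thesis using attached_A3[OF 3] nT class_side(6,7)[of x] 3 unfolding A3_second_def by (auto dest: levels_disjoint)
        qed
        then show "\<not> attached x" "\<not> A2_below x" by blast+
      qed
      have rx: "priority x = 2 + n" using priority_entry_time[OF nX] io by simp
      from r show ?thesis
      proof (cases rule: entered.cases)
        case (cross_B2 y)
        then show ?thesis using base_B2[of x y] din_mono[of 3 x n] by blast
      next
        case (cross_C3 y)
        then show ?thesis using base_C3[of x y] din_mono[of 4 x n] by blast
      next
        case (cross_B3 y)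
        then show ?thesis using base_B3[of x y] din_mono[of 4 x n] by blast
      next
        case (cross_C4 y)
        then show ?thesis using base_C4[of x y] din_mono[of 5 x n] by blast
      next
        case (descend k w i)
        have i3: "i = 1 \<or> i = 2" using descend(2,4) entered_side[OF descend(1)] unfolding side_def by auto
        have k3: "side 3 w \<Longrightarrow> k \<le> 5"
        proof -
          assume "side 3 w"
          then have "i = 2" using side_inj[OF descend(2), of 3] by simp
          then show "k \<le> 5" using descend(3,6) less.prems(4) by simp
        qed
        have dw: "din k w"
          using less.IH[OF descend(6) descend(1)] descend(6) less.prems(2) k3 by simp
        have "arc w x"
        proof (cases "attached w")
          case True
          have "i \<noteq> 1"
          proof
            assume "i = 1"
            then have "side 2 w" using descend(2) by (simp add: numeral_2_eq_2)
            moreover have "entered 6 w" using entered_mono[OF descend(1), of 6] descend(6) less.prems(2) by simp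
            ultimately show False using not_attached(1) True by blast
          qed
          then have w3: "side 3 w" using i3 descend(2) by simp
          have "entered 5 w" using entered_mono[OF descend(1) k3[OF w3]] .
          then have "A3_first w" using attached_A3[OF w3] True A3_second_def by blast
          \<comment> \<open>A foot of an \<open>A3_first\<close> vertex is entered in 3, but the
            exact entry time of \<open>x\<close> exceeds \<open>k\<close>, which is at least
            3.\<close>
          have "\<not> is_foot w x"
          proof
            assume "is_foot w x"
            then have "entered 3 x" using isfoot3[OF w3] \<open>A3_first w\<close> by simp
            then show False using entry_time_le[of 3 x] io descend(6) entered_ge_3[OF descend(1)] by simp
          qed
          then show ?thesis using arc_down_nofoot[OF _ adj_sym[OF descend(5)] descend(3,2)] by blast
        qed (use arc_down[OF _ adj_sym[OF descend(5)] descend(3,2)] in blast)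
        then show ?thesis using din_step[OF dw _ descend(6)] by blast
      next
        case (sideways k w i)
        have "side 3 w \<Longrightarrow> k \<le> 5" "side 2 w \<Longrightarrow> k \<le> 6"
          using side_inj[OF sideways(2), of 3] side_inj[OF sideways(2), of 2] sideways(3,7) less.prems(3,4) by simp_all
        then have dw: "din k w"
          using less.IH[OF sideways(7) sideways(1)] sideways(7) less.prems(2) by simp
        have "\<not> attached w \<and> \<not> A2_below w"
        proof -
          from entered_side[OF sideways(1)] consider "side 1 w" | "side 2 w" | "side 3 w" by blast
          then show ?thesis
          proof cases
            case 1
            then show ?thesis using not_attached(2)[OF entered_has_child[OF sideways(1) 1]] class_side(6,7)[of w] by (auto dest: levels_disjoint)
          next
            case 2
            then have "entered 6 w" using side_inj[OF sideways(2) 2] sideways(3,7) less.prems(4) entered_mono[OF sideways(1), of 6] by simp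
            then show ?thesis using not_attached(1)[OF 2] unfolding A2_below_def A2_late_def by blast
          next
            case 3
            then have "entered 4 w" using side_inj[OF sideways(2) 3] sideways(3,7) less.prems(3) entered_mono[OF sideways(1), of 4] by simp
            then show ?thesis using not_attached(3)[OF 3] class_side(6,7)[of w] 3 by (auto dest: levels_disjoint)
          qed
        qed
        then have "priority w < priority x" using priority_entry_time[of w] entry_time_le[OF sideways(1)] rx sideways(7) by simp
        then show ?thesis using din_step[OF dw arc_sideways[OF adj_sym[OF sideways(5)] sideways(2,3)] sideways(7)] by blast
      qed
    qed
  qed
qed

lemma din_A3_hung: "A3_hung x \<Longrightarrow> din 5 x"
proof -
  assume x: "A3_hung x"
  then obtain a where a: "adj x a" "A3_first a" unfolding A3_hung_def by blast
  have x3: "side 3 x" and a3: "side 3 a" using class_side x a by blast+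
  have Xa: "attached a" using a attached_def by blast
  have "\<not> is_foot a x" using isfoot3[OF a3] x3 by (auto dest: levels_disjoint)
  then have aP: "a \<notin> P"
    using P_exit[OF Xa adj_sym[OF a(1)] _ side_less[OF x3] not_attached(5)[OF x]] x3 a3 by (simp add: side_def)
  have "arc a x"
    using arc_sideways[OF adj_sym[OF a(1)] a3 x3] priority_Q[OF Xa aP] priority_not_attached[OF not_attached(5)[OF x]] by simp
  then show ?thesis using din_step[OF din_A3_first_Q[OF a(2) aP], of x 5] by simp
qed

lemma din_A3_second_Q: "A3_second x \<Longrightarrow> x \<notin> P \<Longrightarrow> din 5 x"
proof -
  assume x: "A3_second x" "x \<notin> P"
  then obtain p where p: "is_foot x p" "arc p x" using arc_Q[of x] attached_def by blast
  have "\<not> A3_first x" using x A3_second_def by blast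
  then have "side 2 p" "entered 4 p" using isfoot3[OF class_side(2)[OF x(1)]] p(1) by simp_all
  then show ?thesis using din_entered[of 4 p] din_step[OF _ p(2), of 4 5] by (auto dest: levels_disjoint)
qed

lemma din_A3_second: "A3_second x \<Longrightarrow> din 6 x"
proof (cases "x \<in> P")
  case True
  assume x: "A3_second x"
  obtain w where w: "attached w" "w \<notin> P" "adj x w" "side 3 w" "arc w x" using P_partner[OF True class_side(2)[OF x]] by blast
  \<comment> \<open>An \<open>A3_first\<close> neighbour would have put \<open>x\<close> into
    \<open>A3_hung\<close>.\<close>
  have "\<not> A3_first w" using x w(3) class_side(2)[OF x] unfolding A3_second_def A3_hung_def by blast
  then have "A3_second w" using attached_A3[OF w(4)] w(1) by blast
  then show ?thesis using din_step[OF din_A3_second_Q w(5), of 6] w(2) by simp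
next
  case False
  assume "A3_second x"
  then show ?thesis using din_A3_second_Q din_mono[of 5 x 6] False by simp
qed

lemma din_A3_late: "A3_late x \<Longrightarrow> din 6 x"
proof -
  assume x: "A3_late x"
  then obtain a where a: "adj x a" "side 3 a" "entered 5 a" "\<not> attached a" using A3_late_nb by blast
  have x3: "side 3 x" using class_side x by blast
  have ng: "\<not> A2_below a" "\<not> A2_below x" using class_side(6,7) a(2) x3 by (auto dest: levels_disjoint)
  have "5 < entry_time x" using x entry_time_gt[of 5 x] unfolding A3_late_def by simp
  then have "arc a x" using arc_sideways[OF adj_sym[OF a(1)] a(2) x3] priority_entry_time[OF a(4) ng(1)]
      priority_entry_time[OF not_attached(6)[OF x] ng(2)] entry_time_le[OF a(3)] by simp
  moreover have "din 5 a" using din_entered[OF a(3)] a(2) by (auto dest: levels_disjoint)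
  ultimately show ?thesis using din_step[of 5 a x 6] by simp
qed

lemma din_A3: "side 3 x \<Longrightarrow> din 6 x \<and> (entered 5 x \<or> above 3 x \<longrightarrow> din 5 x)"
proof -
  assume x: "side 3 x"
  have m: "din 5 x \<Longrightarrow> ?thesis" using din_mono[of 5 x 6] by simp
  consider "entered 5 x" | "A3_first x" | "A3_hung x" | "A3_second x" "\<not> A3_first x" "\<not> entered 5 x" | "A3_late x" "\<not> A3_first x" "\<not> entered 5 x"
    using x unfolding A3_late_def A3_second_def by blast
  then show ?thesis
  proof cases
    case 1
    then show ?thesis using m din_entered[OF 1] x by (auto dest: levels_disjoint)
  next
    case 4
    then have "\<not> above 3 x" using entered_mono[of 4 x 5] unfolding A3_first_def by auto
    then show ?thesis using din_A3_second 4 by blast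
  next
    case 5
    then have "\<not> above 3 x" using entered_mono[of 4 x 5] unfolding A3_first_def by auto
    then show ?thesis using din_A3_late 5 by blast
  qed (use m din_A3_first din_A3_hung in blast)+
qed

text \<open>If \<open>a\<close> is attached, then \<open>x\<close> is an exit for it, so
  \<open>a\<close> lies outside \<open>P\<close> and is reached through its foot within 5. If not,
  \<open>a\<close> is hung and also reached in 5. One step down remains.\<close>

lemma A2_below_step:
  assumes x: "A2_below x" and a: "adj x a" "A3_first a \<or> A3_second a \<or> A3_hung a"
  shows "din 6 x"
proof -
  have x2: "side 2 x" "\<not> entered 6 x" using x class_side(7) A2_late_def by blast+
  have a3: "side 3 a" using a class_side by blast
  have da: "din 5 a \<and> arc a x"
  proof (cases "attached a")
    case True
    have nf: "\<not> is_foot a x"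
    proof
      assume "is_foot a x"
      then have "entered (if A3_first a then 3 else 4) x" using isfoot3[OF a3] by blast
      then show False using x2(2) entered_mono[of "if A3_first a then 3 else 4" x 6] by simp
    qed
    have l: "du x \<le> du a" using x2(1) a3 by (simp add: side_def)
    have aP: "a \<notin> P" using P_exit[OF True adj_sym[OF a(1)] l side_less[OF x2(1)] not_attached(7)[OF x] nf] .
    have "arc a x" using arc_down_nofoot[OF nf adj_sym[OF a(1)] x2(1)] a3 by simp
    moreover have "din 5 a"
      using attached_A3[OF a3] True din_A3_first_Q[OF _ aP] din_A3_second_Q[OF _ aP] din_mono[of 4 a 5, simplified] by blast
    ultimately show ?thesis by blast
  next
    case False
    then have "A3_hung a" using a(2) attached_def by blast
    then show ?thesis using din_A3_hung arc_down[OF False adj_sym[OF a(1)], of 2] x2 a3 by simp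
  qed
  then show ?thesis using din_step[of 5 a x 6] by simp
qed

lemma A2_below_cases: "A2_below x \<Longrightarrow> din 6 x \<or> (\<exists>a. A3_late a \<and> adj x a)"
proof -
  assume x: "A2_below x"
  then obtain a where a: "adj x a" "side 3 a" unfolding A2_below_def by blast
  have "\<not> entered 5 a" using A2_late_nb[OF class_side(7)[OF x] a] .
  then have "A3_first a \<or> A3_second a \<or> A3_hung a \<or> A3_late a" using a A3_late_def by blast
  then show ?thesis using A2_below_step[OF x a(1)] a(1) by blast
qed

lemma din_A2_below: "A2_below x \<Longrightarrow> din 7 x"
proof -
  assume x: "A2_below x"
  from A2_below_cases[OF x] show ?thesis
  proof (elim disjE exE conjE)
    fix a assume a: "A3_late a" "adj x a"
    have "arc a x" using arc_down[OF not_attached(6)[OF a(1)] adj_sym[OF a(2)], of 2] class_side(4)[OF a(1)] class_side(6)[OF class_side(7)[OF x]] by simp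
    then show ?thesis using din_step[OF din_A3_late[OF a(1)], of x 7] by simp
  qed (use din_mono[of 6 x 7] in simp)
qed

lemma din_A2_rooted_Q: "A2_rooted x \<Longrightarrow> x \<notin> P \<Longrightarrow> din 6 x"
proof -
  assume x: "A2_rooted x" "x \<notin> P"
  then obtain p where p: "is_foot x p" "arc p x" using arc_Q[of x] attached_def by blast
  then have "side 1 p" "entered 5 p" using isfoot2[OF class_side(5)[OF x(1)]] by simp_all
  then show ?thesis using din_entered[of 5 p] din_step[OF _ p(2), of 5 6] by (auto dest: levels_disjoint)
qed

lemma din_A2_rooted: "A2_rooted x \<Longrightarrow> din 7 x"
proof (cases "x \<in> P")
  case True
  assume x: "A2_rooted x"
  obtain w where w: "attached w" "w \<notin> P" "adj x w" "side 2 w" "arc w x" using P_partner[OF True class_side(5)[OF x]] by blast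
  then have "A2_rooted w" using attached_A2 by blast
  then show ?thesis using din_step[OF din_A2_rooted_Q w(5), of 7] w(2) by simp
next
  case False
  assume "A2_rooted x"
  then show ?thesis using din_A2_rooted_Q din_mono[of 6 x 7] False by simp
qed

lemma ex_side_2: "\<exists>y. sw.side 2 y"
  using ex_B2 unfolding sw.side_def by fastforce

lemma A2_beside_no_low_parent: "A2_beside x \<Longrightarrow> \<not> low_parent x"
  unfolding A2_beside_def A2_rooted_def supplied_def using class_side by blast

lemma A2_beside_cases:
  assumes x: "A2_beside x"
  shows "(\<forall>y. sw.side 2 y \<longrightarrow> sw.entered 3 y) \<and>
    (\<exists>a. adj x a \<and> side 2 a \<and> (low_parent a \<or> (\<exists>a'. adj a a' \<and> above 3 a')))"
proof -
  have x2: "side 2 x" "\<not> entered 6 x" "\<not> (\<exists>a. adj x a \<and> side 3 a)" using x unfolding A2_beside_def A2_late_def by blast+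
  have "sw.entered 3 y \<and> (\<exists>a. adj x a \<and> side 2 a \<and> (low_parent a \<or> (\<exists>a'. adj a a' \<and> above 3 a')))" if "sw.side 2 y" for y
    using A2_bad[OF x2(1,2) that] A2_beside_no_low_parent[OF x] x2(3) unfolding above_def by blast
  then show ?thesis using ex_side_2 by blast
qed

text \<open>\<open>A2_bad\<close> leaves only a neighbour \<open>a\<close> in
  \<open>A\<^sub>2\<close>, and in each case it is reached in 6: it is entered in 6, or rooted and
  outside \<open>P\<close> because \<open>x\<close> is an exit for it, or fed from
  \<open>A\<^sub>3\<close>. Its priority is at most 8, while that of \<open>x\<close> is at least 2
  + 7.\<close>

lemma din_A2_beside: "A2_beside x \<Longrightarrow> din 7 x"
proof -
  assume x: "A2_beside x"
  then have x2: "side 2 x" "\<not> entered 6 x" "\<not> (\<exists>a. adj x a \<and> side 3 a)" unfolding A2_beside_def A2_late_def by blast+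
  obtain a where a: "adj x a" "side 2 a" "low_parent a \<or> (\<exists>a'. adj a a' \<and> above 3 a')" using A2_beside_cases[OF x] by blast
  have ngx: "\<not> A2_below x" using x A2_beside_def A2_below_def by blast
  have rx: "9 \<le> priority x" using priority_entry_time[OF not_attached(8)[OF x] ngx] entry_time_gt[of 6 x] x2(2) by simp
  have "priority a < priority x \<and> din 6 a"
  proof (cases "entered 6 a")
    case True
    then have "\<not> attached a" "\<not> A2_below a" using not_attached(1) a(2) A2_below_def A2_late_def by blast+
    then show ?thesis using priority_entry_time[of a] entry_time_le[OF True] rx din_entered[OF True] a(2) by (auto dest: levels_disjoint)
  next
    case False
    then have a2: "A2_late a" using a A2_late_def by blast
    show ?thesis
    proof (cases "A2_rooted a")
      case True
      then have Xa: "attached a" using attached_def by blast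
      have "\<not> is_foot a x" using isfoot2[OF a(2)] x2(1) by (auto dest: levels_disjoint)
      then have "a \<notin> P"
        using P_exit[OF Xa adj_sym[OF a(1)] _ side_less[OF x2(1)] not_attached(8)[OF x]] x2(1) a(2) by (simp add: side_def)
      then show ?thesis using din_A2_rooted_Q[OF True] priority_Q[OF Xa] rx by simp
    next
      case nR: False
      have "supplied a"
        using a(3)
      proof
        assume "low_parent a"
        then show ?thesis using nR a2 a(1) x2(1) adj_sym[OF a(1)] unfolding A2_rooted_def by blast
      next
        assume "\<exists>a'. adj a a' \<and> above 3 a'"
        then obtain a' where a': "adj a a'" "above 3 a'" by blast
        then have "\<not> entered 5 a'" using A2_late_nb[OF a2] unfolding above_def by blast
        then have "A3_first a'" using a'(2) entered_mono[of 4 a' 5] unfolding A3_first_def by auto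
        then show ?thesis using a'(1) supplied_def by blast
      qed
      then obtain b where b: "adj a b" "A3_first b \<or> A3_second b \<or> A3_hung b" unfolding supplied_def by blast
      then have "A2_below a" using nR a2 class_side unfolding A2_below_def by blast
      then show ?thesis using A2_below_step[OF _ b] priority_A2_below rx by simp
    qed
  qed
  then show ?thesis using din_step[OF _ arc_sideways[OF adj_sym[OF a(1)] a(2) x2(1)], of 6 7] by simp
qed

lemma din_A2: "side 2 x \<Longrightarrow> din 7 x \<and> (entered 6 x \<longrightarrow> din 6 x)"
proof (cases "entered 6 x")
  case True
  assume "side 2 x"
  then show ?thesis using din_entered[OF True] din_mono[of 6 x 7] by (auto dest: levels_disjoint)
next
  case False
  assume "side 2 x"
  then have "A2_below x \<or> A2_rooted x \<or> A2_beside x" using False unfolding A2_below_def A2_beside_def A2_late_def by blast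
  then show ?thesis using din_A2_below din_A2_rooted din_A2_beside False by blast
qed

lemma bad_child:
  assumes x: "has_child x" "\<not> entered 7 x" and z: "adj x z" "side 2 z"
  shows "A2_late z \<and> arc z x \<and> (din 6 z \<or> A2_beside z)"
proof -
  have x1: "side 1 x" using x has_child_def by blast
  have z6: "A2_late z" using descend_A2[of 6 z x 7] z x x1 A2_late_def by auto
  show ?thesis
  proof (cases "A2_rooted z")
    case True
    then have Xz: "attached z" using attached_def by blast
    have nf: "\<not> is_foot z x" using isfoot2[OF z(2)] x entered_mono[of 5 x 7] by auto
    have "z \<notin> P"
      using P_exit[OF Xz adj_sym[OF z(1)] _ side_less[OF x1] not_attached(2)[OF x(1)] nf] x1 z(2) by (simp add: side_def)
    moreover have "arc z x" using arc_down_nofoot[OF nf adj_sym[OF z(1)] x1] z(2) by (simp add: Suc_1[symmetric] del: Suc_1)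
    ultimately show ?thesis using z6 din_A2_rooted_Q[OF True] by blast
  next
    case False
    then have "\<not> attached z" using attached_A2[OF z(2)] by blast
    then have "arc z x" using arc_down[OF _ adj_sym[OF z(1)] x1] z(2) by (simp add: Suc_1[symmetric] del: Suc_1)
    moreover have "A2_below z \<Longrightarrow> din 6 z" using A2_below_cases[of z] A3_late_nb A1_B3[OF x(1)] x(2) by blast
    moreover have "A2_below z \<or> A2_beside z" using z6 False unfolding A2_below_def A2_beside_def by blast
    ultimately show ?thesis using z6 by blast
  qed
qed

text \<open>If \<open>x\<close> is not entered within 7, all its children are late. A child reached
  in 6 gives 7; the 8 is due to an \<open>A2_beside\<close> child, and then
  \<open>A2_beside_cases\<close> makes all of \<open>B\<^sub>2\<close> as early as possible.\<close>

lemma din_A1: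
  assumes "has_child x"
  shows "entered 7 x \<and> din 7 x \<or> din 7 x \<or> din 8 x \<and> (\<forall>y. sw.side 2 y \<longrightarrow> sw.entered 3 y)"
proof (cases "entered 7 x")
  case True
  then show ?thesis using din_entered[OF True] assms has_child_def by (auto dest: levels_disjoint)
next
  case False
  obtain z where z: "adj x z" "side 2 z" using assms has_child_def by blast
  from bad_child[OF assms False z] show ?thesis
    using din_step[of 6 z x 7, simplified] din_step[of 7 z x 8, simplified] din_A2_beside[of z] A2_beside_cases[of z] by blast
qed

lemma din_A1_child: "has_child x \<Longrightarrow> adj x z \<Longrightarrow> side 2 z \<Longrightarrow> din m z \<Longrightarrow> entered 6 z \<Longrightarrow> din (Suc m) x"
  using din_step[of m z x "Suc m"] arc_down[OF not_attached(1)[of z] adj_sym[of x z], of 1] unfolding has_child_def by (simp add: Suc_1[symmetric] del: Suc_1)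

text \<open>Otherwise the vertex \<open>c'\<close> of \<open>A\<^sub>3\<close> on the walk from
  \<open>A1_C4\<close> would be attached and outside \<open>P\<close>. Being entered in 5, it would
  be \<open>A3_first\<close> and reached in 4 through its foot. This saves one step against the 5
  counted by \<open>entered\<close>, and carried down the walk it would reach \<open>x\<close> in
  7.\<close>

lemma A1_C4_dist:
  assumes x: "has_child x" "\<not> din 7 x" and c: "middle 4 c" "\<exists>a. adj c a \<and> side 3 a"
  shows "\<exists>a. adj c a \<and> side 3 a \<and> dout 3 a"
proof (rule ccontr)
  assume no: "\<not> ?thesis"
  have x1: "side 1 x" using x has_child_def by blast
  have x7: "\<not> entered 7 x" using din_entered[of 7 x] x x1 by (auto dest: levels_disjoint)
  then have B: "\<nexists>y. sw.side 3 y" using A1_B3[OF x(1)] by blast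
  then have nT4: "\<nexists>y. A3_late y" using A3_late_nb by blast
  obtain a b c' where p: "adj x a" "adj a b" "adj b c'" "adj c' c" "side 3 c'"
    "side 2 b \<and> (side 1 a \<or> side 2 a) \<or> side 3 b \<and> side 2 a" using A1_C4[OF x(1) x7 c(1)] .
  have no3: "\<not> dout 3 c'" using no p(4,5) adj_sym by blast
  have c5: "entered 5 c'" using cross_C4[OF p(5,4) c(1)] by simp
  have "attached c'" "c' \<notin> P" using dout_A3_free[OF p(5)] dout_A3_P[OF p(5)] nT4 no3 by blast+
  then have T: "A3_first c'" using attached_A3[OF p(5)] c5 A3_second_def by blast
  have d4: "din 4 c'" using din_A3_first_Q[OF T] \<open>c' \<notin> P\<close> by blast
  have child: "din 7 x" if z: "adj x z" "side 2 z" "A2_beside z \<Longrightarrow> din 6 z" for z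
    using bad_child[OF x(1) x7 z(1,2)] din_step[of 6 z x 7, simplified] z(3) by blast
  have b5: "entered 6 b \<and> din 5 b" if b: "side 2 b" "\<not> entered 3 b"
  proof -
    have "\<not> is_foot c' b" using isfoot3[OF p(5)] T b by simp
    then have "arc c' b" using arc_down_nofoot[OF _ adj_sym[OF p(3)], of 2] b p(5) by simp
    then show ?thesis using din_step[OF d4, of b 5] descend_A3[OF c5 p(5) b(1) p(3), of 6] by simp
  qed
  have b3: "\<not> entered 3 b" if "side 2 b" "side 1 a \<or> side 2 a"
    using A1_up[OF x(1) p(1,2) that(2,1), of 3 7] x7 by auto
  from p(6) consider "side 2 b" "side 1 a" | "side 2 b" "side 2 a" | "side 3 b" "side 2 a" by blast
  then have "din 7 x"
  proof cases
    case 1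
    have cha: "has_child a" using has_childI[OF 1(2) p(2) 1(1)] .
    have b: "entered 6 b" "din 5 b" using b5[OF 1(1) b3[OF 1(1)]] 1 by blast+
    have da: "din 6 a" using din_A1_child[OF cha p(2) 1(1) b(2,1)] by simp
    have a7: "entered 7 a" using descend_A2[OF b(1) 1(1,2) p(2), of 7] by simp
    have "\<not> A2_below a" "\<not> A2_below x" using class_side(6,7) 1(2) x1 by (auto dest: levels_disjoint)
    then have "priority a < priority x" using priority_entry_time[OF not_attached(2)[OF cha]] priority_entry_time[OF not_attached(2)[OF x(1)]]
        entry_time_le[OF a7] entry_time_gt[OF x7] by simp
    then have "arc a x" using arc_sideways[OF adj_sym[OF p(1)] 1(2) x1] by blast
    then show ?thesis using din_step[OF da, of x 7] by simp
  next
    case 2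
    have b: "entered 6 b" "din 5 b" using b5[OF 2(1) b3[OF 2(1)]] 2 by blast+
    have "din 6 a" if "A2_beside a"
    proof -
      have nb: "\<not> attached b" "\<not> A2_below b" using not_attached(1) 2(1) b A2_below_def A2_late_def by blast+
      have na: "\<not> A2_below a" "\<not> entered 6 a" using that unfolding A2_beside_def A2_below_def A2_late_def by blast+
      have "priority b < priority a" using priority_entry_time[OF nb] entry_time_le[OF b(1)] priority_entry_time[OF not_attached(8)[OF that] na(1)] entry_time_gt[OF na(2)] by simp
      then show ?thesis using din_step[OF b(2) arc_sideways[OF adj_sym[OF p(2)] 2(1,2)], of 6] by simp
    qed
    then show ?thesis using child[OF p(1) 2(2)] by blast
  next
    case 3
    then have "\<not> A2_beside a" using p(2) unfolding A2_beside_def by blast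
    then show ?thesis using child[OF p(1) 3(2)] by blast
  qed
  then show False using x(2) by blast
qed

end

section \<open>Both sides together\<close>

context levels
begin

definition meets_A :: "'v \<Rightarrow> bool" where
  "meets_A c \<longleftrightarrow> (\<exists>a. adj c a \<and> side 3 a)"

end

text \<open>The \<open>B\<close>-side is the same half with \<open>u\<close> and \<open>v\<close>
  exchanged and all arcs reversed. The conditions on \<open>C\<^sub>4\<close> bring every vertex
  there within 5 steps of both ends; they come in mirrored pairs, which is what
  \<open>swapped\<close> needs.\<close>

locale oriented =
  A: oriented_half V E ed u v du dv adj f P arc +
  B: oriented_half V E ed v u dv du adj f' P' "\<lambda>s t. arc t s"
  for V :: "'v set" and E :: "'e set" and ed u v du dv adj f P f' P' arc +
  assumes uv: "arc u v"
    and BA: "adj s t \<Longrightarrow> A.sw.side i s \<Longrightarrow> A.side i t \<Longrightarrow> 1 \<le> i \<Longrightarrow> arc s t"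
    and BC: "adj s t \<Longrightarrow> A.sw.side i s \<Longrightarrow> A.middle j t \<Longrightarrow> arc s t"
    and CA: "adj s t \<Longrightarrow> A.middle j s \<Longrightarrow> A.side i t \<Longrightarrow> arc s t"
    and C_A: "A.middle 4 c \<Longrightarrow> A.meets_A c \<Longrightarrow> \<not> A.sw.meets_A c \<Longrightarrow> A.middle 3 d \<Longrightarrow> adj d c \<Longrightarrow> arc d c"
    and C_B: "A.middle 4 c \<Longrightarrow> A.sw.meets_A c \<Longrightarrow> \<not> A.meets_A c \<Longrightarrow> A.middle 3 d \<Longrightarrow> adj c d \<Longrightarrow> arc c d"
    and C_in: "A.middle 4 c \<Longrightarrow> \<not> A.meets_A c \<Longrightarrow> \<not> A.sw.meets_A c \<Longrightarrow> (\<exists>d. A.middle 3 d \<and> arc d c) \<or>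
      (\<exists>e. A.middle 4 e \<and> arc e c \<and> ((\<exists>d. A.middle 3 d \<and> arc d e) \<or> A.meets_A e \<and> A.sw.meets_A e))"
    and C_out: "A.middle 4 c \<Longrightarrow> \<not> A.meets_A c \<Longrightarrow> \<not> A.sw.meets_A c \<Longrightarrow> (\<exists>d. A.middle 3 d \<and> arc c d) \<or>
      (\<exists>e. A.middle 4 e \<and> arc c e \<and> ((\<exists>d. A.middle 3 d \<and> arc e d) \<or> A.meets_A e \<and> A.sw.meets_A e))"
begin

lemma swapped: "oriented V E ed v u dv du adj f' P' f P (\<lambda>s t. arc t s)"
proof -
  interpret A': oriented_half V E ed u v du dv adj f P "\<lambda>s t. arc s t" by (rule A.oriented_half_axioms)
  show ?thesis
  proof
    show "arc u v" by (rule uv)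
    show "adj s t \<Longrightarrow> A.side i s \<Longrightarrow> A.sw.side i t \<Longrightarrow> 1 \<le> i \<Longrightarrow> arc t s" for s t i
      using BA[of t s i] A.adj_sym[of s t] by blast
    show "adj s t \<Longrightarrow> A.side i s \<Longrightarrow> A.sw.middle j t \<Longrightarrow> arc t s" for s t i j
      using CA[of t s j i] A.adj_sym[of s t] unfolding A.sw_middle by blast
    show "adj s t \<Longrightarrow> A.sw.middle j s \<Longrightarrow> A.sw.side i t \<Longrightarrow> arc t s" for s t i j
      using BC[of t s i j] A.adj_sym[of s t] unfolding A.sw_middle by blast
    show "A.sw.middle 4 c \<Longrightarrow> A.sw.meets_A c \<Longrightarrow> \<not> A.meets_A c \<Longrightarrow> A.sw.middle 3 d \<Longrightarrow> adj d c \<Longrightarrow> arc c d" for c d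
      using C_B[of c d] A.adj_sym[of d c] unfolding A.sw_middle by blast
    show "A.sw.middle 4 c \<Longrightarrow> A.meets_A c \<Longrightarrow> \<not> A.sw.meets_A c \<Longrightarrow> A.sw.middle 3 d \<Longrightarrow> adj c d \<Longrightarrow> arc d c" for c d
      using C_A[of c d] A.adj_sym[of c d] unfolding A.sw_middle by blast
    show "A.sw.middle 4 c \<Longrightarrow> \<not> A.sw.meets_A c \<Longrightarrow> \<not> A.meets_A c \<Longrightarrow> (\<exists>d. A.sw.middle 3 d \<and> arc c d) \<or>
      (\<exists>e. A.sw.middle 4 e \<and> arc c e \<and> ((\<exists>d. A.sw.middle 3 d \<and> arc e d) \<or> A.sw.meets_A e \<and> A.meets_A e))" for c
      using C_out[of c] unfolding A.sw_middle by blast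
    show "A.sw.middle 4 c \<Longrightarrow> \<not> A.sw.meets_A c \<Longrightarrow> \<not> A.meets_A c \<Longrightarrow> (\<exists>d. A.sw.middle 3 d \<and> arc d c) \<or>
      (\<exists>e. A.sw.middle 4 e \<and> arc e c \<and> ((\<exists>d. A.sw.middle 3 d \<and> arc d e) \<or> A.sw.meets_A e \<and> A.meets_A e))" for c
      using C_in[of c] unfolding A.sw_middle by blast
  qed
qed

lemmas conv = reach_converse[of arc]

lemma B_in: "B.dout n x \<Longrightarrow> reach arc n v x"
  unfolding conv .

lemma step: "reach arc m v x \<Longrightarrow> arc x y \<Longrightarrow> m < n \<Longrightarrow> reach arc n v y"
  using reach_Suc[of arc m v x y] reach_mono[of arc "Suc m" v y n] by auto

lemma C3_in: "A.middle 3 c \<Longrightarrow> reach arc 3 v c"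
proof -
  assume c: "A.middle 3 c"
  have cV: "c \<in> V" "dv c = Suc 2" using c unfolding A.middle_def by simp_all
  obtain y where y: "adj c y" "dv y = 2" using A.dv_prev[OF cV] by blast
  have y2: "A.sw.side 2 y"
    using A.C3_nb[OF c y(1)] y(2) unfolding A.side_def A.sw.side_def A.middle_def by (elim disjE) simp_all
  have "A.sw.entered 4 y" using A.sw.cross_C3[OF y2 A.adj_sym[OF y(1)], of 4] c unfolding A.sw_middle by blast
  then have "A.sw.entered 6 y" by (rule A.sw.entered_mono) simp
  from A.sw.not_attached(1)[OF y2 this] have "reach arc 2 v y" by (rule B_in[OF B.dout_A2_free[OF y2]])
  from this BC[OF A.adj_sym[OF y(1)] y2 c] show ?thesis by (rule step) simp
qed

text \<open>If \<open>c\<close> also meets \<open>B\<^sub>3\<close>, the mirrored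
  \<open>dout_A3_crossing\<close> applies to that neighbour, as \<open>A\<^sub>3\<close> is not
  empty; if not, \<open>C_A\<close> directs an edge from \<open>C\<^sub>3\<close> to
  \<open>c\<close>. Both give 3 + 1.\<close>

lemma C4_in_nb: "A.middle 4 c \<Longrightarrow> A.meets_A c \<Longrightarrow> reach arc 4 v c"
proof -
  assume c: "A.middle 4 c" "A.meets_A c"
  show ?thesis
  proof (cases "A.sw.meets_A c")
    case True
    then obtain y where y: "adj c y" "A.sw.side 3 y" unfolding A.sw.meets_A_def by blast
    have "A.sw.entered 5 y" using A.sw.cross_C4[OF y(2) A.adj_sym[OF y(1)], of 5] c unfolding A.sw_middle by simp
    moreover have "\<not> A.sw.no_B3" using c(2) unfolding A.sw.no_B3_def A.meets_A_def by blast
    moreover have "\<exists>c. adj y c \<and> A.sw.middle 4 c" using A.adj_sym[OF y(1)] c unfolding A.sw_middle by blast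
    ultimately have "reach arc 3 v y" using B_in B.dout_A3_crossing[OF y(2)] by blast
    then show ?thesis using step[OF _ BC[OF A.adj_sym[OF y(1)] y(2) c(1)], of 3 4] by simp
  next
    case False
    have cV: "c \<in> V" "dv c = Suc 3" using c(1) unfolding A.middle_def by simp_all
    obtain d where d: "adj c d" "dv d = 3" using A.dv_prev[OF cV] by blast
    have "\<not> A.sw.side 3 d" using False d(1) unfolding A.sw.meets_A_def by blast
    then have "A.middle 3 d"
      using A.C4_nb[OF c(1) d(1)] d(2) unfolding A.side_def A.middle_def by (elim disjE) simp_all
    then show ?thesis using step[OF C3_in C_A[OF c False], of d 4] A.adj_sym[OF d(1)] by simp
  qed
qed

text \<open>Origin of the constants in \<open>entered\<close>: the last vertex before the crossing
  is reached in 2 (\<open>B\<^sub>2\<close>), 3 (\<open>C\<^sub>3\<close> or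
  \<open>B\<^sub>3\<close>) or 4 (\<open>C\<^sub>4\<close>) steps, and the crossing adds one. The
  vertices of \<open>B\<close> next to a crossing are unattached on their side, so the mirrored exit
  bounds suffice.\<close>

lemma half_in: "oriented_half_in V E ed u v du dv adj f P arc"
proof
  fix x y
  assume xy: "adj x y"
  note yx = A.adj_sym[OF xy]
  show "reach arc 3 v x" if "A.side 2 x" "A.sw.side 2 y"
  proof -
    have "A.sw.entered 6 y" using A.sw.cross_B2[OF that(2) yx that(1), of 6] by simp
    then have "\<not> A.sw.attached y" using A.sw.not_attached(1)[OF that(2)] by simp
    then show ?thesis using step[OF B_in[OF B.dout_A2_free[OF that(2)]] BA[OF yx that(2,1)], of 3] by simp
  qed
  show "reach arc 4 v x" if "A.side 2 x" "A.middle 3 y"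
    using step[OF C3_in[OF that(2)] CA[OF yx that(2,1)], of 4] by simp
  show "reach arc 4 v x" if "A.side 3 x" "A.sw.side 3 y \<or> A.middle 3 y"
    using that(2)
  proof
    assume y: "A.sw.side 3 y"
    have "A.sw.entered 4 y" using A.sw.cross_B3[OF y yx, of 4] that(1) by simp
    then have "B.dout 3 y" using B.dout_A3_crossing[OF y] by blast
    then show ?thesis using step[OF B_in BA[OF yx y that(1)], of 3 4] by simp
  next
    assume y: "A.middle 3 y"
    show ?thesis using step[OF C3_in[OF y] CA[OF yx y that(1)], of 4] by simp
  qed
  show "reach arc 5 v x" if "A.side 3 x" "A.middle 4 y"
  proof -
    have "A.meets_A y" using yx that(1) A.meets_A_def by blast
    then show ?thesis using step[OF C4_in_nb[OF that(2)] CA[OF yx that(2,1)], of 5] by simp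
  qed
qed

lemma C4_in: "A.middle 4 c \<Longrightarrow> reach arc 5 v c"
proof -
  interpret BI: oriented_half_in V E ed v u dv du adj f' P' "\<lambda>s t. arc t s"
    using oriented.half_in[OF swapped] .
  assume c: "A.middle 4 c"
  have b4: "reach arc 4 v e" if "A.middle 3 d" "arc d e" for d e using step[OF C3_in[OF that(1)] that(2), of 4] by simp
  consider "A.meets_A c" | "\<not> A.meets_A c" "A.sw.meets_A c" | "\<not> A.meets_A c" "\<not> A.sw.meets_A c" by blast
  then show ?thesis
  proof cases
    case 1 then show ?thesis using C4_in_nb[OF c] reach_mono[of arc 4 v c 5] by simp
  next
    case 2
    then obtain y where y: "adj c y" "A.sw.side 3 y" unfolding A.sw.meets_A_def by blast
    \<comment> \<open>If \<open>A\<^sub>3\<close> is empty, the mirrored \<open>A3_late_nb\<close>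
      rules out late vertices in \<open>B\<^sub>3\<close>, and \<open>dout_A3\<close> improves from
      5 to 4.\<close>
    have "B.dout 4 y"
    proof (cases "\<exists>x. A.side 3 x")
      case True
      have "A.sw.entered 5 y" using A.sw.cross_C4[OF y(2) A.adj_sym[OF y(1)], of 5] c unfolding A.sw_middle by simp
      moreover have "\<not> A.sw.no_B3" using True unfolding A.sw.no_B3_def by blast
      moreover have "\<exists>c. adj y c \<and> A.sw.middle 4 c" using A.adj_sym[OF y(1)] c unfolding A.sw_middle by blast
      ultimately have "B.dout 3 y" using B.dout_A3_crossing[OF y(2)] by blast
      then show ?thesis using reach_mono[of _ 3 y v 4] by simp
    next
      case False
      then show ?thesis using A.sw.A3_late_nb B.dout_A3[OF y(2)] by blast
    qed
    then show ?thesis using step[OF B_in BC[OF A.adj_sym[OF y(1)] y(2) c], of 4 5] by simp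
  next
    case 3
    from C_in[OF c 3] show ?thesis
    proof (elim disjE exE conjE)
      fix d assume d: "A.middle 3 d" "arc d c"
      show ?thesis using reach_mono[OF b4[OF d], of 5] by simp
    next
      fix e d assume e: "arc e c" "A.middle 3 d" "arc d e"
      show ?thesis using step[OF b4[OF e(2,3)] e(1), of 5] by simp
    next
      fix e assume e: "A.middle 4 e" "arc e c" "A.meets_A e"
      show ?thesis using step[OF C4_in_nb[OF e(1,3)] e(2), of 5] by simp
    qed
  qed
qed

lemma join: "reach arc m x u \<Longrightarrow> reach arc n v y \<Longrightarrow> m + n \<le> 12 \<Longrightarrow> reach arc 13 x y"
  using reach_mono[OF reach_trans[OF reach_Suc[of arc m x u v, OF _ uv]], of n y 13] by simp

lemma join_uu: "reach arc m x u \<Longrightarrow> reach arc n u y \<Longrightarrow> m + n \<le> 13 \<Longrightarrow> reach arc 13 x y"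
  using reach_mono[OF reach_trans[of arc m x u n y], of 13] by simp

end

locale oriented_in =
  oriented V E ed u v du dv adj f P f' P' arc +
  A: oriented_half_in V E ed u v du dv adj f P arc +
  B: oriented_half_in V E ed v u dv du adj f' P' "\<lambda>s t. arc t s"
  for V :: "'v set" and E :: "'e set" and ed u v du dv adj f P f' P' arc

lemma (in oriented) oriented_in: "oriented_in V E ed u v du dv adj f P f' P' arc"
  using oriented_axioms half_in oriented.half_in[OF swapped] by (simp add: oriented_in_def)

context oriented_in
begin

lemma swapped_in: "oriented_in V E ed v u dv du adj f' P' f P (\<lambda>s t. arc t s)"
  using oriented.oriented_in[OF swapped] .

lemma outA:
  "A.has_child x \<Longrightarrow> reach arc 1 x u" "A.side 2 x \<Longrightarrow> reach arc 3 x u" "A.side 3 x \<Longrightarrow> reach arc 5 x u"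
  "A.side 3 x \<Longrightarrow> \<nexists>y. A.A3_late y \<Longrightarrow> reach arc 4 x u"
  using A.dout_A1 A.dout_A2 A.dout_A3 by blast+

lemma inB:
  "A.sw.has_child x \<Longrightarrow> reach arc 1 v x" "A.sw.side 2 x \<Longrightarrow> reach arc 3 v x" "A.sw.side 3 x \<Longrightarrow> reach arc 5 v x"
  "A.sw.side 1 x \<Longrightarrow> \<not> A.sw.has_child x \<Longrightarrow> reach arc 2 v x"
  using B_in B.dout_A1 B.dout_A2 B.dout_A3 B.childless by blast+

text \<open>The arc between the two ends points the wrong way, so the flow has to cross: through a
  vertex of \<open>A\<^sub>2\<close> in 6 + 2 steps or, if that vertex is late, through
  \<open>B\<^sub>2\<close> in 2 + 4 by \<open>A2_bad\<close>.\<close>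

lemma in_u: "reach arc 8 v u"
proof -
  obtain x where x: "A.side 2 x" using B.ex_side_2 by blast
  obtain y where y: "A.sw.side 2 y" using A.ex_side_2 by blast
  show ?thesis
  proof (cases "A.entered 6 x")
    case True
    then have "reach arc 6 v x" using A.din_A2[OF x] by blast
    moreover have "reach arc 2 x u" using A.dout_A2_free[OF x] A.not_attached(1)[OF x True] by blast
    ultimately show ?thesis using reach_trans[of arc 6 v x 2 u] by simp
  next
    case False
    then have r: "A.sw.entered 4 y" using A.A2_bad[OF x _ y] by blast
    then have "\<not> A.sw.attached y" using A.sw.not_attached(1)[OF y] A.sw.entered_mono[of 4 y 6] by simp
    then have "reach arc 2 v y" using B_in B.dout_A2_free[OF y] by blast
    moreover have "reach arc 4 y u" using B.din_entered[OF r] y unfolding conv by (auto dest: A.sw.levels_disjoint)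
    ultimately show ?thesis using reach_trans[of arc 2 v y 4 u] reach_mono[of arc 6 v u 8] by simp
  qed
qed

lemma in_A1: "A.has_child y \<Longrightarrow> reach arc 8 v y"
  using A.din_A1[of y] reach_mono[of arc 7 v y 8] by auto

lemma in_any: "y \<in> V \<Longrightarrow> reach arc 10 v y"
proof (cases rule: A.V_cases[of y])
  assume y: "y \<in> V"
  have m: "\<And>n. reach arc n v y \<Longrightarrow> n \<le> 10 \<Longrightarrow> reach arc 10 v y" using reach_mono[of arc _ v y 10] by blast
  show "y \<in> V" by (fact y)
  show "y = u \<Longrightarrow> ?thesis" using in_u m[of 8] by simp
  show "A.side 1 y \<Longrightarrow> ?thesis"
    using in_A1[of y] m[of 8] A.childless(2)[of y] reach_trans[OF in_u, of 2 y] by (cases "A.has_child y") auto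
  show "A.side 2 y \<Longrightarrow> ?thesis" using A.din_A2[of y] m[of 7] by simp
  show "A.side 3 y \<Longrightarrow> ?thesis" using A.din_A3[of y] m[of 6] by simp
  show "A.middle 3 y \<Longrightarrow> ?thesis" using C3_in[of y] m[of 3] by simp
  show "A.middle 4 y \<Longrightarrow> ?thesis" using C4_in[of y] m[of 5] by simp
  show "y = v \<Longrightarrow> ?thesis" by simp
  show "A.sw.side 1 y \<Longrightarrow> ?thesis" using inB(1,4)[of y] m[of 1] m[of 2] by auto
  show "A.sw.side 2 y \<Longrightarrow> ?thesis" using inB(2)[of y] m[of 3] by simp
  show "A.sw.side 3 y \<Longrightarrow> ?thesis" using inB(3)[of y] m[of 5] by simp
qed

lemma A1_far_C4:
  assumes y: "A.has_child y" "\<not> reach arc 7 v y" and x: "A.middle 4 x"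
  shows "\<exists>a. adj x a \<and> A.side 3 a \<and> reach arc 3 a u"
proof -
  have "\<not> A.entered 7 y" using A.din_entered[of 7 y] y unfolding A.has_child_def by (auto dest: A.levels_disjoint)
  then have "\<exists>a. adj x a \<and> A.side 3 a" using A.A1_C4[OF y(1) _ x] A.adj_sym by metis
  then show ?thesis using A.A1_C4_dist[OF y x] by blast
qed

text \<open>Leaving costs at most 5 and entering at most 7, except 8 for some \<open>y\<close> in
  \<open>A\<^sub>1\<close>. In that case \<open>B\<^sub>3\<close> is empty, nothing is
  \<open>A3_late\<close>, and leaving costs at most 4; for \<open>C\<^sub>4\<close> this is
  \<open>A1_far_C4\<close>.\<close>

lemma from_AC:
  assumes x: "x \<in> V" "x = u \<or> A.side i x \<or> A.middle i x" and y: "y \<in> V"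
  shows "reach arc 13 x y"
proof -
  interpret S: oriented_in V E ed v u dv du adj f' P' f P "\<lambda>s t. arc t s" by (rule swapped_in)
  have outC: "A.middle 3 c \<Longrightarrow> reach arc 3 c u" "A.middle 4 c \<Longrightarrow> reach arc 5 c u" for c
    using S.C3_in S.C4_in unfolding conv A.sw_middle by blast+
  have x5: "reach arc 5 x u"
    using x(1)
  proof (cases rule: A.V_cases)
    case 1 then show ?thesis by simp
  next
    case 2 then show ?thesis using outA(1)[of x] A.childless(1)[of x] reach_mono[of arc 1 x u 5] reach_mono[of arc 2 x u 5] by auto
  next
    case 3 then show ?thesis using outA(2)[of x] reach_mono[of arc 3 x u 5] by simp
  next
    case 4 then show ?thesis using outA(3) by blast
  next
    case 5 then show ?thesis using outC(1)[of x] reach_mono[of arc 3 x u 5] by simp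
  next
    case 6 then show ?thesis using outC(2) by blast
  qed (use x(2) A.levels_disjoint in blast)+
  show ?thesis
    using y
  proof (cases rule: A.V_cases)
    case 1 then show ?thesis using x5 reach_mono[of arc 5 x u 13] by simp
  next
    case 2
    show ?thesis
    proof (cases "A.has_child y")
      case False
      then show ?thesis using join_uu[OF x5 A.childless(2)[OF 2]] by simp
    next
      case y1: True
      show ?thesis
      proof (cases "reach arc 7 v y")
        case True then show ?thesis using join[OF x5] by simp
      next
        case far: False
        note y8 = in_A1[OF y1]
        have "\<nexists>z. A.sw.side 3 z"
          using A.A1_B3[OF y1] A.din_entered[of 7 y] far 2 by (auto dest: A.levels_disjoint)
        then have nT: "\<nexists>z. A.A3_late z" using A.A3_late_nb by blast
        have "reach arc 4 x u"
          using x(1)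
        proof (cases rule: A.V_cases)
          case 1 then show ?thesis by simp
        next
          case 2 then show ?thesis using outA(1)[of x] A.childless(1)[of x] reach_mono[of arc 1 x u 4] reach_mono[of arc 2 x u 4] by auto
        next
          case 3 then show ?thesis using outA(2)[of x] reach_mono[of arc 3 x u 4] by simp
        next
          case 4 then show ?thesis using outA(4) nT by blast
        next
          case 5 then show ?thesis using outC(1)[of x] reach_mono[of arc 3 x u 4] by simp
        next
          case 6
          then obtain a where a: "adj x a" "A.side 3 a" "reach arc 3 a u" using A1_far_C4[OF y1 far] by blast
          then show ?thesis using reach_Suc2[OF CA[OF a(1) 6 a(2)] a(3)] by simp
        qed (use x(2) A.levels_disjoint in blast)+
        then show ?thesis using join[OF _ y8] by simp
      qed
    qed
  next
    case 3 then show ?thesis using join[OF x5, of 7] A.din_A2 by simp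
  next
    case 4 then show ?thesis using join[OF x5, of 6] A.din_A3 by simp
  next
    case 5 then show ?thesis using join[OF x5 C3_in] by simp
  next
    case 6 then show ?thesis using join[OF x5 C4_in] by simp
  next
    case 7 then show ?thesis using join[OF x5, of 0] by simp
  next
    case 8 then show ?thesis using join[OF x5 inB(1)] join[OF x5 inB(4)] by (cases "A.sw.has_child y") auto
  next
    case 9 then show ?thesis using join[OF x5 inB(2)] by simp
  next
    case 10 then show ?thesis using join[OF x5 inB(3)] by simp
  qed
qed

end

section \<open>From the \<open>B\<close>-side to the \<open>A\<close>-side\<close>

context oriented_in
begin

text \<open>
  Along a crossing path the bounds on \<open>v \<rightarrow> y\<close> and \<open>x \<rightarrow> u\<close> share the four steps of the path, so their sum can
  exceed 10 only for crossings through \<open>A\<^sub>3\<close>; those paths are nearly forced and follow the orientation.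
\<close>

lemma crossing_far:
  assumes y: "A.side 2 y" "A.entered 6 y" "\<not> A.entered 5 y" and x: "A.sw.side 2 x" "A.sw.entered 6 x" "\<not> A.sw.entered 4 x"
  shows "reach arc 4 x y \<or> reach arc 5 v y \<and> A.sw.entered 5 x"
proof -
  obtain a b c where p: "adj y a" "adj a b" "adj b c" "adj c x" "A.sw.side 3 c"
    "A.side 2 a \<and> A.side 3 b \<or> A.side 3 a \<and> \<not> A.entered 4 a \<and> (A.side 3 b \<or> A.middle 4 b)"
    using A.A2_B2_far[OF y(1,3) x(1,3)] .
  note s = A.adj_sym[OF p(1)] A.adj_sym[OF p(2)] A.adj_sym[OF p(3)] A.adj_sym[OF p(4)]
  have b: "A.side 3 b \<or> A.middle 4 b \<and> A.side 3 a" using p(6) by blast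
  have "A.sw.entered 4 c \<or> A.sw.entered 5 c \<and> \<not> A.sw.no_B3 \<and> (\<exists>d. adj c d \<and> A.sw.middle 4 d)"
    using A.sw.cross_B3[OF p(5) s(3), of 4] A.sw.cross_C4[OF p(5) s(3), of 5] b s(3) unfolding A.sw_middle A.sw.no_B3_def by auto
  then have "\<not> A.sw.attached c" using B.dout_A3_crossing[OF p(5)] by blast
  then have xc: "arc x c" using B.arc_down[OF _ p(4) x(1)] p(5) by simp
  have cb: "arc c b" using b BA[OF s(3) p(5), simplified] BC[OF s(3) p(5), of 4] by blast
  have xb: "reach arc 2 x b" using reach_trans[OF reach_one[of arc, OF xc] reach_one[of arc, OF cb]] by (simp add: numeral_2_eq_2)
  have fin: "reach arc 4 x y" if "arc b a" "arc a y"
    using reach_trans[OF xb reach_trans[OF reach_one[of arc, OF that(1)] reach_one[of arc, OF that(2)]]] by simp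
  have ry: "\<not> A.attached y" "\<not> A.A2_below y" "A.priority y = 2 + A.entry_time y" "5 < A.entry_time y"
  proof -
    show "\<not> A.attached y" using A.not_attached(1)[OF y(1,2)] .
    moreover show "\<not> A.A2_below y" using y(2) unfolding A.A2_below_def A.A2_late_def by blast
    ultimately show "A.priority y = 2 + A.entry_time y" by (rule A.priority_entry_time)
    show "5 < A.entry_time y" using A.entry_time_gt[OF y(3)] by simp
  qed
  have b4: "A.side 3 b \<Longrightarrow> A.entered 4 b \<and> \<not> A.attached b"
    using A.cross_B3[OF _ p(3), of 4, simplified] p(5) A.not_attached(3) by blast
  from p(6) consider "A.side 2 a" "A.side 3 b" | "A.side 3 a" "\<not> A.entered 4 a" "A.side 3 b" | "A.side 3 a" "\<not> A.entered 4 a" "A.middle 4 b" by blast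
  then show ?thesis
  proof cases
    case 1
    have "A.entered 4 b" using b4 1(2) by blast
    then have r: "A.entered 5 a" "A.entered 6 a" using A.descend_A3[OF _ 1(2,1) p(2)] by simp_all
    have na: "\<not> A.attached a" "\<not> A.A2_below a" using A.not_attached(1)[OF 1(1) r(2)] r(2) unfolding A.A2_below_def A.A2_late_def by blast+
    have "arc b a" using A.arc_down[OF _ s(2) 1(1)] 1(2) b4 by simp
    moreover have "arc a y"
      using A.arc_sideways[OF s(1) 1(1) y(1)] A.priority_entry_time[OF na] A.entry_time_le[OF r(1)] ry by simp
    ultimately show ?thesis using fin by blast
  next
    case 2
    have "A.entered 4 b" using b4 2(3) by blast
    then have r: "A.entered 5 a" using A.sideways_A3[OF _ 2(3,1) p(2)] by simp
    have nf: "\<not> A.is_foot a y"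
    proof
      assume "A.is_foot a y"
      then have "A.entered (if A.A3_first a then 3 else 4) y" using A.isfoot3[OF 2(1)] by blast
      then show False using y(3) A.entered_mono[of "if A.A3_first a then 3 else 4" y 5] by simp
    qed
    have ay: "arc a y" using A.arc_down_nofoot[OF nf s(1) y(1)] 2(1) by simp
    show ?thesis
    proof (cases "A.attached a")
      case False
      have ng: "\<not> A.A2_below a" "\<not> A.A2_below b" using A.class_side(6,7) 2 A.levels_disjoint by blast+
      have "arc b a"
        using A.arc_sideways[OF s(2) 2(3,1)] A.priority_entry_time[OF False ng(1)] A.priority_entry_time[OF _ ng(2)] b4[OF 2(3)]
          A.entry_time_le[of 4 b] A.entry_time_gt[OF 2(2)] by simp
      then show ?thesis using fin ay by blast
    next
      case True
      then have T: "A.A3_first a" using A.attached_A3[OF 2(1)] r A.A3_second_def by blast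
      have "\<not> A.is_foot a b" using A.isfoot3[OF 2(1)] 2(3) A.levels_disjoint by blast
      then have "a \<notin> P"
        using A.P_exit[OF True p(2) _ A.side_less[OF 2(3)]] b4[OF 2(3)] 2(1,3) by (simp add: A.side_def)
      then have "reach arc 5 v y" using step[OF A.din_A3_first_Q[OF T] ay, of 5] by simp
      moreover have "A.sw.entered 4 c" using A.sw.cross_B3[OF p(5) s(3), of 4] 2(3) by simp
      ultimately show ?thesis using A.sw.descend_A3[of 4 c x 5] p(4,5) x(1) s(4) by simp
    qed
  next
    case 3
    have "A.entered 5 a \<and> \<not> A.no_B3 \<and> (\<exists>d. adj a d \<and> A.middle 4 d)"
      using A.cross_C4[OF 3(1) p(2) 3(3), of 5] p(2,5) 3(3) unfolding A.no_B3_def by auto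
    then have nX: "\<not> A.attached a" using A.dout_A3_crossing[OF 3(1)] by blast
    have "arc a y" using A.arc_down[OF nX s(1) y(1)] 3(1) by simp
    moreover have "arc b a" using CA[OF s(2) 3(3,1)] .
    ultimately show ?thesis using fin by blast
  qed
qed

lemma out_B2: "A.sw.side 2 x \<Longrightarrow> reach arc 7 x u \<and> (A.sw.entered 6 x \<longrightarrow> reach arc 6 x u)"
  using B.din_A2[of x] unfolding conv .

lemma out_B3: "A.sw.side 3 x \<Longrightarrow> reach arc 6 x u \<and> (A.sw.entered 5 x \<or> A.sw.above 3 x \<longrightarrow> reach arc 5 x u)"
  using B.din_A3[of x] unfolding conv .

lemma out_B: "A.sw.entered n x \<Longrightarrow> n \<le> 7 \<Longrightarrow> (A.sw.side 3 x \<longrightarrow> n \<le> 5) \<Longrightarrow> (A.sw.side 2 x \<longrightarrow> n \<le> 6) \<Longrightarrow> reach arc n x u"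
  using B.din_entered[of n x] unfolding conv by blast

lemma out_B1: "A.sw.has_child x \<Longrightarrow> reach arc 7 x u \<or> reach arc 8 x u \<and> (\<forall>y. A.side 2 y \<longrightarrow> A.entered 3 y)"
  using B.din_A1[of x] unfolding conv by blast

lemma out_B1_child: "A.sw.has_child x \<Longrightarrow> adj x z \<Longrightarrow> A.sw.side 2 z \<Longrightarrow> reach arc m z u \<Longrightarrow> A.sw.entered 6 z \<Longrightarrow> reach arc (Suc m) x u"
  using B.din_A1_child[of x z m] unfolding conv by blast

lemma in_A2g: "A.side 2 y \<Longrightarrow> A.entered n y \<Longrightarrow> n \<le> 6 \<Longrightarrow> reach arc n v y"
  using A.din_entered[of n y] by (auto dest: A.levels_disjoint)

lemma in_A1g: "A.has_child y \<Longrightarrow> A.entered n y \<Longrightarrow> n \<le> 7 \<Longrightarrow> reach arc n v y"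
  using A.din_entered[of n y] unfolding A.has_child_def by (auto dest: A.levels_disjoint)

lemma out_B2g: "A.sw.side 2 x \<Longrightarrow> A.sw.entered n x \<Longrightarrow> n \<le> 6 \<Longrightarrow> reach arc n x u"
  using out_B[of n x] by (auto dest: A.levels_disjoint)

text \<open>The 10 leaves one step at each end for passing from a vertex of \<open>B\<^sub>1\<close>
  up to \<open>x\<close> and from \<open>y\<close> down to a vertex of \<open>A\<^sub>1\<close>.
  Larger sums occur only with a 6 on one side and at least 5 on the other, which is
  \<open>crossing_far\<close> or its mirror image.\<close>

lemma crossing_good:
  assumes y: "A.side 2 y" "A.entered 6 y" and x: "A.sw.side 2 x" "A.sw.entered 6 x"
  obtains "reach arc 4 x y" | m n where "reach arc m x u" "reach arc n v y" "m + n \<le> 10"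
proof -
  interpret S: oriented_in V E ed v u dv du adj f' P' f P "\<lambda>s t. arc t s" by (rule swapped_in)
  have iny: "A.entered n y \<Longrightarrow> n \<le> 6 \<Longrightarrow> reach arc n v y" for n using in_A2g[OF y(1)] .
  have outx: "A.sw.entered n x \<Longrightarrow> n \<le> 6 \<Longrightarrow> reach arc n x u" for n using out_B2g[OF x(1)] .
  consider "A.entered 5 y" "A.sw.entered 5 x" | "A.entered 4 y" | "A.sw.entered 4 x"
    | "\<not> A.entered 5 y" "\<not> A.sw.entered 4 x" | "\<not> A.sw.entered 5 x" "\<not> A.entered 4 y" by blast
  then show thesis
  proof cases
    case 1 then show thesis using that(2)[OF outx iny] by simp
  next
    case 2 then show thesis using that(2)[OF outx[OF x(2)] iny] by simp
  next
    case 3 then show thesis using that(2)[OF outx iny[OF y(2)]] by simp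
  next
    case 4
    from crossing_far[OF y 4(1) x 4(2)] show thesis using that(1) that(2)[of 5 5] outx[of 5] by auto
  next
    case 5
    from S.crossing_far[OF x 5(1) y 5(2)] show thesis unfolding conv using that(1) that(2)[of 5 5] iny[of 5] by auto
  qed
qed

text \<open>The pairs excluded by \<open>nx\<close> are obtained in \<open>all_reach\<close> by
  mirroring: \<open>B\<^sub>2\<close> to \<open>A\<^sub>3\<close> from this lemma,
  \<open>B\<^sub>1\<close> to \<open>A\<^sub>3\<close> from \<open>from_B3_to_A1\<close>.\<close>

lemma from_B_to_A:
  assumes x: "A.sw.has_child x \<or> A.sw.side 2 x \<or> A.sw.side 3 x" and y: "A.side 2 y \<or> A.side 3 y"
    and nx: "\<not> (A.sw.side 2 x \<and> A.side 3 y)"  "\<not> (A.sw.has_child x \<and> A.side 3 y)"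
  shows "reach arc 13 x y"
proof -
  interpret S: oriented_in V E ed v u dv du adj f' P' f P "\<lambda>s t. arc t s" by (rule swapped_in)
  have y2: "A.side 2 y \<Longrightarrow> reach arc 7 v y" "A.side 2 y \<Longrightarrow> A.entered 6 y \<Longrightarrow> reach arc 6 v y" using A.din_A2 by blast+
  from x y nx consider "A.sw.side 3 x" "A.side 3 y" | "A.sw.side 3 x" "A.side 2 y" | "A.sw.side 2 x" "A.side 2 y" | "A.sw.has_child x" "A.side 2 y" by blast
  then show ?thesis
  proof cases
    case 1 then show ?thesis using join[of 6 x 6 y] out_B3 A.din_A3 by simp
  next
    case 2
    show ?thesis
    proof (cases "A.entered 6 y")
      case True then show ?thesis using join[of 6 x 6 y] out_B3 y2 2 by simp
    next
      case False
      then have "A.sw.entered 5 x \<or> A.sw.above 3 x" using A.A2_bad_B3[OF 2(2) _ 2(1)] by blast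
      then show ?thesis using join[of 5 x 7 y] out_B3[OF 2(1)] y2(1)[OF 2(2)] by simp
    qed
  next
    case 3
    show ?thesis
    proof (cases "A.entered 6 y")
      case True
      show ?thesis
      proof (cases "A.sw.entered 6 x")
        case xr: True then show ?thesis using join[of 6 x 6 y] out_B2[OF 3(1)] y2(2)[OF 3(2) True] by simp
      next
        case False
        then have "A.entered 4 y" using A.sw.A2_bad[OF 3(1) _ 3(2)] by blast
        then have "reach arc 4 v y" using in_A2g[OF 3(2)] by simp
        then show ?thesis using join[of 7 x 4 y] out_B2[OF 3(1)] by simp
      qed
    next
      case False
      then have "A.sw.entered 4 x" using A.A2_bad[OF 3(2) _ 3(1)] by blast
      then have "reach arc 4 x u" using out_B2g[OF 3(1)] by simp
      then show ?thesis using join[of 4 x 7 y] y2(1)[OF 3(2)] by simp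
    qed
  next
    case 4
    obtain z where z: "adj x z" "A.sw.side 2 z" using 4(1) A.sw.has_child_def by blast
    show ?thesis
    proof (cases "A.sw.entered 6 z")
      case False
      then have "A.entered 4 y" using A.sw.A2_bad[OF z(2) _ 4(2)] by blast
      then have "reach arc 4 v y" using in_A2g[OF 4(2)] by simp
      moreover have "reach arc 8 x u" using S.in_A1[OF 4(1)] unfolding conv .
      ultimately show ?thesis using join[of 8 x 4 y] by simp
    next
      case zr: True
      note has_child = out_B1_child[OF 4(1) z _ zr]
      show ?thesis
      proof (cases "A.entered 6 y")
        case False
        then have "A.sw.entered 4 z" using A.A2_bad[OF 4(2) _ z(2)] by blast
        then have "reach arc 4 z u" using out_B2g[OF z(2)] by simp
        then show ?thesis using join[OF has_child, of 4 7 y] y2(1)[OF 4(2)] by simp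
      next
        case True
        have "arc x z" using B.arc_down[OF A.sw.not_attached(1)[OF z(2) zr] A.adj_sym[OF z(1)], of 1] 4(1) z(2)
          unfolding A.sw.has_child_def by (simp add: Suc_1[symmetric] del: Suc_1)
        from crossing_good[OF 4(2) True z(2) zr] show ?thesis
        proof cases
          case 1
          then show ?thesis using reach_mono[OF reach_Suc2[of arc, OF \<open>arc x z\<close> 1], of 13] by simp
        next
          case (2 m n)
          then show ?thesis using join[OF has_child[OF 2(1)] 2(2)] by simp
        qed
      qed
    qed
  qed
qed

text \<open>When one child is late, \<open>A2_bad\<close> makes the child on the other side early,
  which leaves 5 + 7. An 8 at the late end comes, by \<open>din_A1\<close>, with a 3 at the other
  child, hence 4 + 8.\<close>

lemma from_B1_to_A1:
  assumes x: "A.sw.has_child x" and y: "A.has_child y"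
  shows "reach arc 13 x y"
proof -
  interpret S: oriented_in V E ed v u dv du adj f' P' f P "\<lambda>s t. arc t s" by (rule swapped_in)
  obtain z where z: "adj x z" "A.sw.side 2 z" using x A.sw.has_child_def by blast
  obtain w where w: "adj y w" "A.side 2 w" using y A.has_child_def by blast
  show ?thesis
  proof (cases "A.entered 6 w")
    case False
    then have z4: "A.sw.entered 4 z" using A.A2_bad[OF w(2) _ z(2)] by blast
    then have zr: "A.sw.entered 6 z" by (rule A.sw.entered_mono) simp
    note has_child = out_B1_child[OF x z _ zr]
    have o: "A.sw.entered n z \<Longrightarrow> n \<le> 6 \<Longrightarrow> reach arc n z u" for n using out_B2g[OF z(2)] .
    from A.din_A1[OF y] have "reach arc 7 v y \<or> reach arc 8 v y \<and> A.sw.entered 3 z" using z(2) by blast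
    then show ?thesis using join[OF has_child[OF o[OF z4]], of 7 y] join[OF has_child[OF o[of 3]], of 8 y] by auto
  next
    case wr: True
    note cw = A.din_A1_child[OF y w _ wr]
    show ?thesis
    proof (cases "A.sw.entered 6 z")
      case False
      then have w4: "A.entered 4 w" using A.sw.A2_bad[OF z(2) _ w(2)] by blast
      have o: "A.entered n w \<Longrightarrow> n \<le> 6 \<Longrightarrow> reach arc n v w" for n using in_A2g[OF w(2)] .
      from out_B1[OF x] have "reach arc 7 x u \<or> reach arc 8 x u \<and> A.entered 3 w" using w(2) by blast
      then show ?thesis using join[OF _ cw[OF o[OF w4]], of 7 x] join[OF _ cw[OF o[of 3]], of 8 x] by auto
    next
      case zr: True
      have xz: "arc x z" using B.arc_down[OF A.sw.not_attached(1)[OF z(2) zr] A.adj_sym[OF z(1)], of 1] x z(2)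
        unfolding A.sw.has_child_def by (simp add: Suc_1[symmetric] del: Suc_1)
      have wy: "arc w y" using A.arc_down[OF A.not_attached(1)[OF w(2) wr] A.adj_sym[OF w(1)], of 1] y w(2)
        unfolding A.has_child_def by (simp add: Suc_1[symmetric] del: Suc_1)
      from crossing_good[OF w(2) wr z(2) zr] show ?thesis
      proof cases
        case 1
        then show ?thesis using reach_mono[OF reach_Suc[OF reach_Suc2[of arc, OF xz 1] wy], of 13] by simp
      next
        case (2 m n)
        then show ?thesis using join[OF out_B1_child[OF x z 2(1) zr] cw[OF 2(2)]] by simp
      qed
    qed
  qed
qed

lemma from_B3_to_A1:
  assumes x: "A.sw.side 3 x" and y: "A.has_child y"
  shows "reach arc 13 x y"
proof -
  have r: "A.entered 7 y" "A.sw.entered 5 x \<or> A.entered 6 y" using A.A1_B3[OF y x] by blast+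
  have "A.entered n y \<Longrightarrow> n \<le> 7 \<Longrightarrow> reach arc n v y" for n using in_A1g[OF y] .
  then show ?thesis using r join[of 5 x 7 y] join[of 6 x 6 y] out_B3[OF x] by auto
qed

theorem all_reach:
  assumes x: "x \<in> V" and y: "y \<in> V"
  shows "reach arc 13 x y"
proof -
  interpret S: oriented_in V E ed v u dv du adj f' P' f P "\<lambda>s t. arc t s" by (rule swapped_in)
  have inAny: "reach arc 10 v y" using in_any[OF y] .
  have outAny: "reach arc 10 x u" using S.in_any[OF x] unfolding conv .
  have AC: ?thesis if "x = u \<or> A.side i x \<or> A.middle i x" for i using from_AC[OF x that y] .
  have CB: ?thesis if "y = v \<or> A.sw.side i y \<or> A.sw.middle i y" for i using S.from_AC[OF y that x] unfolding conv .
  show ?thesis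
  proof (cases "(x = v \<or> A.sw.side 1 x \<and> \<not> A.sw.has_child x) \<or> (y = u \<or> A.side 1 y \<and> \<not> A.has_child y)")
    case True
    then show ?thesis
    proof
      assume "x = v \<or> A.sw.side 1 x \<and> \<not> A.sw.has_child x"
      then have "reach arc 2 x v" using B.childless(2)[of x] unfolding conv by auto
      then show ?thesis using reach_mono[OF reach_trans[OF _ inAny], of 2 x 13] by simp
    next
      assume "y = u \<or> A.side 1 y \<and> \<not> A.has_child y"
      then have "reach arc 2 u y" using A.childless(2)[of y] by auto
      then show ?thesis using reach_mono[OF reach_trans[OF outAny], of 2 y 13] by simp
    qed
  next
    case False
    have xs: "A.sw.has_child x \<or> A.sw.side 2 x \<or> A.sw.side 3 x \<or> ?thesis"
      using x False AC by (cases rule: A.V_cases) blast+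
    have ys: "A.has_child y \<or> A.side 2 y \<or> A.side 3 y \<or> ?thesis"
      using y False CB by (cases rule: A.V_cases) (unfold A.sw_middle, blast+)
    have d: "\<not> (A.side 2 y \<and> A.side 3 y)" "\<not> (A.has_child y \<and> A.side 3 y)" "\<not> (A.has_child y \<and> A.side 2 y)"
      "\<not> (A.sw.side 2 x \<and> A.sw.side 3 x)" "\<not> (A.sw.has_child x \<and> A.sw.side 3 x)" "\<not> (A.sw.has_child x \<and> A.sw.side 2 x)"
      unfolding A.has_child_def A.sw.has_child_def by (auto dest: A.levels_disjoint)
    note S = S.from_B_to_A[of y x, unfolded conv] S.from_B3_to_A1[of y x, unfolded conv]
    show ?thesis using xs ys S from_B_to_A[of x y] from_B1_to_A1[of x y] from_B3_to_A1[of x y] d by argo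
  qed
qed

end

section \<open>Existence of the orientation\<close>

text \<open>
  The vertices of \<open>C\<^sub>4\<close> with neighbours in neither \<open>A\<^sub>3\<close> nor \<open>B\<^sub>3\<close> are served by ears over \<open>C\<^sub>3\<close>, except that a
  neighbour in \<open>C4_A\<close> serves as the entry when there is one.
\<close>

context levels
begin

definition C4_A :: "'v \<Rightarrow> bool" where
  "C4_A c \<longleftrightarrow> middle 4 c \<and> meets_A c \<and> \<not> sw.meets_A c"

definition C4_B :: "'v \<Rightarrow> bool" where
  "C4_B c \<longleftrightarrow> middle 4 c \<and> sw.meets_A c \<and> \<not> meets_A c"

definition C4_inner :: "'v \<Rightarrow> bool" where
  "C4_inner c \<longleftrightarrow> middle 4 c \<and> \<not> meets_A c \<and> \<not> sw.meets_A c"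

definition C4_deep :: "'v \<Rightarrow> bool" where
  "C4_deep c \<longleftrightarrow> C4_inner c \<and> \<not> (\<exists>b. adj c b \<and> C4_A b)"

lemma C4_inner_nb: "C4_inner c \<Longrightarrow> adj c y \<Longrightarrow> middle 3 y \<or> middle 4 y"
  using C4_nb[of c y] unfolding C4_inner_def meets_A_def sw.meets_A_def by blast

lemma C4_C3:
  assumes "middle 4 c" "\<not> meets_A c"
  shows "\<exists>d. adj c d \<and> middle 3 d"
proof -
  have cV: "c \<in> V" "du c = Suc 3" using assms(1) unfolding middle_def by simp_all
  obtain d where d: "adj c d" "du d = 3" using du_prev[OF cV] by blast
  have "\<not> side 3 d" using assms(2) d(1) unfolding meets_A_def by blast
  then have "middle 3 d"
    using C4_nb[OF assms(1) d(1)] d(2) unfolding sw.side_def middle_def by (elim disjE) simp_all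
  then show ?thesis using d by blast
qed

definition C_exit :: "('v \<Rightarrow> 'e) \<Rightarrow> 'v \<Rightarrow> bool" where
  "C_exit fc c \<longleftrightarrow> (\<exists>g\<in>E. g \<noteq> fc c \<and> (\<exists>d. ed g = {c, d} \<and> (middle 3 d \<or> middle 4 d \<and> \<not> C4_deep d \<and> \<not> C4_A d)))"

text \<open>The ears of \<open>attachment_ex\<close> again, with feet in \<open>C\<^sub>3\<close>. A
  deep vertex has neighbours only in \<open>C\<^sub>3\<close> and \<open>C\<^sub>4\<close> and none
  in \<open>C4_A\<close>, so without an exit its second edge ends in another deep vertex, which by
  independence is not in \<open>Pc\<close>.\<close>

lemma centre_attachment:
  "\<exists>fc Pc. (\<forall>c. C4_deep c \<longrightarrow> fc c \<in> E \<and> (\<exists>d. middle 3 d \<and> ed (fc c) = {c, d})) \<and> (\<forall>c\<in>Pc. C4_deep c) \<and>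
    (\<forall>c\<in>Pc. \<exists>w. C4_deep w \<and> w \<notin> Pc \<and> adj w c) \<and>
    (\<forall>c. C4_deep c \<longrightarrow> c \<notin> Pc \<longrightarrow> C_exit fc c \<or> (\<exists>w\<in>Pc. adj c w))"
proof -
  have "\<forall>c. \<exists>e. C4_deep c \<longrightarrow> e \<in> E \<and> (\<exists>d. middle 3 d \<and> ed e = {c, d})"
  proof
    fix c
    show "\<exists>e. C4_deep c \<longrightarrow> e \<in> E \<and> (\<exists>d. middle 3 d \<and> ed e = {c, d})"
    proof (cases "C4_deep c")
      case True
      then have "middle 4 c" "\<not> meets_A c" unfolding C4_deep_def C4_inner_def by blast+
      from C4_C3[OF this] obtain d where "adj c d" "middle 3 d" by blast
      then show ?thesis unfolding adj_def by blast
    qed simp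
  qed
  then obtain fc where "\<forall>c. C4_deep c \<longrightarrow> fc c \<in> E \<and> (\<exists>d. middle 3 d \<and> ed (fc c) = {c, d})"
    by (rule choice[THEN exE])
  then have fc: "\<And>c. C4_deep c \<Longrightarrow> fc c \<in> E \<and> (\<exists>d. middle 3 d \<and> ed (fc c) = {c, d})" by blast
  define S where "S = {c. C4_deep c \<and> \<not> C_exit fc c}"
  have "S \<subseteq> V" unfolding S_def C4_deep_def C4_inner_def middle_def by blast
  then have "finite S" using finV finite_subset by blast
  from maximal_independent[OF this, of adj] obtain Pc where Pc0: "Pc \<subseteq> S" "\<forall>x\<in>Pc. \<forall>y\<in>Pc. \<not> adj x y"
    "\<forall>x\<in>S - Pc. \<not> adj x x \<longrightarrow> (\<exists>y\<in>Pc. adj x y \<or> adj y x)" by (elim exE conjE)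
  have Pc: "Pc \<subseteq> S" "\<And>x y. x \<in> Pc \<Longrightarrow> y \<in> Pc \<Longrightarrow> \<not> adj x y"
    "\<And>x. x \<in> S \<Longrightarrow> x \<notin> Pc \<Longrightarrow> \<not> adj x x \<Longrightarrow> \<exists>y\<in>Pc. adj x y \<or> adj y x"
    using Pc0 by simp_all
  have PS: "C4_deep x" "\<not> C_exit fc x" if "x \<in> Pc" for x using Pc(1) that unfolding S_def by auto
  have 1: "\<exists>w. C4_deep w \<and> w \<notin> Pc \<and> adj w c" if c: "c \<in> Pc" for c
  proof -
    have dc: "C4_inner c" "\<not> (\<exists>b. adj c b \<and> C4_A b)" using PS(1)[OF c] C4_deep_def by blast+
    have "c \<in> V" using dc unfolding C4_inner_def middle_def by blast
    then obtain g where g: "g \<in> E" "g \<noteq> fc c" "c \<in> ed g" using two_edges by blast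
    obtain w where w: "ed g = {c, w}" "adj c w" using ends_other[OF g(1,3)] by blast
    have "middle 3 w \<or> middle 4 w" "\<not> C4_A w" using C4_inner_nb[OF dc(1) w(2)] dc(2) w(2) by blast+
    then have "C4_deep w" using PS(2)[OF c] g w unfolding C_exit_def by blast
    then show ?thesis using Pc(2)[OF c] w(2) adj_sym by blast
  qed
  have 2: "C_exit fc c \<or> (\<exists>w\<in>Pc. adj c w)" if "C4_deep c" "c \<notin> Pc" for c
  proof (cases "C_exit fc c")
    case False
    then have "c \<in> S" using that(1) S_def by blast
    moreover have "\<not> adj c c" using adjV[of c c] by blast
    ultimately have "\<exists>y\<in>Pc. adj c y \<or> adj y c" using Pc(3)[OF _ that(2)] by blast
    then show ?thesis using adj_sym by blast
  qed simp
  show ?thesis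
  proof (intro exI[of _ fc] exI[of _ Pc] conjI allI ballI impI)
    show "\<exists>w. C4_deep w \<and> w \<notin> Pc \<and> adj w c" if "c \<in> Pc" for c using 1[OF that] .
    show "C_exit fc c \<or> (\<exists>w\<in>Pc. adj c w)" if "C4_deep c" "c \<notin> Pc" for c using 2[OF that] .
  qed (use fc PS(1) in blast)+
qed

end

context levels
begin

text \<open>The prescriptions for the two halves, for the crossings (\<open>FX\<close>) and for
  \<open>C\<^sub>3\<close> and \<open>C\<^sub>4\<close> (\<open>FC\<close>) concern different kinds
  of edges, and none of them demands both directions of an edge. So they combine into one relation
  \<open>F\<close> that extends to an orientation.\<close>

theorem good_orientation:
  "\<exists>ta he. (\<forall>e\<in>E. {ta e, he e} = ed e) \<and>
     (\<forall>x\<in>V. \<forall>y\<in>V. reach (\<lambda>s t. \<exists>e\<in>E. ta e = s \<and> he e = t) 13 x y)"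
proof -
  from attachment_ex obtain f P where "attachment V E ed u v du dv adj f P" by (elim exE)
  then interpret A: attachment V E ed u v du dv adj f P .
  from sw.attachment_ex obtain f' P' where "attachment V E ed v u dv du adj f' P'" by (elim exE)
  then interpret B: attachment V E ed v u dv du adj f' P' .
  from centre_attachment obtain fc Pc where fc0: "\<forall>c. C4_deep c \<longrightarrow> fc c \<in> E \<and> (\<exists>d. middle 3 d \<and> ed (fc c) = {c, d})"
    "\<forall>c\<in>Pc. C4_deep c" "\<forall>c\<in>Pc. \<exists>w. C4_deep w \<and> w \<notin> Pc \<and> adj w c"
    "\<forall>c. C4_deep c \<longrightarrow> c \<notin> Pc \<longrightarrow> C_exit fc c \<or> (\<exists>w\<in>Pc. adj c w)"
    by (elim exE conjE)
  have fc: "\<And>c. C4_deep c \<Longrightarrow> fc c \<in> E \<and> (\<exists>d. middle 3 d \<and> ed (fc c) = {c, d})" "\<And>c. c \<in> Pc \<Longrightarrow> C4_deep c"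
    "\<And>c. c \<in> Pc \<Longrightarrow> \<exists>w. C4_deep w \<and> w \<notin> Pc \<and> adj w c"
    "\<And>c. C4_deep c \<Longrightarrow> c \<notin> Pc \<Longrightarrow> C_exit fc c \<or> (\<exists>w\<in>Pc. adj c w)"
    using fc0 by simp_all
  \<comment> \<open>\<open>C4_A\<close> vertices are entered from \<open>C\<^sub>3\<close> and pass
    the flow to inner neighbours, which get 3 for not being deep. A deep vertex outside
    \<open>Pc\<close> is entered through its foot and may leave to \<open>Pc\<close> or to a vertex
    of value 3; the latter goes on to \<open>C\<^sub>3\<close> or meets both
    \<open>A\<^sub>3\<close> and \<open>B\<^sub>3\<close>.\<close>
  define c_priority :: "'v \<Rightarrow> nat" where "c_priority c = (if C4_A c then 0 else if C4_deep c then (if c \<in> Pc then 2 else 1) else 3)" for c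
  define reversed_foot where "reversed_foot c e \<longleftrightarrow> C4_deep c \<and> c \<notin> Pc \<and> e = fc c" for c e
  define FX where "FX e s t \<longleftrightarrow> e \<in> E \<and> ed e = {s, t} \<and> ((\<exists>i\<ge>1. sw.side i s \<and> side i t) \<or>
     (\<exists>i j. sw.side i s \<and> middle j t) \<or> (\<exists>i j. middle j s \<and> side i t) \<or> s = u \<and> t = v)" for e s t
  define FC where "FC e s t \<longleftrightarrow> e \<in> E \<and> ed e = {s, t} \<and> (middle 3 s \<and> middle 4 t \<and> (C4_A t \<or> reversed_foot t e) \<or>
     middle 4 s \<and> middle 3 t \<and> (C4_B s \<or> C4_inner s \<and> \<not> reversed_foot s e) \<or> middle 4 s \<and> middle 4 t \<and> c_priority s < c_priority t)" for e s t
  define F where "F e s t \<longleftrightarrow> A.half_arc e s t \<or> B.half_arc e t s \<or> FX e s t \<or> FC e s t" for e s t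
  have F_ed: "e \<in> E \<and> ed e = {s, t}" if "F e s t" for e s t
    using that unfolding F_def FX_def FC_def A.half_arc_def B.half_arc_def by (auto simp: insert_commute)
  have clA: "A.half_arc e s t \<Longrightarrow> (\<exists>i. side i s) \<and> (\<exists>i. side i t)" for e s t using A.half_arc_side by blast
  have clB: "B.half_arc e s t \<Longrightarrow> (\<exists>i. sw.side i s) \<and> (\<exists>i. sw.side i t)" for e s t using B.half_arc_side by blast
  have al_u: "side 0 u" and sw_v: "sw.side 0 v" using side_0 sw.side_0 by auto
  have FX_anti: "\<not> FX e t s" if fx: "FX e s t" for e s t
  proof
    assume r: "FX e t s"
    consider i where "1 \<le> i" "sw.side i s" "side i t" | i j where "sw.side i s" "middle j t" | i j where "middle j s" "side i t" | "s = u" "t = v"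
      using fx unfolding FX_def by blast
    then show False
    proof cases
      case 1
      then have "\<not> (t = u \<and> s = v)" using side_inj[OF 1(3), of 0] al_u by auto
      then show ?thesis using r 1 levels_disjoint(1,2,3) unfolding FX_def by metis
    next
      case 2 then show ?thesis using r levels_disjoint(1,2,3,8) unfolding FX_def by blast
    next
      case 3 then show ?thesis using r levels_disjoint(1,2,3,13) unfolding FX_def by blast
    next
      case 4
      then have "FX e v u" using r by simp
      moreover have "\<not> side i v" "\<not> sw.side i u" "\<not> middle i u" "\<not> middle i v" "v \<noteq> u" "1 \<le> i \<Longrightarrow> \<not> side i u" for i
        using levels_disjoint(7,8,12,13,15) du_u by (auto simp: side_def)
      ultimately show ?thesis unfolding FX_def by blast
    qed
  qed
  have FX_cl: "\<not> ((\<exists>i. side i s) \<and> (\<exists>i. side i t))" "\<not> ((\<exists>i. sw.side i s) \<and> (\<exists>i. sw.side i t))" "\<not> ((\<exists>i. middle i s) \<and> (\<exists>i. middle i t))"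
    if fx: "FX e s t" for e s t
  proof -
    consider "\<exists>i. sw.side i s" "\<exists>i. side i t" | "\<exists>i. sw.side i s" "\<exists>i. middle i t" | "\<exists>i. middle i s" "\<exists>i. side i t"
      | "\<exists>i. side i s" "\<exists>i. sw.side i t"
      using fx al_u sw_v unfolding FX_def by blast
    then have "\<not> ((\<exists>i. side i s) \<and> (\<exists>i. side i t)) \<and> \<not> ((\<exists>i. sw.side i s) \<and> (\<exists>i. sw.side i t)) \<and> \<not> ((\<exists>i. middle i s) \<and> (\<exists>i. middle i t))"
      using levels_disjoint(1,2,3) by cases blast+
    then show "\<not> ((\<exists>i. side i s) \<and> (\<exists>i. side i t))" "\<not> ((\<exists>i. sw.side i s) \<and> (\<exists>i. sw.side i t))" "\<not> ((\<exists>i. middle i s) \<and> (\<exists>i. middle i t))"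
      by blast+
  qed
  have FC_cl: "(\<exists>i. middle i s) \<and> (\<exists>i. middle i t)" if "FC e s t" for e s t
    using that unfolding FC_def by blast
  have FC_anti: "\<not> FC e t s" if fc': "FC e s t" for e s t
  proof
    assume r: "FC e t s"
    have g: "\<not> (C4_A c \<and> C4_B c)" "\<not> (C4_A c \<and> C4_inner c)" "\<not> (C4_B c \<and> reversed_foot c e')" for c e'
      unfolding C4_A_def C4_B_def C4_inner_def reversed_foot_def C4_deep_def by blast+
    have d: "\<not> (middle 3 c \<and> middle 4 c)" for c unfolding middle_def by simp
    have "\<not> (c_priority s < c_priority t \<and> c_priority t < c_priority s)" by simp
    then show False using r fc' g(1,2)[of s] g(1,2)[of t] g(3)[of s e] g(3)[of t e] d[of s] d[of t] unfolding FC_def by argo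
  qed
  have anti: "\<not> F e t s" if "F e s t" for e s t
  proof
    assume "F e t s"
    have m: "(\<exists>i. side i x) \<Longrightarrow> (\<exists>i. sw.side i x) \<Longrightarrow> False" "(\<exists>i. side i x) \<Longrightarrow> (\<exists>i. middle i x) \<Longrightarrow> False"
      "(\<exists>i. sw.side i x) \<Longrightarrow> (\<exists>i. middle i x) \<Longrightarrow> False" for x using levels_disjoint(1,2,3) by blast+
    note c1 = clA[of e s t] clA[of e t s] clB[of e s t] clB[of e t s] FX_cl[of e s t] FX_cl[of e t s] FC_cl[of e s t] FC_cl[of e t s]
    show False using \<open>F e t s\<close> \<open>F e s t\<close> c1 m[of s] m[of t] A.half_arc_antisym[of e s t] B.half_arc_antisym[of e s t] FX_anti[of e s t] FC_anti[of e s t]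
      unfolding F_def by argo
  qed
  \<comment> \<open>The pair is forced where \<open>F\<close> prescribes a direction and arbitrary
    on the remaining edges.\<close>
  have "\<exists>p. ed e = {fst p, snd p} \<and> (\<forall>s t. F e s t \<longrightarrow> p = (s, t))" if e: "e \<in> E" for e
  proof (cases "\<exists>s t. F e s t")
    case True
    then obtain s t where st: "F e s t" by blast
    have "(s, t) = (s', t')" if "F e s' t'" for s' t'
    proof -
      have "{s, t} = {s', t'}" using F_ed[OF st] F_ed[OF that] by simp
      then have "s = s' \<and> t = t' \<or> s = t' \<and> t = s'" by (auto simp: doubleton_eq_iff)
      then show ?thesis using anti[OF st] that by auto
    qed
    then show ?thesis using F_ed[OF st] by (intro exI[of _ "(s, t)"]) auto
  next
    case False
    obtain s t where "ed e = {s, t}" using ed2[OF e] by blast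
    then show ?thesis using False by (intro exI[of _ "(s, t)"]) auto
  qed
  then have "\<forall>e\<in>E. \<exists>p. ed e = {fst p, snd p} \<and> (\<forall>s t. F e s t \<longrightarrow> p = (s, t))" by simp
  then obtain p where "\<forall>e\<in>E. ed e = {fst (p e), snd (p e)} \<and> (\<forall>s t. F e s t \<longrightarrow> p e = (s, t))"
    by (rule bchoice[THEN exE])
  then have p: "\<And>e. e \<in> E \<Longrightarrow> ed e = {fst (p e), snd (p e)} \<and> (\<forall>s t. F e s t \<longrightarrow> p e = (s, t))" by simp
  define arc where "arc = (\<lambda>s t. \<exists>e\<in>E. fst (p e) = s \<and> snd (p e) = t)"
  have F_arc: "arc s t" if "F e s t" for e s t
  proof -
    have e: "e \<in> E" using F_ed[OF that] by blast
    have "p e = (s, t)" using p[OF e] that by blast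
    then show ?thesis using e unfolding arc_def by (intro bexI[of _ e]) simp_all
  qed
  interpret A: oriented_half V E ed u v du dv adj f P arc
    by unfold_locales (use F_arc F_def in blast)
  interpret B: oriented_half V E ed v u dv du adj f' P' "\<lambda>s t. arc t s"
    by unfold_locales (use F_arc F_def in blast)
  have attached: "arc s t" if "FX e s t" for e s t using F_arc F_def that by blast
  have C: "arc s t" if "FC e s t" for e s t using F_arc F_def that by blast
  have back_in: "\<exists>d. middle 3 d \<and> arc d c" if c: "C4_deep c" "c \<notin> Pc" for c
  proof -
    obtain d where d: "fc c \<in> E" "middle 3 d" "ed (fc c) = {c, d}" using fc(1)[OF c(1)] by blast
    have "FC (fc c) d c" using d c unfolding FC_def reversed_foot_def C4_deep_def C4_inner_def by (auto simp: insert_commute)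
    then show ?thesis using C d(2) by blast
  qed
  have out3: "\<exists>d. middle 3 d \<and> arc c d" if c: "middle 4 c" "C4_B c \<or> C4_inner c \<and> (C4_deep c \<longrightarrow> c \<in> Pc)" for c
  proof -
    have "\<not> meets_A c" using c unfolding C4_B_def C4_inner_def by blast
    then obtain d where d: "adj c d" "middle 3 d" using C4_C3[OF c(1)] by blast
    obtain e where e: "e \<in> E" "ed e = {c, d}" using d(1) unfolding adj_def by blast
    have "FC e c d" using e d c unfolding FC_def reversed_foot_def by auto
    then show ?thesis using C d(2) by blast
  qed
  have sideways: "arc c w" if cw: "adj c w" "middle 4 c" "middle 4 w" "c_priority c < c_priority w" for c w
  proof -
    obtain e where e: "e \<in> E" "ed e = {c, w}" using cw(1) unfolding adj_def by blast
    have "FC e c w" using e cw unfolding FC_def by auto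
    then show ?thesis by (rule C)
  qed
  have c_priority_simps: "C4_A c \<Longrightarrow> c_priority c = 0" "C4_deep c \<Longrightarrow> c \<notin> Pc \<Longrightarrow> c_priority c = 1" "c \<in> Pc \<Longrightarrow> c_priority c = 2"
    "\<not> C4_A c \<Longrightarrow> \<not> C4_deep c \<Longrightarrow> c_priority c = 3" for c
    using fc(2)[of c] unfolding c_priority_def C4_A_def C4_deep_def C4_inner_def by auto
  have d4: "C4_deep c \<Longrightarrow> middle 4 c" "C4_A c \<Longrightarrow> middle 4 c" for c unfolding C4_deep_def C4_inner_def C4_A_def by blast+
  interpret O: oriented V E ed u v du dv adj f P f' P' arc
  proof
    obtain e where "e \<in> E" "ed e = {u, v}" using adj_uv unfolding adj_def by blast
    then have "FX e u v" unfolding FX_def by blast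
    then show "arc u v" by (rule attached)
  next
    fix s t i assume "adj s t" "sw.side i s" "side i t" "1 \<le> i"
    then show "arc s t" using attached unfolding FX_def adj_def by blast
  next
    fix s t i j assume "adj s t" "sw.side i s" "middle j t"
    then show "arc s t" using attached unfolding FX_def adj_def by blast
  next
    fix s t i j assume "adj s t" "middle j s" "side i t"
    then show "arc s t" using attached unfolding FX_def adj_def by blast
  next
    fix c d assume c: "middle 4 c" "meets_A c" "\<not> sw.meets_A c" "middle 3 d" "adj d c"
    then obtain e where e: "e \<in> E" "ed e = {d, c}" unfolding adj_def by blast
    have "FC e d c" using e c unfolding FC_def C4_A_def by blast
    then show "arc d c" by (rule C)
  next
    fix c d assume c: "middle 4 c" "sw.meets_A c" "\<not> meets_A c" "middle 3 d" "adj c d"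
    then obtain e where e: "e \<in> E" "ed e = {c, d}" unfolding adj_def by blast
    have "FC e c d" using e c unfolding FC_def C4_B_def by blast
    then show "arc c d" by (rule C)
  next
    fix c assume c: "middle 4 c" "\<not> meets_A c" "\<not> sw.meets_A c"
    then have dc: "C4_inner c" unfolding C4_inner_def by blast
    show "(\<exists>d. middle 3 d \<and> arc d c) \<or> (\<exists>e. middle 4 e \<and> arc e c \<and> ((\<exists>d. middle 3 d \<and> arc d e) \<or> meets_A e \<and> sw.meets_A e))"
    proof (cases "C4_deep c")
      case True
      show ?thesis
      proof (cases "c \<in> Pc")
        case False then show ?thesis using back_in[OF True] by blast
      next
        case cP: True
        then obtain w where w: "C4_deep w" "w \<notin> Pc" "adj w c" using fc(3) by blast
        then have "arc w c" using sideways[OF w(3)] d4 True c_priority_simps cP by simp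
        then show ?thesis using back_in[OF w(1,2)] d4(1)[OF w(1)] by blast
      qed
    next
      case False
      then obtain b where b: "adj c b" "C4_A b" using dc unfolding C4_deep_def by blast
      have "\<not> C4_A c" using c unfolding C4_A_def by blast
      then have "arc b c" using sideways[OF adj_sym[OF b(1)] d4(2)[OF b(2)] c(1)] c_priority_simps(1)[OF b(2)] c_priority_simps(4)[OF _ False] by simp
      moreover have "\<exists>d. middle 3 d \<and> arc d b"
      proof -
        have "b \<in> V" "dv b = Suc 3" "\<not> sw.meets_A b" using b(2) unfolding C4_A_def middle_def by simp_all
        then obtain d where d: "adj b d" "middle 3 d" using sw.C4_C3[of b] b(2) unfolding sw_middle C4_A_def by blast
        obtain e where e: "e \<in> E" "ed e = {d, b}" using adj_sym[OF d(1)] unfolding adj_def by blast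
        have "FC e d b" using e d(2) b(2) d4(2)[OF b(2)] unfolding FC_def by blast
        then show ?thesis using C d(2) by blast
      qed
      ultimately show ?thesis using d4(2)[OF b(2)] by blast
    qed
    show "(\<exists>d. middle 3 d \<and> arc c d) \<or> (\<exists>e. middle 4 e \<and> arc c e \<and> ((\<exists>d. middle 3 d \<and> arc e d) \<or> meets_A e \<and> sw.meets_A e))"
    proof (cases "C4_deep c \<and> c \<notin> Pc")
      case False
      then show ?thesis using out3[OF c(1)] dc by blast
    next
      case True
      then have d0: "C4_deep c" "c \<notin> Pc" by blast+
      from fc(4)[OF this] show ?thesis
      proof
        assume "\<exists>w\<in>Pc. adj c w"
        then obtain w where w: "w \<in> Pc" "adj c w" by blast
        note d0w = fc(2)[OF w(1)]
        have "arc c w" using sideways[OF w(2) c(1) d4(1)[OF d0w]] c_priority_simps(2)[OF d0] c_priority_simps(3)[OF w(1)] by simp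
        moreover have "\<exists>d. middle 3 d \<and> arc w d" using out3[OF d4(1)[OF d0w]] d0w w(1) unfolding C4_deep_def by blast
        ultimately show ?thesis using d4(1)[OF d0w] by blast
      next
        assume "C_exit fc c"
        then obtain g d where g: "g \<in> E" "g \<noteq> fc c" "ed g = {c, d}" "middle 3 d \<or> middle 4 d \<and> \<not> C4_deep d \<and> \<not> C4_A d"
          unfolding C_exit_def by blast
        show ?thesis
          using g(4)
        proof
          assume d: "middle 3 d"
          have "FC g c d" using g d c(1) dc unfolding FC_def reversed_foot_def by blast
          then show ?thesis using C d by blast
        next
          assume d: "middle 4 d \<and> \<not> C4_deep d \<and> \<not> C4_A d"
          have "arc c d" using sideways[OF adjI[OF g(1,3)] c(1)] d c_priority_simps(2)[OF d0] c_priority_simps(4)[of d] by simp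
          moreover have "(\<exists>x. middle 3 x \<and> arc d x) \<or> meets_A d \<and> sw.meets_A d"
            using out3[of d] d unfolding C4_B_def C4_inner_def C4_A_def by blast
          ultimately show ?thesis using d by blast
        qed
      qed
    qed
  qed
  interpret O2: oriented_in V E ed u v du dv adj f P f' P' arc by (rule O.oriented_in)
  have "\<forall>x\<in>V. \<forall>y\<in>V. reach arc 13 x y" using O2.all_reach by blast
  then show ?thesis
    using p unfolding arc_def by (intro exI[of _ "\<lambda>e. fst (p e)"] exI[of _ "\<lambda>e. snd (p e)"]) auto
qed

end

section \<open>Transfer to multigraphs\<close>

lemma reach_unfold: "reach R (Suc n) x y \<Longrightarrow> \<exists>z. (x = z \<or> R x z) \<and> reach R n z y"
proof -
  assume "reach R (Suc n) x y"
  then obtain k where k: "k \<le> Suc n" "(R ^^ k) x y" unfolding reach_def by blast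
  show ?thesis
  proof (cases k)
    case 0
    then show ?thesis using k(2) by (intro exI[of _ x]) simp
  next
    case (Suc j)
    then obtain z where "R x z" "(R ^^ j) z y" using k(2) relpowp_Suc_D2 by metis
    then show ?thesis using k(1) Suc unfolding reach_def by auto
  qed
qed

lemma reach_0: "reach R 0 x y \<Longrightarrow> x = y"
  unfolding reach_def by simp

lemma Inf_enat_attained:
  fixes A :: "enat set"
  assumes "Inf A \<le> enat n"
  shows "\<exists>a\<in>A. a \<le> enat n"
proof -
  have "A \<noteq> {}" using assms by (auto simp: Inf_enat_def)
  then have "Inf A \<in> A" unfolding Inf_enat_def using LeastI_ex[of "\<lambda>a. a \<in> A"] by auto
  then show ?thesis using assms by blast
qed

section \<open>Walks and distances in a multigraph\<close>

lemma mwalk_Nil: "mwalk G [x] [] \<longleftrightarrow> x \<in> mverts G"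
  unfolding mwalk_def by simp

lemma mwalk_Cons: "mwalk G (x # y # vs) (e # es) \<longleftrightarrow>
    e \<in> medges G \<and> ends G e = {x, y} \<and> x \<in> mverts G \<and> mwalk G (y # vs) es"
  unfolding mwalk_def by (auto simp: All_less_Suc2)

definition madj :: "('v, 'e) mgraph \<Rightarrow> 'v \<Rightarrow> 'v \<Rightarrow> bool" where
  "madj G s t \<longleftrightarrow> (\<exists>e\<in>medges G. ends G e = {s, t})"

lemma madj_sym: "madj G s t \<Longrightarrow> madj G t s"
  unfolding madj_def by (metis insert_commute)

lemma mwalk_relpow:
  assumes "mwalk G vs es"
  shows "(madj G ^^ length es) (hd vs) (last vs)"
  unfolding relpowp_fun_conv
proof (intro exI[of _ "\<lambda>i. vs ! i"] conjI allI impI)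
  have l: "length vs = Suc (length es)" using assms unfolding mwalk_def by blast
  then have "vs \<noteq> []" by auto
  then show "vs ! 0 = hd vs" "vs ! length es = last vs" using l by (simp_all add: hd_conv_nth last_conv_nth)
  show "madj G (vs ! i) (vs ! Suc i)" if "i < length es" for i
    using assms that nth_mem[OF that] unfolding mwalk_def madj_def by blast
qed

text \<open>Relational powers make the step lemmas immediate. \<open>LEAST\<close> means something
  only if some walk exists; in \<open>long_edge\<close> this is ensured by
  \<open>near\<close>.\<close>

definition gdist :: "('v, 'e) mgraph \<Rightarrow> 'v \<Rightarrow> 'v \<Rightarrow> nat" where
  "gdist G s x = (LEAST n. (madj G ^^ n) s x)"

lemma gdist_le: "(madj G ^^ n) s x \<Longrightarrow> gdist G s x \<le> n"
  unfolding gdist_def by (rule Least_le)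

lemma gdist_relpow: "reach (madj G) k s x \<Longrightarrow> (madj G ^^ gdist G s x) s x \<and> gdist G s x \<le> k"
  unfolding gdist_def reach_def by (metis (mono_tags, lifting) LeastI Least_le le_trans)

section \<open>The level structure of an edge of girth at least 6\<close>

locale long_edge = multigraph G for G :: "('v, 'e) mgraph" +
  fixes e0 :: 'e and u v :: 'v
  assumes near: "x \<in> mverts G \<Longrightarrow> y \<in> mverts G \<Longrightarrow> reach (madj G) 4 x y"
    and no_bridge: "bridgeless G"
    and e0: "e0 \<in> medges G" "ends G e0 = {u, v}"
    and girth: "mcycle G vs es \<Longrightarrow> e0 \<in> set es \<Longrightarrow> 6 \<le> length es"
begin

abbreviation d :: "'v \<Rightarrow> 'v \<Rightarrow> nat" where "d \<equiv> gdist G"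

lemma uv: "u \<noteq> v" "u \<in> mverts G" "v \<in> mverts G"
  using ends_two[OF e0(1)] e0(2) by (auto simp: doubleton_eq_iff)

lemma madjV: "madj G x y \<Longrightarrow> x \<in> mverts G \<and> y \<in> mverts G \<and> x \<noteq> y"
  unfolding madj_def using ends_two by (metis doubleton_eq_iff)

lemma madj_uv: "madj G u v" "madj G v u"
  using e0 unfolding madj_def by auto

lemma d_pow: "s \<in> mverts G \<Longrightarrow> x \<in> mverts G \<Longrightarrow> (madj G ^^ d s x) s x"
  and d_4: "s \<in> mverts G \<Longrightarrow> x \<in> mverts G \<Longrightarrow> d s x \<le> 4"
  using gdist_relpow[OF near] by blast+

lemma d_0: "s \<in> mverts G \<Longrightarrow> x \<in> mverts G \<Longrightarrow> d s x = 0 \<longleftrightarrow> x = s"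
  using d_pow[of s x] gdist_le[of 0 G s x] by auto

lemma d_adj: "s \<in> mverts G \<Longrightarrow> madj G x y \<Longrightarrow> d s y \<le> Suc (d s x)"
  using relpowp_Suc_I[OF d_pow[of s x], of y] madjV[of x y] by (intro gdist_le) blast

lemma d_prev: "s \<in> mverts G \<Longrightarrow> x \<in> mverts G \<Longrightarrow> d s x = Suc n \<Longrightarrow> \<exists>y. madj G x y \<and> d s y = n"
proof -
  assume s: "s \<in> mverts G" and x: "x \<in> mverts G" "d s x = Suc n"
  then have "(madj G ^^ Suc n) s x" using d_pow[OF s x(1)] by simp
  then obtain y where y: "(madj G ^^ n) s y" "madj G y x" by (rule relpowp_Suc_E)
  then have "d s y \<le> n" "Suc n \<le> Suc (d s y)" using gdist_le[OF y(1)] d_adj[OF s y(2)] x(2) by simp_all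
  then show ?thesis using madj_sym[OF y(2)] by (intro exI[of _ y]) simp
qed

lemma d_shift: "madj G s t \<Longrightarrow> x \<in> mverts G \<Longrightarrow> d s x \<le> Suc (d t x)"
  using relpowp_Suc_I2[OF _ d_pow[of t x], of s] madjV[of s t] by (intro gdist_le) blast

lemma d_1: "madj G s x \<Longrightarrow> d s x = 1"
proof -
  assume a: "madj G s x"
  then have "d s x \<noteq> 0" "d s x \<le> 1" using d_0[of s x] madjV[OF a] gdist_le[of 1 G s x] by auto
  then show ?thesis by simp
qed

lemma adj_of_d1: "s \<in> mverts G \<Longrightarrow> x \<in> mverts G \<Longrightarrow> d s x = 1 \<Longrightarrow> madj G s x"
  using d_pow[of s x] relpowp_1[of "madj G"] by metis

lemma d_self: "d u u = 0" "d v v = 0"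
  using d_0 uv by blast+

lemma e0_only:
  assumes "e \<in> medges G" "ends G e = {u, v}"
  shows "e = e0"
proof (rule ccontr)
  assume "e \<noteq> e0"
  then have "mcycle G [u, v, u] [e, e0]"
    using assms e0 uv unfolding mcycle_def by (simp add: mwalk_Cons mwalk_Nil insert_commute)
  then show False using girth by fastforce
qed

lemma no_triangle:
  assumes "x \<in> mverts G" "d u x = 1" "d v x = 1"
  shows False
proof -
  obtain a b where a: "a \<in> medges G" "ends G a = {u, x}" and b: "b \<in> medges G" "ends G b = {v, x}"
    using adj_of_d1[OF uv(2) assms(1,2)] adj_of_d1[OF uv(3) assms(1,3)] unfolding madj_def by blast
  have x: "x \<noteq> u" "x \<noteq> v" using assms d_self by auto
  have "a \<noteq> b" "a \<noteq> e0" "b \<noteq> e0" using a b e0 x uv by (auto simp: doubleton_eq_iff)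
  then have "mcycle G [u, x, v, u] [a, b, e0]"
    using a b e0 uv x assms(1) unfolding mcycle_def by (simp add: mwalk_Cons mwalk_Nil insert_commute)
  then show False using girth by fastforce
qed

lemma no_square:
  assumes "madj G x y" "d u x = 1" "d v x = 2" "d u y = 2" "d v y = 1"
  shows False
proof -
  have V: "x \<in> mverts G" "y \<in> mverts G" using madjV[OF assms(1)] by auto
  obtain a b c where a: "a \<in> medges G" "ends G a = {u, x}" and b: "b \<in> medges G" "ends G b = {v, y}"
    and c: "c \<in> medges G" "ends G c = {x, y}"
    using adj_of_d1[OF uv(2) V(1) assms(2)] adj_of_d1[OF uv(3) V(2) assms(5)] assms(1) unfolding madj_def by blast
  have x: "x \<noteq> u" "x \<noteq> v" "y \<noteq> u" "y \<noteq> v" "x \<noteq> y" using assms d_self by auto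
  have "a \<noteq> b" "a \<noteq> e0" "b \<noteq> e0" "c \<noteq> a" "c \<noteq> b" "c \<noteq> e0" using a b c e0 x uv by (auto simp: doubleton_eq_iff)
  then have "mcycle G [u, x, y, v, u] [a, c, b, e0]"
    using a b c e0 uv x V unfolding mcycle_def by (simp add: mwalk_Cons mwalk_Nil insert_commute)
  then show False using girth by fastforce
qed

lemma no_pentagon:
  assumes x: "x \<in> mverts G" "d u x = 2" "d v x = 2"
  shows False
proof -
  have "d u x = Suc 1" "d v x = Suc 1" using x by simp_all
  then obtain p q where p: "madj G x p" "d u p = 1" and q: "madj G x q" "d v q = 1"
    using d_prev[OF uv(2) x(1), of 1] d_prev[OF uv(3) x(1), of 1] by blast
  have V: "p \<in> mverts G" "q \<in> mverts G" using madjV[OF p(1)] madjV[OF q(1)] by auto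
  obtain a b c c' where a: "a \<in> medges G" "ends G a = {u, p}" and b: "b \<in> medges G" "ends G b = {v, q}"
    and c: "c \<in> medges G" "ends G c = {p, x}" and c': "c' \<in> medges G" "ends G c' = {x, q}"
    using adj_of_d1[OF uv(2) V(1) p(2)] adj_of_d1[OF uv(3) V(2) q(2)] madj_sym[OF p(1)] q(1) unfolding madj_def by blast
  have pq: "p \<noteq> q" using no_triangle V p q by auto
  have "p \<noteq> v" using d_adj[OF uv(3) madj_sym[OF p(1)]] x d_self by auto
  moreover have "q \<noteq> u" using d_adj[OF uv(2) madj_sym[OF q(1)]] x d_self by auto
  moreover have "p \<noteq> u" "q \<noteq> v" "x \<noteq> u" "x \<noteq> v" "x \<noteq> p" "x \<noteq> q" using p q x d_self by auto
  ultimately have n: "p \<noteq> v" "q \<noteq> u" "p \<noteq> u" "q \<noteq> v" "x \<noteq> u" "x \<noteq> v" "x \<noteq> p" "x \<noteq> q" by blast+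
  have "a \<noteq> b" "a \<noteq> e0" "b \<noteq> e0" "c \<noteq> a" "c \<noteq> b" "c \<noteq> e0" "c' \<noteq> a" "c' \<noteq> b" "c' \<noteq> e0" "c \<noteq> c'"
    using a b c c' e0 n pq uv by (auto simp: doubleton_eq_iff)
  then have "mcycle G [u, p, x, q, v, u] [a, c, c', b, e0]"
    using a b c c' e0 uv x V n pq unfolding mcycle_def by (simp add: mwalk_Cons mwalk_Nil insert_commute)
  then show False using girth by fastforce
qed

lemma centre: "x \<in> mverts G \<Longrightarrow> d u x = d v x \<Longrightarrow> 3 \<le> d u x"
proof (rule ccontr)
  assume x: "x \<in> mverts G" "d u x = d v x" "\<not> 3 \<le> d u x"
  then consider "d u x = 0" | "d u x = 1" | "d u x = 2" by linarith
  then show False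
  proof cases
    case 1
    then show False using x(1,2) d_0[OF uv(2) x(1)] d_0[OF uv(3) x(1)] uv(1) by simp
  next
    case 2
    then show False using no_triangle[OF x(1)] x(2) by simp
  next
    case 3
    then show False using no_pentagon[OF x(1)] x(2) by simp
  qed
qed

text \<open>Deleting \<open>e\<close> leaves a connected graph, so some path from \<open>x\<close>
  to another vertex avoids \<open>e\<close>, and its first edge is as wanted. If \<open>e\<close> is
  no edge, deleting \<open>e0\<close> still yields an edge at \<open>x\<close>.\<close>

lemma two_edges:
  assumes "x \<in> mverts G"
  shows "\<exists>g\<in>medges G. g \<noteq> e \<and> x \<in> ends G g"
proof -
  have *: "\<exists>g\<in>medges G. g \<noteq> e \<and> x \<in> ends G g" if e: "e \<in> medges G" for e
  proof -
    obtain y where y: "y \<in> mverts G" "y \<noteq> x" using uv by blast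
    have "mconnected (del_edge G e)" using no_bridge e unfolding bridgeless_def by blast
    moreover have "mverts (del_edge G e) = mverts G" by (simp add: del_edge_def)
    ultimately obtain vs es where p: "mpath (del_edge G e) x vs es y"
      using assms y(1) unfolding mconnected_def by metis
    then have w: "mwalk (del_edge G e) vs es" "hd vs = x" "last vs = y" unfolding mpath_def by blast+
    have l: "length vs = Suc (length es)" using w(1) unfolding mwalk_def by blast
    have "es \<noteq> []"
    proof
      assume "es = []"
      then obtain z where "vs = [z]" using l by (cases vs) auto
      then show False using w y by simp
    qed
    then have "es ! 0 \<in> set es" "ends (del_edge G e) (es ! 0) = {vs ! 0, vs ! Suc 0}"
      using w(1) unfolding mwalk_def by simp_all
    moreover have "set es \<subseteq> medges G - {e}" using w(1) unfolding mwalk_def del_edge_def by simp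
    moreover have "vs ! 0 = x" using w(2) l by (cases vs) auto
    ultimately show ?thesis by (intro bexI[of _ "es ! 0"]) (auto simp: del_edge_def)
  qed
  show ?thesis
  proof (cases "e \<in> medges G")
    case False
    moreover obtain g where "g \<in> medges G" "x \<in> ends G g" using *[OF e0(1)] by blast
    ultimately show ?thesis by (intro bexI[of _ g]) auto
  qed (rule *)
qed

text \<open>A path from \<open>u\<close> to \<open>v\<close> that avoids \<open>e0\<close> has to
  leave the set of vertices closer to \<open>u\<close>. It cannot leave at level 0, where only
  \<open>e0\<close> itself would do so, nor at level 1, where it would close a cycle of length 4 or
  5. So it leaves at level 2 or 3, and a vertex at level 3 has a neighbour at level 2.\<close>

lemma ex_A2: "\<exists>x\<in>mverts G. d u x = 2 \<and> d v x = 3"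
proof -
  have "mconnected (del_edge G e0)" using no_bridge e0 unfolding bridgeless_def by blast
  moreover have "mverts (del_edge G e0) = mverts G" by (simp add: del_edge_def)
  ultimately obtain vs es where p: "mpath (del_edge G e0) u vs es v"
    using uv unfolding mconnected_def by metis
  then have w: "mwalk (del_edge G e0) vs es" "hd vs = u" "last vs = v" unfolding mpath_def by blast+
  have l: "length vs = Suc (length es)" using w(1) unfolding mwalk_def by blast
  then have "vs \<noteq> []" by auto
  then have h: "vs ! 0 = u" "vs ! length es = v" using w(2,3) l by (simp_all add: hd_conv_nth last_conv_nth)
  have "\<exists>i<length es. d u (vs ! i) < d v (vs ! i) \<and> \<not> d u (vs ! Suc i) < d v (vs ! Suc i)"
  proof (rule ccontr)
    assume no: "\<not> ?thesis"
    have "i \<le> length es \<Longrightarrow> d u (vs ! i) < d v (vs ! i)" for i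
    proof (induction i)
      case 0 then show ?case using h d_0[of u u] d_1[OF madj_uv(2)] uv by simp
    next
      case (Suc i) then show ?case using no by simp
    qed
    from this[of "length es"] show False using h d_0[of v v] uv by simp
  qed
  then obtain i where i: "i < length es" "d u (vs ! i) < d v (vs ! i)" "\<not> d u (vs ! Suc i) < d v (vs ! Suc i)" by blast
  define x y e where "x = vs ! i" and "y = vs ! Suc i" and "e = es ! i"
  have e: "e \<in> medges G" "e \<noteq> e0" "ends G e = {x, y}"
  proof -
    have "set es \<subseteq> medges G - {e0}" "ends G (es ! i) = {vs ! i, vs ! Suc i}"
      using w(1) i(1) unfolding mwalk_def del_edge_def by simp_all
    then show "e \<in> medges G" "e \<noteq> e0" "ends G e = {x, y}"
      using nth_mem[OF i(1)] unfolding e_def x_def y_def by blast+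
  qed
  then have xy: "madj G x y" unfolding madj_def by blast
  note V = madjV[OF xy]
  have lt: "d u x < d v x" "d v y \<le> d u y" using i unfolding x_def y_def by simp_all
  have s: "d u x \<le> Suc (d u y)" "d u y \<le> Suc (d u x)" "d v x \<le> Suc (d v y)" "d v x \<le> Suc (d u x)" "d v x \<le> 4"
    using d_adj[OF uv(2) xy] d_adj[OF uv(2) madj_sym[OF xy]] d_adj[OF uv(3) madj_sym[OF xy]] d_shift[OF madj_uv(2), of x] d_4[OF uv(3)] V by blast+
  have ne: "d u x \<noteq> 0"
  proof
    assume 0: "d u x = 0"
    then have "x = u" using d_0[OF uv(2), of x] V by blast
    have "d u y \<le> 1" using s(2) 0 by simp
    then have "d v y = 0" using centre[of y] lt V by (cases "d v y = d u y") auto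
    then have "y = v" using d_0[OF uv(3), of y] V by blast
    then show False using e e0_only \<open>x = u\<close> by blast
  qed
  have n1: "d u x \<noteq> 1"
  proof
    assume 1: "d u x = 1"
    have x2: "d v x = 2" using 1 lt s by simp
    then have "d u y \<le> 2" "1 \<le> d v y" using s 1 by simp_all
    moreover have "d u y \<noteq> d v y" using centre[of y] V calculation by auto
    ultimately have "d u y = 2" "d v y = 1" using lt by linarith+
    then show False using no_square[OF xy 1 x2] by blast
  qed
  have dx: "d v x = Suc (d u x)" using lt s by linarith
  consider "d u x = 2" | "d u x = 3" using ne n1 dx s(5) by linarith
  then show ?thesis
  proof cases
    case 1 then show ?thesis using dx V by auto
  next
    case 2
    then have "d u x = Suc 2" by simp
    then obtain w where w: "madj G x w" "d u w = 2" using d_prev[OF uv(2), of x 2] V by blast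
    have "3 \<le> d v w" using d_adj[OF uv(3) madj_sym[OF w(1)]] dx 2 by simp
    moreover have "d v w \<le> 3" using d_shift[OF madj_uv(2), of w] madjV[OF w(1)] w(2) by simp
    ultimately show ?thesis using w madjV[OF w(1)] by auto
  qed
qed

lemma swap: "long_edge G e0 v u"
  using near no_bridge e0 girth by unfold_locales (auto simp: insert_commute)

end

context long_edge
begin

lemma levels: "levels (mverts G) (medges G) (ends G) u v (d u) (d v) (madj G)"
proof
  interpret sw: long_edge G e0 v u by (rule swap)
  show "madj G s t \<longleftrightarrow> (\<exists>e\<in>medges G. ends G e = {s, t})" for s t by (rule madj_def)
  show "finite (mverts G)" by (rule finite_mverts)
  show "e \<in> medges G \<Longrightarrow> \<exists>s\<in>mverts G. \<exists>t\<in>mverts G. s \<noteq> t \<and> ends G e = {s, t}" for e by (rule ends_two)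
  show "u \<in> mverts G" "v \<in> mverts G" by (fact uv)+
  show "d u v = Suc 0" "d v u = Suc 0" using d_1[OF madj_uv(1)] d_1[OF madj_uv(2)] by simp_all
  show "x \<in> mverts G \<Longrightarrow> (d u x = 0) = (x = u)" "x \<in> mverts G \<Longrightarrow> (d v x = 0) = (x = v)" for x
    by - ((rule d_0[OF uv(2)]; assumption), (rule d_0[OF uv(3)]; assumption))
  show "x \<in> mverts G \<Longrightarrow> d u x \<le> 4" "x \<in> mverts G \<Longrightarrow> d v x \<le> 4" for x
    by - ((rule d_4[OF uv(2)]; assumption), (rule d_4[OF uv(3)]; assumption))
  show "madj G x y \<Longrightarrow> d u y \<le> Suc (d u x)" "madj G x y \<Longrightarrow> d v y \<le> Suc (d v x)" for x y
    by - ((rule d_adj[OF uv(2)]; assumption), (rule d_adj[OF uv(3)]; assumption))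
  show "x \<in> mverts G \<Longrightarrow> d u x \<le> Suc (d v x)" "x \<in> mverts G \<Longrightarrow> d v x \<le> Suc (d u x)" for x
    by - ((rule d_shift[OF madj_uv(1)]; assumption), (rule d_shift[OF madj_uv(2)]; assumption))
  show "x \<in> mverts G \<Longrightarrow> d u x = Suc n \<Longrightarrow> \<exists>y. madj G x y \<and> d u y = n"
    "x \<in> mverts G \<Longrightarrow> d v x = Suc n \<Longrightarrow> \<exists>y. madj G x y \<and> d v y = n" for x n
    by - ((rule d_prev[OF uv(2)]; assumption), (rule d_prev[OF uv(3)]; assumption))
  show "x \<in> mverts G \<Longrightarrow> d u x = d v x \<Longrightarrow> 3 \<le> d u x" for x by (rule centre)
  show "\<not> (d u x = 1 \<and> d v x = 2 \<and> d u y = 2 \<and> d v y = 1)" if "madj G x y" for x y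
    using no_square[OF that] by blast
  show "e = e'" if "e \<in> medges G" "e' \<in> medges G" "ends G e = {u, v}" "ends G e' = {u, v}" for e e'
    using e0_only[OF that(1,3)] e0_only[OF that(2,4)] by simp
  show "madj G u v" by (rule madj_uv)
  show "\<exists>a b c. (x = a \<or> madj G x a) \<and> (a = b \<or> madj G a b) \<and> (b = c \<or> madj G b c) \<and> (c = y \<or> madj G c y)"
    if xy: "x \<in> mverts G" "y \<in> mverts G" for x y
  proof -
    have "reach (madj G) (Suc (Suc (Suc (Suc 0)))) x y" using near[OF xy] by (simp add: numeral_eq_Suc)
    then obtain a where a: "x = a \<or> madj G x a" "reach (madj G) (Suc (Suc (Suc 0))) a y" using reach_unfold[of _ _ x y] by blast
    obtain b where b: "a = b \<or> madj G a b" "reach (madj G) (Suc (Suc 0)) b y" using reach_unfold[OF a(2)] by blast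
    obtain c where c: "b = c \<or> madj G b c" "reach (madj G) (Suc 0) c y" using reach_unfold[OF b(2)] by blast
    obtain z where z: "c = z \<or> madj G c z" "reach (madj G) 0 z y" using reach_unfold[OF c(2)] by blast
    then show ?thesis using a(1) b(1) c(1) reach_0[OF z(2)] by (intro exI[of _ a] exI[of _ b] exI[of _ c]) simp
  qed
  show "x \<in> mverts G \<Longrightarrow> \<exists>g\<in>medges G. g \<noteq> e \<and> x \<in> ends G g" for x e by (rule two_edges)
  show "\<exists>x\<in>mverts G. d u x = 2 \<and> d v x = 3" by (rule ex_A2)
  show "\<exists>x\<in>mverts G. d u x = 3 \<and> d v x = 2" using sw.ex_A2 by blast
qed

end

section \<open>From bounded reachability to directed paths\<close>

context wf_digraph
begin

lemma apath_of_awalk: "awalk x p y \<Longrightarrow> \<exists>q. apath x q y \<and> length q \<le> length p"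
proof (induction "length p" arbitrary: p rule: less_induct)
  case less
  show ?case
  proof (cases "distinct (awalk_verts x p)")
    case True
    then show ?thesis using less.prems unfolding apath_def by blast
  next
    case False
    obtain q r s where p: "p = q @ r @ s" "\<exists>w. awalk x q w \<and> awalk w r w \<and> awalk w s y" "closed_w r"
      using awalk_cyc_decompE'[OF less.prems False] by metis
    have "r \<noteq> []" using p(3) unfolding closed_w_def by auto
    moreover have "awalk x (q @ s) y" using p(2) awalk_appendI by blast
    ultimately obtain q' where "apath x q' y" "length q' \<le> length (q @ s)"
      using less.hyps[of "q @ s"] p(1) by auto
    then show ?thesis using p(1) by (intro exI[of _ q']) simp
  qed
qed

lemma awalk_of_relpow:
  "((\<lambda>s t. \<exists>e\<in>arcs G. tail G e = s \<and> head G e = t) ^^ k) x y \<Longrightarrow> x \<in> verts G \<Longrightarrow> \<exists>p. awalk x p y \<and> length p = k"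
proof (induction k arbitrary: x)
  case 0
  then show ?case using awalk_Nil_iff by auto
next
  case (Suc k)
  from Suc.prems(1) obtain z where z: "\<exists>e\<in>arcs G. tail G e = x \<and> head G e = z"
    "((\<lambda>s t. \<exists>e\<in>arcs G. tail G e = s \<and> head G e = t) ^^ k) z y" by (rule relpowp_Suc_E2)
  then obtain e where e: "e \<in> arcs G" "tail G e = x" "head G e = z" by blast
  then have "z \<in> verts G" using head_in_verts by blast
  then obtain p where "awalk z p y" "length p = k" using Suc.IH[OF z(2)] by blast
  then show ?case using e by (intro exI[of _ "e # p"]) (simp add: awalk_Cons_iff)
qed

lemma apath_of_reach:
  assumes "reach (\<lambda>s t. \<exists>e\<in>arcs G. tail G e = s \<and> head G e = t) n x y" "x \<in> verts G"
  shows "\<exists>p. apath x p y \<and> length p \<le> n"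
proof -
  obtain k p where "k \<le> n" "awalk x p y" "length p = k"
    using assms awalk_of_relpow unfolding reach_def by blast
  then show ?thesis using apath_of_awalk[of x p y] le_trans by blast
qed

end

lemma reach_of_mdist:
  assumes "mdist G x y \<le> enat n"
  shows "reach (madj G) n x y"
proof -
  obtain a where a: "a \<in> (\<lambda>(vs, es). enat (length es)) ` {(vs, es). mpath G x vs es y}" "a \<le> enat n"
    using Inf_enat_attained assms unfolding mdist_def by blast
  then obtain vs es where p: "mpath G x vs es y" "length es \<le> n" by auto
  then show ?thesis using mwalk_relpow[of G vs es] unfolding mpath_def reach_def by auto
qed

theorem theorem1p4:
  fixes G :: "('v, 'e) mgraph"
  assumes "multigraph G"
    and "mconnected G"
    and "bridgeless G"
    and "mdiameter G = 4"
    and "max_edge_girth G \<in> {6, 7, 8}"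
  shows "(\<exists>D. orientation G D \<and> ddiameter D \<le> 13) \<and> oriented_diameter G \<le> 13"
proof -
  interpret multigraph G by fact
  have near: "reach (madj G) 4 x y" if "x \<in> mverts G" "y \<in> mverts G" for x y
  proof -
    have "mdist G x y \<le> (SUP v\<in>mverts G. mdist G x v)" by (rule SUP_upper[OF that(2)])
    also have "\<dots> \<le> mdiameter G" unfolding mdiameter_def by (rule SUP_upper[OF that(1)])
    finally have "mdist G x y \<le> enat 4" using assms(4) by (simp add: numeral_eq_enat)
    then show ?thesis by (rule reach_of_mdist)
  qed
  have "\<exists>e0\<in>medges G. 6 \<le> edge_girth G e0"
  proof (rule ccontr)
    assume no: "\<not> ?thesis"
    have "edge_girth G e \<le> 5" if "e \<in> medges G" for e
    proof -
      have "edge_girth G e < 6" using no that by auto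
      then show ?thesis by (cases "edge_girth G e") (auto simp: numeral_eq_enat)
    qed
    then have "max_edge_girth G \<le> 5" unfolding max_edge_girth_def by (rule SUP_least)
    then show False using assms(5) by (auto simp: numeral_eq_enat)
  qed
  then obtain e0 where e0: "e0 \<in> medges G" "6 \<le> edge_girth G e0" by blast
  obtain u v where uv: "ends G e0 = {u, v}" using ends_two[OF e0(1)] by blast
  have "6 \<le> length es" if "mcycle G vs es" "e0 \<in> set es" for vs es
  proof -
    have "edge_girth G e0 \<le> enat (length es)"
      unfolding edge_girth_def using that by (intro INF_lower2[of "(vs, es)"]) auto
    then have "6 \<le> enat (length es)" using e0(2) by (rule order_trans[rotated])
    then show ?thesis by (simp add: numeral_eq_enat)
  qed
  then interpret long_edge G e0 u v
    using near assms(3) e0(1) uv by unfold_locales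
  interpret levels "mverts G" "medges G" "ends G" u v "gdist G u" "gdist G v" "madj G" by (rule levels)
  obtain ta he where o: "\<forall>e\<in>medges G. {ta e, he e} = ends G e"
    "\<forall>x\<in>mverts G. \<forall>y\<in>mverts G. reach (\<lambda>s t. \<exists>e\<in>medges G. ta e = s \<and> he e = t) 13 x y"
    using good_orientation by (elim exE conjE)
  define D where "D = \<lparr>verts = mverts G, arcs = medges G, tail = ta, head = he\<rparr>"
  have D: "orientation G D" using o(1) unfolding orientation_def D_def by simp
  interpret D: wf_digraph D
  proof
    fix e assume "e \<in> arcs D"
    then have "{ta e, he e} = ends G e" "ends G e \<subseteq> mverts G"
      using o(1) ends_two[of e] unfolding D_def by auto
    then show "tail D e \<in> verts D" "head D e \<in> verts D" unfolding D_def by auto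
  qed
  have path: "\<exists>p. D.apath x p y \<and> length p \<le> 13" if "x \<in> mverts G" "y \<in> mverts G" for x y
    using D.apath_of_reach[of 13 x y] o(2) that unfolding D_def by simp
  have dist: "ddist D x y \<le> 13" if xy: "x \<in> mverts G" "y \<in> mverts G" for x y
  proof -
    obtain p where p: "D.apath x p y" "length p \<le> 13" using path[OF xy] by blast
    have "ddist D x y \<le> enat (length p)" unfolding ddist_def using p(1) by (intro INF_lower) simp
    also have "\<dots> \<le> 13" using p(2) by (simp add: numeral_eq_enat)
    finally show ?thesis .
  qed
  have diam: "ddiameter D \<le> 13"
    unfolding ddiameter_def using dist by (intro SUP_least) (simp add: D_def)
  have "strongly_connected D"
  proof (rule strongly_connectedI)
    show "verts D \<noteq> {}" using uV unfolding D_def by auto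
    show "x \<rightarrow>\<^sup>*\<^bsub>D\<^esub> y" if "x \<in> verts D" "y \<in> verts D" for x y
      using path[of x y] that D.reachable_apath unfolding D_def by auto
  qed
  then have "oriented_diameter G \<le> ddiameter D"
    unfolding oriented_diameter_def using D by (intro INF_lower) simp
  then show ?thesis using D diam order_trans by blast
qed

end
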